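(* Let $d\in\mathbb{N}$, $d\geq3$, let $\beta\in(1,2)$ be the $d$-Bonacci number, and let $h\in\{1,2,\dots,d-1\}$. Put $$\mathcal{L}_h=\Bigl([h]\cap\bigl[1-\tfrac\beta2,\tfrac12\bigr)\Bigr)\cup\Bigl([h-d]\cap\bigl[-\tfrac12,\tfrac\beta2-1\bigr)\Bigr),$$ where $[j]=j+(\beta-1)\mathbb{Z}[\beta]$. Then the collection of tiles $\{\mathcal{R}(x): x\in\mathcal{L}_h\}$ forms a tiling of $\mathbb{R}^{d-1}$ (i.e., it is a layer of the multiple tiling $\{\mathcal{R}(x)\}_{x\in\mathbb{Z}[\beta]\cap X_S}$, which has covering degree $d-1$).
   Context: The $d$-Bonacci number is the Pisot number $\beta\in(1,2)$ satisfying $\beta^d=\beta^{d-1}+\dots+\beta+1$; it is an algebraic unit of degree $d$. Let $X_S=[-\tfrac12,\tfrac\beta2-1)\cup[1-\tfrac\beta2,\tfrac12)$ and $T_S\colon X_S\to X_S$, $T_S(x)=\beta x-\lfloor\beta x-\tfrac12\rfloor$. Let $\beta_{(1)},\dots,\beta_{(e)}$ (together with their complex conjugates) be the non-real Galois conjugates of $\beta$ and $\beta_{(e+1)},\dots,\beta_{(d-e-1)}$ the real Galois conjugates other than $\beta$, with field isomorphisms $\sigma_{(j)}\colon\mathbb{Q}(\beta)\to\mathbb{Q}(\beta_{(j)})$; define $\Phi\colon\mathbb{Q}(\beta)\to\mathbb{C}^e\times\mathbb{R}^{d-2e-1}\cong\mathbb{R}^{d-1}$, $\Phi(x)=(\sigma_{(1)}(x),\dots,\sigma_{(d-e-1)}(x))$.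 For $x\in\mathbb{Z}[\beta]\cap X_S$, $\mathcal{R}(x)$ is the Hausdorff limit $\lim_{n\to\infty}\Phi(\beta^nT_S^{-n}(x))$, $T_S^{-n}(x)$ being the set of preimages of $x$ in $X_S$. A collection of sets forms a tiling of $\mathbb{R}^{d-1}$ if its members take finitely many shapes up to translation, it is locally finite, covers $\mathbb{R}^{d-1}$, each member is the closure of its interior, and almost every point of $\mathbb{R}^{d-1}$ lies in exactly one member.
   Formalization: The transformation is taken as T_S(x) = βx − ⌊βx + 1/2⌋; with the printed ⌊βx − 1/2⌋ its values lie in [1/2, 3/2), outside X_S, so T_S would not map X_S to itself and all preimage sets would be empty. *)

theory Defs
  imports "HOL-Analysis.Analysis" "HOL-Computational_Algebra.Computational_Algebra"
begin

section \<open>The base and its conjugates\<close>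

text \<open>The equation has a unique solution in the interval (1,2), and this solution is a Pisot
  unit of degree \<open>d\<close>; these properties are consequences and not part of the definition.\<close>

definition dBonacci :: "nat \<Rightarrow> real \<Rightarrow> bool" where
  "dBonacci d \<beta> \<longleftrightarrow> 1 < \<beta> \<and> \<beta> < 2 \<and> \<beta> ^ d = (\<Sum>i<d. \<beta> ^ i)"

definition int_adjoin :: "real \<Rightarrow> real set" where
  "int_adjoin \<beta> = {poly (map_poly of_int p) \<beta> | p :: int poly. True}"

definition rat_field_adjoin :: "'a::field_char_0 \<Rightarrow> 'a set" where
  "rat_field_adjoin b =
     {poly (map_poly of_rat p) b / poly (map_poly of_rat q) b | p q :: rat poly.
        poly (map_poly of_rat q) b \<noteq> 0}"

text \<open>An irreducible rational polynomial vanishing at \<open>\<beta>\<close> is, up to a constant factor, the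
  minimal polynomial of \<open>\<beta>\<close>. In particular \<open>\<beta>\<close> counts as a conjugate of itself.\<close>

definition galois_conjugate :: "real \<Rightarrow> complex \<Rightarrow> bool" where
  "galois_conjugate \<beta> z \<longleftrightarrow>
     (\<exists>p :: rat poly. irreducible p \<and> poly (map_poly of_rat p) \<beta> = 0 \<and>
        poly (map_poly of_rat p) z = 0)"

text \<open>The numbers \<open>\<gamma> 1, \<dots>, \<gamma> e\<close> are one representative of each pair of non-real conjugates,
  and \<open>\<gamma> (e + 1), \<dots>, \<gamma> (d - e - 1)\<close> are the real conjugates other than \<open>\<beta>\<close>.\<close>

definition conjugate_enumeration :: "nat \<Rightarrow> real \<Rightarrow> nat \<Rightarrow> (nat \<Rightarrow> complex) \<Rightarrow> bool" where
  "conjugate_enumeration d \<beta> e \<gamma> \<longleftrightarrow>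
     2 * e < d \<and> inj_on \<gamma> {1..d - e - 1} \<and>
     \<gamma> ` {1..e} \<inter> cnj ` \<gamma> ` {1..e} = {} \<and>
     \<gamma> ` {1..e} \<union> cnj ` \<gamma> ` {1..e} = {z. galois_conjugate \<beta> z \<and> z \<notin> \<real>} \<and>
     \<gamma> ` {e + 1..d - e - 1} = {z. galois_conjugate \<beta> z \<and> z \<in> \<real> \<and> z \<noteq> of_real \<beta>}"

definition field_iso_on :: "'a::field set \<Rightarrow> 'b::field set \<Rightarrow> ('a \<Rightarrow> 'b) \<Rightarrow> bool" where
  "field_iso_on K L f \<longleftrightarrow>
     bij_betw f K L \<and> f 1 = 1 \<and>
     (\<forall>x\<in>K. \<forall>y\<in>K. f (x + y) = f x + f y \<and> f (x * y) = f x * f y)"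

text \<open>The identification of \<open>\<complex>\<^sup>e \<times> \<real>\<^bsup>d-2e-1\<^esup>\<close> with \<open>\<real>\<^bsup>d-1\<^esup>\<close>: the numbering \<open>\<iota>\<close> of the
  coordinates by \<open>{1..d - 1}\<close> lists first the real parts and then the imaginary parts of the
  \<open>e\<close> complex components, followed by the \<open>d - 2e - 1\<close> real components.\<close>

definition embed ::
    "nat \<Rightarrow> (nat \<Rightarrow> real \<Rightarrow> complex) \<Rightarrow> ('n::finite \<Rightarrow> nat) \<Rightarrow> real \<Rightarrow> real ^ 'n" where
  "embed e \<sigma> \<iota> x = (\<chi> i.
     if \<iota> i \<le> e then Re (\<sigma> (\<iota> i) x)
     else if \<iota> i \<le> 2 * e then Im (\<sigma> (\<iota> i - e) x)
     else Re (\<sigma> (\<iota> i - e) x))"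

section \<open>The symmetric beta-transformation\<close>

definition XS_neg :: "real \<Rightarrow> real set" where
  "XS_neg \<beta> = {-1/2..<\<beta>/2 - 1}"

definition XS_pos :: "real \<Rightarrow> real set" where
  "XS_pos \<beta> = {1 - \<beta>/2..<1/2}"

definition XS :: "real \<Rightarrow> real set" where
  "XS \<beta> = XS_neg \<beta> \<union> XS_pos \<beta>"

text \<open>The subtracted integer is the one for which the value lies in \<open>[-1/2, 1/2)\<close>, as is
  necessary for a map from \<open>XS \<beta>\<close> to itself. (With \<open>\<beta> * x - 1/2\<close> under the floor, the
  values would lie in \<open>[1/2, 3/2)\<close>, outside \<open>XS \<beta>\<close>.)\<close>

definition TS :: "real \<Rightarrow> real \<Rightarrow> real" where
  "TS \<beta> x = \<beta> * x - of_int \<lfloor>\<beta> * x + 1/2\<rfloor>"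

definition TS_preimage :: "real \<Rightarrow> nat \<Rightarrow> real \<Rightarrow> real set" where
  "TS_preimage \<beta> n x = {y \<in> XS \<beta>. (TS \<beta> ^^ n) y = x}"

section \<open>Tiles\<close>

definition hausdorff_tendsto :: "(nat \<Rightarrow> 'a::metric_space set) \<Rightarrow> 'a set \<Rightarrow> bool" where
  "hausdorff_tendsto A K \<longleftrightarrow>
     (\<forall>\<epsilon>>0. \<forall>\<^sub>F n in sequentially.
        (\<forall>a\<in>A n. \<exists>k\<in>K. dist a k < \<epsilon>) \<and> (\<forall>k\<in>K. \<exists>a\<in>A n. dist a k < \<epsilon>))"

text \<open>Compactness (in fact closedness) makes the limit unique.\<close>

definition hausdorff_lim :: "(nat \<Rightarrow> 'a::metric_space set) \<Rightarrow> 'a set" where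
  "hausdorff_lim A = (THE K. compact K \<and> hausdorff_tendsto A K)"

definition tile ::
    "real \<Rightarrow> nat \<Rightarrow> (nat \<Rightarrow> real \<Rightarrow> complex) \<Rightarrow> ('n::finite \<Rightarrow> nat) \<Rightarrow> real \<Rightarrow> (real ^ 'n) set" where
  "tile \<beta> e \<sigma> \<iota> x =
     hausdorff_lim (\<lambda>n. (\<lambda>y. embed e \<sigma> \<iota> (\<beta> ^ n * y)) ` TS_preimage \<beta> n x)"

section \<open>Tilings\<close>

text \<open>Collections are indexed families, so that members are counted with multiplicity. For
  \<open>m > 0\<close>, the condition on \<open>card\<close> includes finiteness.\<close>

definition multiple_tiling :: "nat \<Rightarrow> 'i set \<Rightarrow> ('i \<Rightarrow> 'a::euclidean_space set) \<Rightarrow> bool" where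
  "multiple_tiling m I R \<longleftrightarrow>
     (\<exists>\<S>. finite \<S> \<and> (\<forall>i\<in>I. \<exists>S\<in>\<S>. \<exists>t. R i = (\<lambda>s. t + s) ` S)) \<and>
     (\<forall>z. \<exists>U. open U \<and> z \<in> U \<and> finite {i \<in> I. R i \<inter> U \<noteq> {}}) \<and>
     (\<Union>i\<in>I. R i) = UNIV \<and>
     (\<forall>i\<in>I. R i = closure (interior (R i))) \<and>
     (AE z in lborel. card {i \<in> I. z \<in> R i} = m)"

definition tiling :: "'i set \<Rightarrow> ('i \<Rightarrow> 'a::euclidean_space set) \<Rightarrow> bool" where
  "tiling I R \<longleftrightarrow> multiple_tiling 1 I R"

definition residue_class :: "real \<Rightarrow> int \<Rightarrow> real set" where
  "residue_class \<beta> j = {of_int j + (\<beta> - 1) * z | z. z \<in> int_adjoin \<beta>}"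

definition layer_index :: "nat \<Rightarrow> real \<Rightarrow> nat \<Rightarrow> real set" where
  "layer_index d \<beta> h =
     (residue_class \<beta> (int h) \<inter> XS_pos \<beta>) \<union> (residue_class \<beta> (int h - int d) \<inter> XS_neg \<beta>)"

end

theory Submission
  imports Defs
begin

text \<open>
  Taking fractional parts conjugates \<open>TS \<beta>\<close> to the map \<open>v \<mapsto> \<beta> v - (\<beta> - 1) a\<close>, \<open>a = [v \<ge> 1/2]\<close>, of
  the interval \<open>[1 - \<beta>/2, \<beta>/2)\<close>. This map preserves the \<open>d - 1\<close> residue classes modulo
  \<open>(\<beta> - 1) \<int>[\<beta>]\<close>, and the layers become exactly these classes.

  The covering property is the usual consequence of the relative density of each class. To see that
  each class covers almost every point only once, follow two points whose difference is
  \<open>(\<beta> - 1)\<close> times a subset sum of \<open>\<beta>\<^sup>-\<^sup>1, \<dots>, \<beta>\<^sup>-\<^sup>d\<close>, up to sign: such differences are preserved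
  by the map, and they vanish after one of the points has read \<open>d\<close> digits 1 (and \<open>d\<close> further digits).
  Every difference in \<open>(\<beta> - 1) \<int>[\<beta>]\<close> is a chain of steps \<open>\<plusminus> (\<beta> - 1) \<beta>\<^sup>-\<^sup>i\<close>, and since
  \<open>\<beta>\<^sup>-\<^sup>i + \<beta>\<^sup>-\<^sup>j \<le> 1\<close> the steps can be ordered so as to stay in the interval. Hence a word
  with many blocks \<open>1\<^sup>d 0\<^sup>d\<close> synchronizes the finitely many neighbours of a tile, so that every tile
  contains a ball, at a uniform scale, that meets no other tile of its layer. This gives the closure
  property of the tiles. The overlaps are invariant under the inverse of the contraction, which copies
  these holes to all scales, so the overlaps form a closed porous set, which is null.
\<close>

section \<open>Hausdorff limits and multiple tilings\<close>

lemma hausdorff_tendsto_subset: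
  assumes "hausdorff_tendsto A K" "hausdorff_tendsto A L" "closed L"
  shows "K \<subseteq> L"
proof
  fix x assume "x \<in> K"
  have "\<exists>y\<in>L. dist y x < \<epsilon>" if "\<epsilon> > 0" for \<epsilon>
  proof -
    have close: "\<forall>\<^sub>F n in sequentially.
        (\<forall>a\<in>A n. \<exists>k\<in>S. dist a k < \<epsilon>/2) \<and> (\<forall>k\<in>S. \<exists>a\<in>A n. dist a k < \<epsilon>/2)"
      if "hausdorff_tendsto A S" for S
      using that \<open>\<epsilon> > 0\<close> unfolding hausdorff_tendsto_def by (meson half_gt_zero)
    obtain n where K_close: "\<forall>k\<in>K. \<exists>a\<in>A n. dist a k < \<epsilon>/2"
      and L_close: "\<forall>a\<in>A n. \<exists>y\<in>L. dist a y < \<epsilon>/2"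
      using eventually_conj[OF close[OF assms(1)] close[OF assms(2)]]
      by (auto simp: eventually_sequentially)
    obtain a where a_in: "a \<in> A n" and a_close: "dist a x < \<epsilon>/2" using K_close \<open>x \<in> K\<close> by blast
    obtain y where "y \<in> L" "dist a y < \<epsilon>/2" using L_close a_in by blast
    then show ?thesis using a_close dist_triangle_half_r[of a y \<epsilon> x] by blast
  qed
  then show "x \<in> L" using assms(3) closed_approachable by blast
qed

lemma hausdorff_lim_eqI:
  assumes "compact K" "hausdorff_tendsto A K"
  shows "hausdorff_lim A = K"
  unfolding hausdorff_lim_def
  using assms hausdorff_tendsto_subset compact_imp_closed
  by (intro the_equality) (blast intro: subset_antisym)+

lemma hausdorff_tendstoI:
  assumes "\<delta> \<longlonglongrightarrow> (0::real)"
    and "\<And>n a. a \<in> A n \<Longrightarrow> \<exists>k\<in>K. dist a k \<le> \<delta> n"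
    and "\<And>n k. k \<in> K \<Longrightarrow> \<exists>a\<in>A n. dist a k \<le> \<delta> n"
  shows "hausdorff_tendsto A K"
  unfolding hausdorff_tendsto_def
proof (intro allI impI)
  fix \<epsilon> :: real assume "\<epsilon> > 0"
  then have "\<forall>\<^sub>F n in sequentially. \<delta> n < \<epsilon>" using order_tendstoD(2)[OF assms(1)] by simp
  then show "\<forall>\<^sub>F n in sequentially.
      (\<forall>a\<in>A n. \<exists>k\<in>K. dist a k < \<epsilon>) \<and> (\<forall>k\<in>K. \<exists>a\<in>A n. dist a k < \<epsilon>)"
    by eventually_elim (meson assms(2,3) le_less_trans)
qed

lemma multiple_tiling_reindex:
  assumes tiling: "multiple_tiling m I R" and bij_g: "bij_betw g K I"
    and R'_eq: "\<And>k. k \<in> K \<Longrightarrow> R' k = R (g k)"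
  shows "multiple_tiling m K R'"
proof -
  have bij: "bij_betw g {k \<in> K. P (R' k)} {i \<in> I. P (R i)}" for P
    using bij_g R'_eq by (auto simp: bij_betw_def inj_on_def)
  have range: "g k \<in> I" if "k \<in> K" for k using bij_g that by (auto simp: bij_betw_def)
  have Union: "(\<Union>k\<in>K. R' k) = (\<Union>i\<in>I. R i)" using bij_g R'_eq by (auto simp: bij_betw_def)
  show ?thesis
    using tiling unfolding multiple_tiling_def Union
      bij_betw_same_card[OF bij[of "\<lambda>S. z \<in> S" for z]]
      bij_betw_finite[OF bij[of "\<lambda>S. S \<inter> U \<noteq> {}" for U]]
    by (auto simp: R'_eq range)
qed

section \<open>Porous sets are null\<close>

text \<open>The comparison sets \<open>B\<close> need not be balls: below they are the images of a ball under the
  powers of a linear contraction, whose eccentricity is unbounded.\<close>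

definition uniformly_porous :: "real \<Rightarrow> 'a::euclidean_space set \<Rightarrow> bool" where
  "uniformly_porous c A \<longleftrightarrow>
     (\<forall>r>0. \<exists>B. open B \<and> B \<noteq> {} \<and> B \<subseteq> ball 0 r \<and>
        (\<forall>z. \<exists>H\<subseteq>B. open H \<and> c * measure lebesgue B \<le> measure lebesgue H \<and> (+) z ` H \<inter> A = {}))"

lemma uniformly_porous_subset:
  assumes "uniformly_porous c A" "A' \<subseteq> A"
  shows "uniformly_porous c A'"
  using assms unfolding uniformly_porous_def by (meson disjoint_iff subsetD)

lemma sets_borel_translate_Int:
  fixes A B :: "'a::euclidean_space set"
  assumes "A \<in> sets borel" "B \<in> sets borel"
  shows "{t \<in> B. z + t \<in> A} \<in> sets borel"
proof -
  have "(+) z -` A \<inter> space borel \<in> sets borel"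
    using assms(1) by (intro measurable_sets[of "(+) z" borel borel]) auto
  moreover have "{t \<in> B. z + t \<in> A} = B \<inter> ((+) z -` A \<inter> space borel)" by auto
  ultimately show ?thesis using assms(2) by (metis sets.Int)
qed

lemma emeasure_mult_eq_nn_integral_translates:
  fixes A B :: "'a::euclidean_space set"
  assumes A_borel: "A \<in> sets borel" and B_borel: "B \<in> sets borel"
  shows "emeasure lborel A * emeasure lborel B = (\<integral>\<^sup>+ z. emeasure lborel {t \<in> B. z + t \<in> A} \<partial>lborel)"
proof -
  let ?f = "\<lambda>z t. indicator A (z + t) * indicator B t :: ennreal"
  have measurable: "case_prod ?f \<in> borel_measurable (lborel \<Otimes>\<^sub>M lborel)"
    using A_borel B_borel by measurable
  have translate: "(\<integral>\<^sup>+ z. indicator A (z + t) \<partial>lborel) = emeasure lborel A" for t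
  proof -
    have "(\<integral>\<^sup>+ z. indicator A (z + t) \<partial>lborel) = (\<integral>\<^sup>+ z. indicator A z \<partial>distr lborel borel ((+) t))"
      using A_borel by (subst nn_integral_distr) (auto simp: add.commute)
    then show ?thesis using A_borel by (simp add: lborel_distr_plus)
  qed
  have slice: "(\<integral>\<^sup>+ t. ?f z t \<partial>lborel) = emeasure lborel {t \<in> B. z + t \<in> A}" for z
  proof -
    have "(\<integral>\<^sup>+ t. ?f z t \<partial>lborel) = (\<integral>\<^sup>+ t. indicator {t \<in> B. z + t \<in> A} t \<partial>lborel)"
      by (intro nn_integral_cong) (auto simp: indicator_def)
    then show ?thesis using sets_borel_translate_Int[OF A_borel B_borel] by simp
  qed
  have "emeasure lborel A * emeasure lborel B = (\<integral>\<^sup>+ t. emeasure lborel A * indicator B t \<partial>lborel)"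
    using B_borel by (simp add: nn_integral_cmult)
  also have "\<dots> = (\<integral>\<^sup>+ t. (\<integral>\<^sup>+ z. ?f z t \<partial>lborel) \<partial>lborel)"
    using A_borel by (intro nn_integral_cong) (simp add: nn_integral_multc translate)
  also have "\<dots> = (\<integral>\<^sup>+ z. (\<integral>\<^sup>+ t. ?f z t \<partial>lborel) \<partial>lborel)"
    using lborel_pair.Fubini'[OF measurable] .
  finally show ?thesis unfolding slice .
qed

lemma emeasure_lborel_eq_measure:
  "bounded S \<Longrightarrow> emeasure lborel S = ennreal (measure lborel S)"
  for S :: "'a::euclidean_space set"
  using emeasure_bounded_finite[of S] by (intro emeasure_eq_ennreal_measure) auto

lemma measure_lborel_open_pos:
  fixes B :: "'a::euclidean_space set"
  assumes "open B" "bounded B" "B \<noteq> {}"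
  shows "measure lborel B > 0"
proof -
  have "measure lebesgue B \<noteq> 0"
    using open_not_negligible[OF assms(1,3)] lmeasurable_open[OF assms(2,1)]
    by (simp add: negligible_iff_measure)
  then show ?thesis using assms(1) by (simp add: less_le)
qed

lemma measure_le_of_translates_bound:
  fixes A B U :: "'a::euclidean_space set"
  assumes sets: "A \<in> sets borel" "open B" "open U"
    and bounded: "bounded A" "bounded B" "B \<noteq> {}"
    and finite: "emeasure lborel U < \<infinity>"
    and q_nonneg: "0 \<le> q"
    and translates: "\<And>z. measure lborel {t \<in> B. z + t \<in> A} \<le> q * measure lborel B"
    and outside: "\<And>z t. t \<in> B \<Longrightarrow> z + t \<in> A \<Longrightarrow> z \<in> U"
  shows "measure lborel A \<le> q * measure lborel U"
proof -
  have emeasure_U: "emeasure lborel U = ennreal (measure lborel U)"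
    using finite by (intro emeasure_eq_ennreal_measure) auto
  have slice_le: "emeasure lborel {t \<in> B. z + t \<in> A}
      \<le> ennreal (q * measure lborel B) * indicator U z" for z
  proof (cases "z \<in> U")
    case True
    have "bounded {t \<in> B. z + t \<in> A}" using bounded(2) by (rule bounded_subset) auto
    then show ?thesis
      using True translates[of z] by (simp add: emeasure_lborel_eq_measure ennreal_leI)
  next
    case False
    then have "{t \<in> B. z + t \<in> A} = {}" using outside by auto
    then show ?thesis by (simp only: emeasure_empty zero_le)
  qed
  have "ennreal (measure lborel A * measure lborel B) = emeasure lborel A * emeasure lborel B"
    using bounded by (simp add: emeasure_lborel_eq_measure ennreal_mult)
  also have "\<dots> \<le> (\<integral>\<^sup>+ z. ennreal (q * measure lborel B) * indicator U z \<partial>lborel)"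
    using sets slice_le
    by (subst emeasure_mult_eq_nn_integral_translates) (auto intro: nn_integral_mono)
  also have "\<dots> = ennreal (q * measure lborel B * measure lborel U)"
    using sets q_nonneg by (simp add: nn_integral_cmult emeasure_U ennreal_mult[symmetric])
  finally have "measure lborel A * measure lborel B \<le> q * measure lborel B * measure lborel U"
    using q_nonneg by simp
  then have "measure lborel B * measure lborel A \<le> measure lborel B * (q * measure lborel U)"
    by (simp add: mult_ac)
  then show ?thesis using measure_lborel_open_pos[OF sets(2) bounded(2,3)] by simp
qed

lemma open_superset_measure_less:
  fixes A :: "'a::euclidean_space set"
  assumes "compact A" "\<epsilon> > 0"
  obtains U where "open U" "A \<subseteq> U" "emeasure lborel U < \<infinity>" "measure lborel U < measure lborel A + \<epsilon>"
proof -
  have A_borel: "A \<in> sets borel" and A_finite: "emeasure lborel A < \<infinity>"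
    using assms(1) emeasure_compact_finite by (auto simp: compact_imp_closed)
  obtain U where U_open: "open U" and A_subset_U: "A \<subseteq> U"
    and U_diff_less: "emeasure lborel (U - A) < ennreal \<epsilon>"
    using outer_regular_lborel[OF A_borel assms(2)] .
  have "emeasure lborel U = emeasure lborel A + emeasure lborel (U - A)"
    using U_open A_subset_U A_borel by (subst plus_emeasure) (auto simp: Un_absorb1)
  then have U_finite: "emeasure lborel U < \<infinity>"
    using A_finite order.strict_trans[OF U_diff_less ennreal_less_top] by (simp add: less_top)
  have "emeasure lborel (U - A) = ennreal (measure lborel (U - A))"
    using U_diff_less by (intro emeasure_eq_ennreal_measure) auto
  then have "measure lborel (U - A) < \<epsilon>" using U_diff_less by (simp add: ennreal_less_iff)
  moreover have "measure lborel (U - A) = measure lborel U - measure lborel A"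
    using U_open A_subset_U A_borel A_finite U_finite by (intro measure_Diff) auto
  ultimately show thesis using that U_open A_subset_U U_finite by simp
qed

lemma measure_translate_le_if_hole:
  fixes A B H :: "'a::euclidean_space set"
  assumes "A \<in> sets borel" "open B" "bounded B" "open H" "H \<subseteq> B"
    and large: "c * measure lebesgue B \<le> measure lebesgue H"
    and hole: "(+) z ` H \<inter> A = {}"
  shows "measure lborel {t \<in> B. z + t \<in> A} \<le> (1 - c) * measure lborel B"
proof -
  have fmeasurable: "S \<in> fmeasurable lborel" if "open S" "S \<subseteq> B" for S
    using that emeasure_bounded_finite[OF bounded_subset[OF assms(3)]] by (intro fmeasurableI) auto
  have "measure lborel {t \<in> B. z + t \<in> A} \<le> measure lborel (B - H)"
    using hole assms sets_borel_translate_Int[OF assms(1), of B z]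
    by (intro measure_mono_fmeasurable fmeasurable.Diff fmeasurable) auto
  also have "\<dots> = measure lborel B - measure lborel H"
    using assms by (intro measurable_measure_Diff fmeasurable) auto
  also have "\<dots> \<le> (1 - c) * measure lborel B"
    using large assms(2,4) by (simp add: left_diff_distrib)
  finally show ?thesis .
qed

lemma uniformly_porous_compact_measure_0:
  fixes A :: "'a::euclidean_space set"
  assumes "compact A" and c_pos: "0 < c" and c_le_1: "c \<le> 1" and porous: "uniformly_porous c A"
  shows "measure lborel A = 0"
proof (rule ccontr)
  assume nonzero: "measure lborel A \<noteq> 0"
  then have "A \<noteq> {}" by auto
  have A_borel: "A \<in> sets borel" and A_bounded: "bounded A"
    using assms(1) by (auto simp: compact_imp_closed compact_imp_bounded)
  define \<epsilon> where "\<epsilon> = c * measure lborel A"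
  have "\<epsilon> > 0" unfolding \<epsilon>_def using nonzero c_pos by (simp add: less_le)
  obtain U where U_open: "open U" and A_subset_U: "A \<subseteq> U" and U_finite: "emeasure lborel U < \<infinity>"
    and U_less: "measure lborel U < measure lborel A + \<epsilon>"
    using open_superset_measure_less[OF assms(1) \<open>\<epsilon> > 0\<close>] .
  obtain r where r_pos: "r > 0" and neighbourhood_subset: "{z. infdist z A \<le> r} \<subseteq> U"
    using compact_in_open_separated[OF \<open>A \<noteq> {}\<close> assms(1) U_open A_subset_U] .
  obtain B where B_open: "open B" and B_nonempty: "B \<noteq> {}" and B_subset: "B \<subseteq> ball 0 r" and
    holes: "\<And>z. \<exists>H\<subseteq>B. open H \<and> c * measure lebesgue B \<le> measure lebesgue H \<and> (+) z ` H \<inter> A = {}"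
    using porous[unfolded uniformly_porous_def, rule_format, OF r_pos] by (elim exE conjE) simp
  have "bounded B" using B_subset bounded_subset by blast
  have "measure lborel A \<le> (1 - c) * measure lborel U"
  proof (rule measure_le_of_translates_bound[OF A_borel B_open U_open A_bounded \<open>bounded B\<close>
        B_nonempty U_finite])
    show "z \<in> U" if "t \<in> B" "z + t \<in> A" for z t
    proof -
      have "infdist z A \<le> dist z (z + t)" using that(2) by (rule infdist_le)
      also have "\<dots> \<le> r" using B_subset that(1) by (auto simp: dist_norm)
      finally show ?thesis using neighbourhood_subset by blast
    qed
    show "measure lborel {t \<in> B. z + t \<in> A} \<le> (1 - c) * measure lborel B" for z
      using holes[of z] measure_translate_le_if_hole[OF A_borel B_open \<open>bounded B\<close>] by blast
  qed (use c_pos c_le_1 in simp)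
  also have "\<dots> \<le> (1 - c) * (measure lborel A + \<epsilon>)"
    using U_less c_pos c_le_1 by (intro mult_left_mono) auto
  also have "\<dots> = measure lborel A - c * \<epsilon>" unfolding \<epsilon>_def by (simp add: algebra_simps)
  also have "\<dots> < measure lborel A" using c_pos \<open>\<epsilon> > 0\<close> by simp
  finally show False by simp
qed

lemma uniformly_porous_closed_null:
  fixes A :: "'a::euclidean_space set"
  assumes "closed A" "0 < c" "c \<le> 1" "uniformly_porous c A"
  shows "A \<in> null_sets lborel"
proof -
  have "A \<inter> cball 0 (real n) \<in> null_sets lborel" for n
  proof (rule null_setsI)
    have compact: "compact (A \<inter> cball 0 (real n))" using assms(1) by (intro closed_Int_compact) auto
    then have "measure lborel (A \<inter> cball 0 (real n)) = 0"
      using assms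
      by (auto intro!: uniformly_porous_compact_measure_0 uniformly_porous_subset[OF assms(4)])
    then show "emeasure lborel (A \<inter> cball 0 (real n)) = 0"
      using emeasure_compact_finite[OF compact] by (auto simp: measure_def enn2real_eq_0_iff)
  qed (use assms(1) in auto)
  then have "(\<Union>n. A \<inter> cball 0 (real n)) \<in> null_sets lborel" by (intro null_sets_UN)
  moreover have "(\<Union>n. A \<inter> cball 0 (real n)) = A" using real_arch_simple by (auto simp: dist_norm)
  ultimately show ?thesis by simp
qed

section \<open>Powers of a linear contraction\<close>

locale linear_contraction =
  fixes M :: "'a::euclidean_space \<Rightarrow> 'a" and \<theta> :: real
  assumes linear_M: "linear M" and inj_M: "inj M"
    and norm_M_le: "norm (M z) \<le> \<theta> * norm z"
    and theta: "0 < \<theta>" "\<theta> < 1"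
begin

lemma linear_funpow: "linear (M ^^ n)"
  by (induction n) (use linear_compose[OF _ linear_M] in \<open>auto simp: o_def linear_ident\<close>)

lemma surj_funpow: "surj (M ^^ n)"
  using linear_injective_imp_surjective[OF linear_funpow] inj_M by simp

lemmas funpow_diff = linear_diff[OF linear_funpow]

lemma norm_funpow_le: "norm ((M ^^ n) z) \<le> \<theta> ^ n * norm z"
proof (induction n)
  case (Suc n)
  have "norm ((M ^^ Suc n) z) \<le> \<theta> * norm ((M ^^ n) z)" using norm_M_le by simp
  also have "\<dots> \<le> \<theta> * (\<theta> ^ n * norm z)" using Suc theta by (intro mult_left_mono) auto
  finally show ?case by (simp add: mult.assoc)
qed simp

lemma dist_funpow_le: "dist ((M ^^ n) x) ((M ^^ n) y) \<le> \<theta> ^ n * dist x y"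
  unfolding dist_norm funpow_diff[symmetric] by (rule norm_funpow_le)

lemma open_funpow_image: "open S \<Longrightarrow> open ((M ^^ n) ` S)"
  using open_surjective_linear_image linear_funpow surj_funpow by blast

lemma bounded_funpow_image: "bounded S \<Longrightarrow> bounded ((M ^^ n) ` S)"
  using bounded_linear_image linear_funpow linear_conv_bounded_linear by blast

lemma funpow_image_translate: "(M ^^ n) ` (+) x ` S = (+) ((M ^^ n) x) ` (M ^^ n) ` S"
  unfolding image_image linear_add[OF linear_funpow] ..

lemma tendsto_theta_power: "(\<lambda>n. c * \<theta> ^ n) \<longlonglongrightarrow> 0"
  using tendsto_mult_left[OF LIMSEQ_power_zero[of \<theta>], of c] theta by simp

lemma ex_theta_power_less:
  assumes "0 < \<epsilon>"
  shows "\<exists>n. c * \<theta> ^ n < \<epsilon>"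
  using order_tendstoD(2)[OF tendsto_theta_power assms] unfolding eventually_sequentially by blast

lemma tendsto_funpow_cancel:
  assumes "((\<lambda>i. (M ^^ n) (f i)) \<longlongrightarrow> (M ^^ n) y) F"
  shows "(f \<longlongrightarrow> y) F"
proof -
  obtain g where linear_g: "linear g" and g_left_inverse: "g \<circ> (M ^^ n) = id"
    using linear_injective_left_inverse[OF linear_funpow inj_fn[OF inj_M]] by blast
  then have inverse: "g ((M ^^ n) z) = z" for z by (metis comp_apply id_apply)
  have "((\<lambda>i. g ((M ^^ n) (f i))) \<longlongrightarrow> g ((M ^^ n) y)) F"
    using bounded_linear.tendsto[OF linear_g[unfolded linear_conv_bounded_linear] assms] .
  then show ?thesis unfolding inverse .
qed

lemma measure_funpow_image_ball_le:
  fixes G :: "'a set"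
  assumes G_open: "open G" and G_bounded: "bounded G" and G_nonempty: "G \<noteq> {}"
  shows "\<exists>m\<ge>1. \<forall>n. measure lebesgue ((M ^^ n) ` ball 0 \<rho>) \<le> m * measure lebesgue ((M ^^ n) ` G)"
proof -
  obtain g where "g \<in> G" using G_nonempty by blast
  have "x \<in> (+) (x - g) ` G" for x using \<open>g \<in> G\<close> by force
  then have "cball 0 \<rho> \<subseteq> (\<Union>x. (+) x ` G)" by blast
  then obtain I where I_finite: "finite I" and I_cover: "cball 0 \<rho> \<subseteq> (\<Union>x\<in>I. (+) x ` G)"
    by (rule compactE_image[OF compact_cball open_translation[OF G_open], where C = UNIV])
  have "measure lebesgue ((M ^^ n) ` ball 0 \<rho>)
      \<le> real (card I + 1) * measure lebesgue ((M ^^ n) ` G)" for n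
  proof -
    let ?Gn = "(M ^^ n) ` G"
    have translates_measurable: "(+) x ` ?Gn \<in> lmeasurable" for x
      using G_open G_bounded
      by (intro measurable_translation lmeasurable_open bounded_funpow_image open_funpow_image)
    have "(M ^^ n) ` ball 0 \<rho> \<subseteq> (M ^^ n) ` (\<Union>x\<in>I. (+) x ` G)"
      using I_cover ball_subset_cball by blast
    then have "(M ^^ n) ` ball 0 \<rho> \<subseteq> (\<Union>x\<in>I. (+) ((M ^^ n) x) ` ?Gn)"
      unfolding image_UN funpow_image_translate .
    then have "measure lebesgue ((M ^^ n) ` ball 0 \<rho>)
        \<le> measure lebesgue (\<Union>x\<in>I. (+) ((M ^^ n) x) ` ?Gn)"
      using translates_measurable I_finite
      by (intro measure_mono_fmeasurable fmeasurable.finite_UN)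
         (auto intro!: fmeasurableD[OF lmeasurable_open] open_funpow_image bounded_funpow_image)
    also have "\<dots> \<le> (\<Sum>x\<in>I. measure lebesgue ((+) ((M ^^ n) x) ` ?Gn))"
      using translates_measurable I_finite by (intro measure_UNION_le) auto
    also have "\<dots> = real (card I) * measure lebesgue ?Gn" by (simp add: measure_translation)
    also have "\<dots> \<le> real (card I + 1) * measure lebesgue ?Gn" by (intro mult_right_mono) auto
    finally show ?thesis .
  qed
  then show ?thesis by (intro exI[of _ "real (card I + 1)"]) auto
qed

lemma invariant_funpow:
  assumes "\<And>y. M y \<in> A \<Longrightarrow> y \<in> A" "(M ^^ n) y \<in> A"
  shows "y \<in> A"
  using assms(2) by (induction n) (auto dest: assms(1))

text \<open>The invariance of \<open>A\<close> copies a hole at unit scale, which exists near every point, to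
  all smaller scales.\<close>

lemma ex_scaled_hole:
  fixes A G :: "'a set"
  assumes invariant: "\<And>y. M y \<in> A \<Longrightarrow> y \<in> A"
    and "open G" and hole: "\<And>y. \<exists>p. (+) p ` G \<subseteq> ball y \<rho> - A"
  shows "\<exists>H\<subseteq>(M ^^ n) ` ball 0 \<rho>. open H \<and> measure lebesgue H = measure lebesgue ((M ^^ n) ` G) \<and>
    (+) z ` H \<inter> A = {}"
proof -
  obtain y where z_eq: "z = (M ^^ n) y" using surj_funpow[of n] by (metis surjD)
  obtain p where hole_p: "(+) p ` G \<subseteq> ball y \<rho> - A" using hole by blast
  let ?H = "(M ^^ n) ` (+) (p - y) ` G"
  have "(+) (p - y) ` G \<subseteq> ball 0 \<rho>"
    using hole_p by (force simp: dist_norm norm_minus_commute algebra_simps)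
  then have "?H \<subseteq> (M ^^ n) ` ball 0 \<rho>" by (rule image_mono)
  moreover have "open ?H" using assms(2) by (intro open_funpow_image open_translation)
  moreover have "measure lebesgue ?H = measure lebesgue ((M ^^ n) ` G)"
    unfolding funpow_image_translate measure_translation ..
  moreover have "(+) z ` ?H \<inter> A = {}"
  proof -
    have "(+) z ` ?H = (M ^^ n) ` (+) p ` G"
      unfolding z_eq image_image linear_add[OF linear_funpow, symmetric] by simp
    then show ?thesis using hole_p invariant_funpow[of A, OF invariant] by auto
  qed
  ultimately show ?thesis by blast
qed

theorem null_sets_if_relatively_dense_holes:
  fixes A G :: "'a set"
  assumes "closed A"
    and invariant: "\<And>y. M y \<in> A \<Longrightarrow> y \<in> A"
    and G_open: "open G" and G_bounded: "bounded G" and G_nonempty: "G \<noteq> {}"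
    and hole: "\<And>y. \<exists>p. (+) p ` G \<subseteq> ball y \<rho> - A"
  shows "A \<in> null_sets lborel"
proof -
  obtain m where m_ge_1: "m \<ge> 1"
    and ball_le: "\<And>n. measure lebesgue ((M ^^ n) ` ball 0 \<rho>) \<le> m * measure lebesgue ((M ^^ n) ` G)"
    using measure_funpow_image_ball_le[OF G_open G_bounded G_nonempty] by blast
  have "\<rho> > 0" using hole[of 0] G_nonempty by (cases "\<rho> \<le> 0") (auto simp: ball_empty)
  have "uniformly_porous (1 / m) A"
    unfolding uniformly_porous_def
  proof (intro allI impI)
    fix r :: real assume "r > 0"
    then obtain n where small: "\<rho> * \<theta> ^ n < r" using ex_theta_power_less by blast
    let ?B = "(M ^^ n) ` ball 0 \<rho>"
    have "norm ((M ^^ n) x) < r" if "norm x < \<rho>" for x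
    proof -
      have "norm ((M ^^ n) x) \<le> \<theta> ^ n * norm x" by (rule norm_funpow_le)
      also have "\<dots> \<le> \<theta> ^ n * \<rho>" using that theta by (intro mult_left_mono) auto
      finally show ?thesis using small by (simp add: mult.commute)
    qed
    then have "?B \<subseteq> ball 0 r" by auto
    moreover have "\<exists>H\<subseteq>?B. open H \<and> 1 / m * measure lebesgue ?B \<le> measure lebesgue H \<and>
        (+) z ` H \<inter> A = {}" for z
    proof -
      have "1 / m * measure lebesgue ?B \<le> measure lebesgue ((M ^^ n) ` G)"
        using m_ge_1 ball_le[of n] by (simp add: divide_le_eq mult.commute)
      then show ?thesis using ex_scaled_hole[OF invariant G_open hole, of n z] by metis
    qed
    ultimately show "\<exists>B. open B \<and> B \<noteq> {} \<and> B \<subseteq> ball 0 r \<and>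
        (\<forall>z. \<exists>H\<subseteq>B. open H \<and> 1 / m * measure lebesgue B \<le> measure lebesgue H \<and> (+) z ` H \<inter> A = {})"
      using \<open>\<rho> > 0\<close> open_funpow_image[OF open_ball, of n 0 \<rho>] by (intro exI[of _ ?B]) simp
  qed
  then show ?thesis using assms(1) m_ge_1 by (intro uniformly_porous_closed_null[of A "1 / m"]) auto
qed

end

section \<open>The ring generated by a real number\<close>

lemma int_adjoin_of_int [simp]: "of_int k \<in> int_adjoin b"
  unfolding int_adjoin_def by (auto intro!: exI[of _ "[:k:]"] simp: map_poly_pCons)

lemma int_adjoin_of_nat [simp]: "of_nat k \<in> int_adjoin b"
  using int_adjoin_of_int[of "int k" b] by simp

lemma int_adjoin_0 [simp]: "0 \<in> int_adjoin b" and int_adjoin_1 [simp]: "1 \<in> int_adjoin b"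
  using int_adjoin_of_int[of 0 b] int_adjoin_of_int[of 1 b] by simp_all

lemma int_adjoin_add:
  assumes "x \<in> int_adjoin b" "y \<in> int_adjoin b"
  shows "x + y \<in> int_adjoin b"
proof -
  obtain p q :: "int poly"
    where xy_eq: "x = poly (map_poly of_int p) b" "y = poly (map_poly of_int q) b"
    using assms unfolding int_adjoin_def by auto
  have "map_poly of_int (p + q) = (map_poly of_int p + map_poly of_int q :: real poly)"
    by (intro poly_eqI) (simp add: coeff_map_poly)
  then show ?thesis unfolding int_adjoin_def xy_eq by (auto intro!: exI[of _ "p + q"])
qed

lemma int_adjoin_int_mult:
  assumes "x \<in> int_adjoin b"
  shows "of_int k * x \<in> int_adjoin b"
proof -
  obtain p :: "int poly" where x_eq: "x = poly (map_poly of_int p) b"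
    using assms unfolding int_adjoin_def by auto
  have "map_poly of_int (smult k p) = (smult (of_int k) (map_poly of_int p) :: real poly)"
    by (intro poly_eqI) (simp add: coeff_map_poly)
  then show ?thesis unfolding int_adjoin_def x_eq by (auto intro!: exI[of _ "smult k p"])
qed

lemma int_adjoin_generator_mult:
  assumes "x \<in> int_adjoin b"
  shows "b * x \<in> int_adjoin b"
proof -
  obtain p :: "int poly" where x_eq: "x = poly (map_poly of_int p) b"
    using assms unfolding int_adjoin_def by auto
  show ?thesis unfolding int_adjoin_def x_eq
    by (auto intro!: exI[of _ "pCons 0 p"] simp: map_poly_pCons)
qed

lemma int_adjoin_induct [consumes 1, case_names zero step]:
  assumes "x \<in> int_adjoin b" "P 0" "\<And>k y. y \<in> int_adjoin b \<Longrightarrow> P y \<Longrightarrow> P (of_int k + b * y)"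
  shows "P x"
proof -
  have "P (poly (map_poly of_int p) b)" for p :: "int poly"
  proof (induction p)
    case 0
    then show ?case using assms(2) by simp
  next
    case (pCons a p)
    then show ?case
      using assms(3)[of "poly (map_poly of_int p) b" a]
      by (auto simp: map_poly_pCons int_adjoin_def)
  qed
  then show ?thesis using assms(1) unfolding int_adjoin_def by auto
qed

lemma int_adjoin_mult:
  assumes "x \<in> int_adjoin b" "y \<in> int_adjoin b"
  shows "x * y \<in> int_adjoin b"
  using assms(1)
proof (induction rule: int_adjoin_induct)
  case (step k z)
  have "of_int k * y + b * (z * y) \<in> int_adjoin b"
    by (intro int_adjoin_add int_adjoin_int_mult int_adjoin_generator_mult assms(2) step)
  then show ?case by (simp add: algebra_simps)
qed simp

lemma int_adjoin_uminus: "x \<in> int_adjoin b \<Longrightarrow> - x \<in> int_adjoin b"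
  using int_adjoin_int_mult[of x b "-1"] by simp

lemma int_adjoin_diff: "x \<in> int_adjoin b \<Longrightarrow> y \<in> int_adjoin b \<Longrightarrow> x - y \<in> int_adjoin b"
  using int_adjoin_add[of x b "- y"] int_adjoin_uminus[of y b] by simp

lemma int_adjoin_generator [simp]: "b \<in> int_adjoin b"
  using int_adjoin_generator_mult[OF int_adjoin_1] by simp

lemma int_adjoin_power: "x \<in> int_adjoin b \<Longrightarrow> x ^ n \<in> int_adjoin b"
  by (induction n) (auto intro: int_adjoin_mult)

lemma int_adjoin_sum: "(\<And>i. i \<in> A \<Longrightarrow> f i \<in> int_adjoin b) \<Longrightarrow> sum f A \<in> int_adjoin b"
  by (induction A rule: infinite_finite_induct) (auto intro: int_adjoin_add)

lemmas int_adjoin_intros =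
  int_adjoin_add int_adjoin_diff int_adjoin_mult int_adjoin_uminus int_adjoin_power int_adjoin_sum

lemma int_adjoin_subset_rat_field_adjoin: "int_adjoin b \<subseteq> rat_field_adjoin b"
proof
  fix x assume "x \<in> int_adjoin b"
  then obtain p :: "int poly" where x_eq: "x = poly (map_poly of_int p) b"
    unfolding int_adjoin_def by auto
  have "map_poly of_rat (map_poly of_int p) = (map_poly of_int p :: real poly)"
    by (intro poly_eqI) (simp add: coeff_map_poly)
  then have "x = poly (map_poly of_rat (map_poly of_int p)) b
      / poly (map_poly of_rat (1 :: rat poly)) b"
    using x_eq by simp
  moreover have "poly (map_poly of_rat (1 :: rat poly)) b \<noteq> 0" by simp
  ultimately show "x \<in> rat_field_adjoin b" unfolding rat_field_adjoin_def by blast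
qed

section \<open>Congruence modulo the generator minus one\<close>

definition same_residue :: "real \<Rightarrow> real \<Rightarrow> real \<Rightarrow> bool" where
  "same_residue b x y \<longleftrightarrow> (\<exists>z\<in>int_adjoin b. x - y = (b - 1) * z)"

lemma mem_residue_class_iff: "x \<in> residue_class b j \<longleftrightarrow> same_residue b x (of_int j)"
  unfolding residue_class_def same_residue_def by (auto simp: algebra_simps)

lemma same_residue_refl [simp]: "same_residue b x x"
  unfolding same_residue_def by (intro bexI[of _ 0]) auto

lemma same_residue_add:
  assumes "same_residue b x y" "same_residue b x' y'"
  shows "same_residue b (x + x') (y + y')"
proof -
  obtain z z' where "z \<in> int_adjoin b" "x - y = (b - 1) * z"
    "z' \<in> int_adjoin b" "x' - y' = (b - 1) * z'"
    using assms unfolding same_residue_def by auto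
  then show ?thesis
    unfolding same_residue_def
    by (intro bexI[of _ "z + z'"] int_adjoin_add) (auto simp: algebra_simps)
qed

lemma same_residue_mult_left:
  assumes "same_residue b x y" "a \<in> int_adjoin b"
  shows "same_residue b (a * x) (a * y)"
proof -
  obtain z where "z \<in> int_adjoin b" "x - y = (b - 1) * z"
    using assms unfolding same_residue_def by auto
  then show ?thesis
    unfolding same_residue_def using assms(2)
    by (intro bexI[of _ "a * z"] int_adjoin_mult)
       (auto simp: right_diff_distrib[symmetric] mult.left_commute)
qed

lemma same_residue_diff_iff_0: "same_residue b x y \<longleftrightarrow> same_residue b (x - y) 0"
  unfolding same_residue_def by simp

lemma same_residue_sym: "same_residue b x y \<Longrightarrow> same_residue b y x"
  using same_residue_mult_left[of b "x - y" 0 "-1"] int_adjoin_of_int[of "-1" b]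
  by (simp add: same_residue_diff_iff_0[of b x] same_residue_diff_iff_0[of b y])

lemma same_residue_trans [trans]: "same_residue b x y \<Longrightarrow> same_residue b y z \<Longrightarrow> same_residue b x z"
  using same_residue_add[of b "x - y" 0 "y - z" 0] by (simp add: same_residue_diff_iff_0[of b _ y]
      same_residue_diff_iff_0[of b _ z])

lemma same_residue_sum:
  "(\<And>i. i \<in> A \<Longrightarrow> same_residue b (f i) (g i)) \<Longrightarrow> same_residue b (sum f A) (sum g A)"
  by (induction A rule: infinite_finite_induct) (auto intro: same_residue_add)

lemma same_residue_int_adjoin_iff:
  assumes "same_residue b x y"
  shows "x \<in> int_adjoin b \<longleftrightarrow> y \<in> int_adjoin b"
proof -
  obtain z where "z \<in> int_adjoin b" "x = y + (b - 1) * z" "y = x - (b - 1) * z"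
    using assms unfolding same_residue_def by (auto simp: algebra_simps)
  then show ?thesis
    by (metis int_adjoin_1 int_adjoin_add int_adjoin_diff int_adjoin_generator int_adjoin_mult)
qed

lemma same_residue_generator_mult: "x \<in> int_adjoin b \<Longrightarrow> same_residue b (b * x) x"
  unfolding same_residue_def by (auto simp: algebra_simps)

lemma same_residue_generator_power: "same_residue b (b ^ n) 1"
proof (induction n)
  case (Suc n)
  have "same_residue b (b ^ Suc n) (b ^ n)"
    unfolding power_Suc by (intro same_residue_generator_mult int_adjoin_power) simp
  then show ?case using Suc same_residue_trans by blast
qed simp

lemma int_adjoin_same_residue_int:
  assumes "x \<in> int_adjoin b"
  shows "\<exists>j::int. same_residue b x (of_int j)"
  using assms
proof (induction rule: int_adjoin_induct)
  case zero
  show ?case by (rule exI[of _ 0]) simp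
next
  case (step k y)
  then obtain j :: int where y_residue: "same_residue b y (of_int j)" by auto
  have "same_residue b (b * y) (of_int j)"
    using same_residue_generator_mult[OF step(1)] y_residue by (rule same_residue_trans)
  then have "same_residue b (of_int k + b * y) (of_int k + of_int j)"
    by (intro same_residue_add) simp
  then show ?case by (metis of_int_add)
qed

section \<open>Sums of inverse powers\<close>

lemma sum_inverse_powers_eq_1:
  fixes s :: "'a::field"
  assumes "s \<noteq> 0" "s ^ d = (\<Sum>i<d. s ^ i)"
  shows "(\<Sum>i\<in>{1..d}. (1/s) ^ i) = 1"
proof -
  have "s ^ d * (\<Sum>i\<in>{1..d}. (1/s) ^ i) = (\<Sum>i\<in>{1..d}. s ^ (d - i))"
    unfolding sum_distrib_left
    by (intro sum.cong) (use assms(1) in \<open>auto simp: power_diff power_one_over field_simps\<close>)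
  also have "\<dots> = (\<Sum>i<d. s ^ i)"
    by (rule sum.reindex_bij_witness[of _ "\<lambda>i. d - i" "\<lambda>i. d - i"]) auto
  finally have "s ^ d * (\<Sum>i\<in>{1..d}. (1/s) ^ i) = s ^ d" using assms(2) by simp
  then show ?thesis using assms(1) by simp
qed

lemma sum_inverse_powers_coeffs_0:
  fixes b :: "nat \<Rightarrow> 'a::field"
  assumes card_Z: "card Z \<ge> d" and zero_notin_Z: "0 \<notin> Z"
    and root: "\<And>z. z \<in> Z \<Longrightarrow> (\<Sum>k\<in>{1..d}. b k * (1 / z) ^ k) = 0"
    and i_range: "i \<in> {1..d}"
  shows "b i = 0"
proof -
  define P where "P = (\<Sum>k\<in>{1..d}. monom (b k) (d - k))"
  have coeff_P: "coeff P (d - i) = b i"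
  proof -
    have "coeff P (d - i) = (\<Sum>k\<in>{1..d}. if k = i then b k else 0)"
      unfolding P_def coeff_sum coeff_monom using i_range by (intro sum.cong) auto
    then show ?thesis using i_range by simp
  qed
  have poly_P: "poly P z = 0" if "z \<in> Z" for z
  proof -
    have "z \<noteq> 0" using zero_notin_Z that by auto
    then have "poly P z = z ^ d * (\<Sum>k\<in>{1..d}. b k * (1 / z) ^ k)"
      unfolding P_def poly_sum poly_monom sum_distrib_left
      by (intro sum.cong refl) (auto simp: power_diff power_one_over field_simps)
    then show ?thesis using root[OF that] by simp
  qed
  have "P = 0"
  proof (rule ccontr)
    assume "P \<noteq> 0"
    have "degree P \<le> d - 1" unfolding P_def
      by (intro degree_sum_le) (auto intro: order_trans[OF degree_monom_le])
    moreover have "card Z \<le> card {z. poly P z = 0}"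
      using poly_P \<open>P \<noteq> 0\<close> by (intro card_mono poly_roots_finite) auto
    ultimately show False using card_poly_roots_bound[OF \<open>P \<noteq> 0\<close>] card_Z i_range by simp
  qed
  then show ?thesis using coeff_P by simp
qed

lemma positive_root_unique:
  fixes s t :: real
  assumes "d > 0" "s > 0" "s ^ d = (\<Sum>i<d. s ^ i)" "t > 0" "t ^ d = (\<Sum>i<d. t ^ i)"
  shows "s = t"
proof -
  have not_less: "\<not> a < b"
    if "a > 0" "a ^ d = (\<Sum>i<d. a ^ i)" "b > 0" "b ^ d = (\<Sum>i<d. b ^ i)" for a b :: real
  proof
    assume "a < b"
    then have "(\<Sum>i\<in>{1..d}. (1/b) ^ i) < (\<Sum>i\<in>{1..d}. (1/a) ^ i)"
      using that assms(1) by (intro sum_strict_mono power_strict_mono frac_less2) auto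
    then show False
      using sum_inverse_powers_eq_1[of a d] sum_inverse_powers_eq_1[of b d] that by simp
  qed
  then show ?thesis using assms(2-) by (meson linorder_neqE)
qed

section \<open>The balanced transformation\<close>

definition digit :: "real \<Rightarrow> real" where
  "digit v = of_bool (v \<ge> 1/2)"

definition balanced_map :: "real \<Rightarrow> real \<Rightarrow> real" where
  "balanced_map \<beta> v = \<beta> * v - (\<beta> - 1) * digit v"

definition balanced_domain :: "real \<Rightarrow> real set" where
  "balanced_domain \<beta> = {1 - \<beta>/2..<\<beta>/2}"

lemma funpow_add_apply: "(f ^^ (m + n)) x = (f ^^ n) ((f ^^ m) x)"
  by (subst add.commute) (simp add: funpow_add)

lemma floor_between_minus_1_and_1:
  fixes x :: real
  assumes "-1 \<le> x" "x < 1"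
  shows "\<lfloor>x\<rfloor> = (if x < 0 then -1 else 0)"
  using assms by (intro floor_unique) auto

locale bonacci =
  fixes d :: nat and \<beta> :: real
  assumes d_ge: "d \<ge> 3" and dBonacci: "dBonacci d \<beta>"
begin

abbreviation "T \<equiv> balanced_map \<beta>"
abbreviation "X \<equiv> balanced_domain \<beta>"
abbreviation "Z\<beta> \<equiv> int_adjoin \<beta>"

lemma beta_gt_1: "1 < \<beta>" and beta_less_2: "\<beta> < 2" and beta_pow_d: "\<beta> ^ d = (\<Sum>i<d. \<beta> ^ i)"
  using dBonacci unfolding dBonacci_def by auto

lemma beta_pos: "0 < \<beta>"
  using beta_gt_1 by simp

lemma beta_pow_d_mult_left_end: "\<beta> ^ d * (1 - \<beta>/2) = 1/2"
proof -
  have "\<beta> ^ d - 1 = (\<beta> - 1) * \<beta> ^ d"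
    unfolding power_diff_1_eq beta_pow_d[symmetric] ..
  then show ?thesis by (simp add: algebra_simps)
qed

lemma beta_pow_mult_left_end_le:
  assumes "i \<le> d"
  shows "\<beta> ^ i * (1 - \<beta>/2) \<le> 1/2"
proof -
  have "\<beta> ^ i * (1 - \<beta>/2) \<le> \<beta> ^ d * (1 - \<beta>/2)"
    using assms beta_gt_1 beta_less_2 by (intro mult_right_mono power_increasing) auto
  then show ?thesis unfolding beta_pow_d_mult_left_end .
qed

lemma balanced_domain_diff_less: "v \<in> X \<Longrightarrow> v' \<in> X \<Longrightarrow> v' - v < \<beta> - 1"
  unfolding balanced_domain_def by auto

lemma T_in_X:
  assumes "v \<in> X"
  shows "T v \<in> X"
proof (cases "v \<ge> 1/2")
  case True
  have "\<beta> * v < \<beta> * (\<beta>/2)" "\<beta> * (1/2) \<le> \<beta> * v"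
    using assms beta_pos True unfolding balanced_domain_def by auto
  moreover have "(\<beta> - 1) * (\<beta> - 2) \<le> 0"
    using beta_gt_1 beta_less_2 by (simp add: mult_nonneg_nonpos)
  then have "\<beta> * (\<beta>/2) - (\<beta> - 1) \<le> \<beta>/2" by (simp add: field_simps)
  ultimately show ?thesis
    using True unfolding balanced_domain_def balanced_map_def digit_def by simp
next
  case False
  have "1 * v \<le> \<beta> * v" using assms beta_gt_1 beta_less_2 unfolding balanced_domain_def
    by (intro mult_right_mono) auto
  moreover have "\<beta> * v < \<beta> * (1/2)" using False beta_pos by (intro mult_strict_left_mono) auto
  ultimately show ?thesis
    using False assms unfolding balanced_domain_def balanced_map_def digit_def by simp
qed

lemma funpow_T_in_X: "v \<in> X \<Longrightarrow> (T ^^ n) v \<in> X"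
  by (induction n) (auto intro: T_in_X)

subsection \<open>Inverse branches\<close>

definition branch0 :: "real \<Rightarrow> real" where
  "branch0 v = v / \<beta>"

definition branch1 :: "real \<Rightarrow> real" where
  "branch1 v = (v + \<beta> - 1) / \<beta>"

lemma one_minus_branch1: "1 - branch1 v = (1 - v) / \<beta>"
  unfolding branch1_def using beta_pos by (simp add: field_simps)

lemma branch_of_T: "w = branch0 (T w) \<or> w = branch1 (T w)"
  unfolding branch0_def branch1_def balanced_map_def digit_def using beta_pos by simp

context
  fixes v assumes v_in_X: "v \<in> X"
begin

lemma branch0_less: "branch0 v < 1/2"
  using v_in_X beta_pos unfolding branch0_def balanced_domain_def by (simp add: field_simps)

lemma branch1_ge: "branch1 v \<ge> 1/2"
  using v_in_X beta_pos unfolding branch1_def balanced_domain_def by (simp add: field_simps)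

lemma T_branch0: "T (branch0 v) = v"
  using branch0_less beta_pos unfolding balanced_map_def digit_def by (simp add: branch0_def)

lemma T_branch1: "T (branch1 v) = v"
  using branch1_ge beta_pos unfolding balanced_map_def digit_def by (simp add: branch1_def)

lemma branch0_in_X_iff: "branch0 v \<in> X \<longleftrightarrow> \<beta> * (1 - \<beta>/2) \<le> v"
proof -
  have "branch0 v < \<beta>/2" using branch0_less beta_gt_1 by linarith
  then show ?thesis
    using beta_pos
    unfolding balanced_domain_def branch0_def by (simp add: le_divide_eq mult.commute)
qed

lemma branch1_in_X_iff: "branch1 v \<in> X \<longleftrightarrow> \<beta> * (1 - \<beta>/2) < 1 - v"
proof -
  have "1 - \<beta>/2 \<le> branch1 v" using branch1_ge beta_gt_1 by linarith
  then have "branch1 v \<in> X \<longleftrightarrow> 1 - \<beta>/2 < (1 - v) / \<beta>"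
    unfolding one_minus_branch1[symmetric] balanced_domain_def by auto
  then show ?thesis using beta_pos by (simp add: less_divide_eq mult.commute)
qed

lemma branch0_in_X: "v \<ge> 1/2 \<Longrightarrow> branch0 v \<in> X"
  using branch0_in_X_iff beta_pow_mult_left_end_le[of 1] d_ge by simp

lemma branch1_in_X: "v < 1/2 \<Longrightarrow> branch1 v \<in> X"
  using branch1_in_X_iff beta_pow_mult_left_end_le[of 1] d_ge by simp

lemma T_surj_on_X: "\<exists>u\<in>X. T u = v"
  using branch0_in_X branch1_in_X T_branch0 T_branch1 by (cases "v \<ge> 1/2") auto

end

lemma zeros_prependable:
  assumes "v \<in> X" "v \<ge> 1/2" "i \<le> d"
  shows "\<exists>w\<in>X. (T ^^ i) w = v \<and> (0 < i \<longrightarrow> w < 1/2)"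
proof -
  have "\<exists>w\<in>X. (T ^^ i) w = v \<and> \<beta> ^ i * w = v \<and> (0 < i \<longrightarrow> w < 1/2)"
    using assms(3)
  proof (induction i)
    case 0
    then show ?case using assms by simp
  next
    case (Suc i)
    then obtain w where w_in_X: "w \<in> X" and w_maps: "(T ^^ i) w = v" and w_scaled: "\<beta> ^ i * w = v"
      by auto
    have "\<beta> ^ i * (\<beta> * (1 - \<beta>/2)) \<le> \<beta> ^ i * w"
      unfolding w_scaled
        using beta_pow_mult_left_end_le[OF Suc.prems] assms(2) by (simp add: mult_ac)
    then have "branch0 w \<in> X" using branch0_in_X_iff[OF w_in_X] beta_pos by simp
    moreover have "(T ^^ Suc i) (branch0 w) = v"
      using T_branch0 w_in_X w_maps by (simp add: funpow_swap1)
    moreover have "\<beta> ^ Suc i * branch0 w = v" unfolding branch0_def using w_scaled beta_pos by simp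
    ultimately show ?case using branch0_less[OF w_in_X] by blast
  qed
  then show ?thesis by blast
qed

lemma ones_prependable:
  assumes "v \<in> X" "v < 1/2" "i \<le> d"
  shows "\<exists>w\<in>X. (T ^^ i) w = v \<and> (\<forall>j<i. (T ^^ j) w \<ge> 1/2)"
proof -
  have "\<exists>w\<in>X. (T ^^ i) w = v \<and> \<beta> ^ i * (1 - w) = 1 - v \<and> (\<forall>j<i. (T ^^ j) w \<ge> 1/2)"
    using assms(3)
  proof (induction i)
    case 0
    then show ?case using assms by auto
  next
    case (Suc i)
    then obtain w where w_in_X: "w \<in> X" and w_maps: "(T ^^ i) w = v"
      and w_scaled: "\<beta> ^ i * (1 - w) = 1 - v"
      and ones: "\<forall>j<i. (T ^^ j) w \<ge> 1/2" by auto
    have "\<beta> ^ i * (\<beta> * (1 - \<beta>/2)) < \<beta> ^ i * (1 - w)"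
      unfolding w_scaled
        using beta_pow_mult_left_end_le[OF Suc.prems] assms(2) by (simp add: mult_ac)
    then have "branch1 w \<in> X" using branch1_in_X_iff[OF w_in_X] beta_pos by simp
    moreover have "(T ^^ Suc i) (branch1 w) = v"
      using T_branch1 w_in_X w_maps by (simp add: funpow_swap1)
    moreover have "\<beta> ^ Suc i * (1 - branch1 w) = 1 - v"
      unfolding one_minus_branch1 using w_scaled beta_pos by simp
    moreover have "(T ^^ j) (branch1 w) \<ge> 1/2" if "j < Suc i" for j
      using that ones branch1_ge[OF w_in_X] T_branch1[OF w_in_X]
      by (cases j) (auto simp: funpow_swap1)
    ultimately show ?case by blast
  qed
  then show ?thesis by blast
qed

section \<open>Synchronization of expansions\<close>

definition power_sum :: "nat set \<Rightarrow> real" where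
  "power_sum A = (\<Sum>i\<in>A. (1/\<beta>) ^ i)"

definition shift_down :: "nat set \<Rightarrow> nat set" where
  "shift_down A = {i. 1 \<le> i \<and> Suc i \<in> A}"

lemma power_sum_empty [simp]: "power_sum {} = 0"
  unfolding power_sum_def by simp

lemma power_sum_nonneg: "0 \<le> power_sum A"
  unfolding power_sum_def using beta_pos by (intro sum_nonneg) auto

lemma power_sum_all: "power_sum {1..d} = 1"
  unfolding power_sum_def using beta_pos beta_pow_d by (intro sum_inverse_powers_eq_1) auto

lemma power_sum_complement:
  assumes "A \<subseteq> {1..d}"
  shows "power_sum ({1..d} - A) = 1 - power_sum A"
  using power_sum_all assms unfolding power_sum_def by (subst sum_diff) auto

lemma beta_mult_power_sum:
  assumes "finite A" "0 \<notin> A"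
  shows "\<beta> * power_sum A = of_bool (1 \<in> A) + power_sum (shift_down A)"
proof -
  have split: "A = (A \<inter> {1}) \<union> Suc ` shift_down A"
  proof -
    have "i \<in> Suc ` shift_down A" if "i \<in> A" "i \<noteq> 1" for i
      using that assms(2) unfolding shift_down_def by (cases i) (auto simp: not_less_eq_eq)
    then show ?thesis unfolding shift_down_def by auto
  qed
  have "finite (Suc ` shift_down A)"
    using assms(1) by (rule finite_subset[rotated]) (use split in auto)
  then have "power_sum A = power_sum (A \<inter> {1}) + power_sum (Suc ` shift_down A)"
    unfolding power_sum_def
    by (subst split, intro sum.union_disjoint) (auto simp: shift_down_def)
  moreover have "power_sum (Suc ` shift_down A) = power_sum (shift_down A) / \<beta>"
    unfolding power_sum_def by (simp add: sum.reindex sum_divide_distrib)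
  moreover have "power_sum (A \<inter> {1}) = of_bool (1 \<in> A) / \<beta>"
    unfolding power_sum_def by (cases "1 \<in> A") auto
  ultimately show ?thesis using beta_pos by (simp add: distrib_left)
qed

lemma shift_down_subset: "A \<subseteq> {1..Suc n} \<Longrightarrow> shift_down A \<subseteq> {1..n}"
  unfolding shift_down_def by auto

subsection \<open>Linked points\<close>

definition offset :: "nat set \<Rightarrow> real \<Rightarrow> real \<Rightarrow> bool" where
  "offset A v v' \<longleftrightarrow> A \<subseteq> {1..d} \<and> v \<in> X \<and> v' \<in> X \<and> v' - v = (\<beta> - 1) * power_sum A"

definition linked :: "real \<Rightarrow> real \<Rightarrow> bool" where
  "linked v v' \<longleftrightarrow> (\<exists>A. offset A v v' \<or> offset A v' v)"

lemma offset_empty_iff: "offset {} v v' \<longleftrightarrow> v \<in> X \<and> v' = v"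
  unfolding offset_def by auto

context
  fixes A v v' assumes offset: "offset A v v'"
begin

lemma T_diff_if_offset:
  "T v' - T v = (\<beta> - 1) * (of_bool (1 \<in> A) + power_sum (shift_down A) + digit v - digit v')"
proof -
  have "finite A" "0 \<notin> A" using offset unfolding offset_def by (auto intro: finite_subset)
  have "T v' - T v = \<beta> * (v' - v) + (\<beta> - 1) * (digit v - digit v')"
    unfolding balanced_map_def by (simp add: algebra_simps)
  also have "\<beta> * (v' - v) = (\<beta> - 1) * (\<beta> * power_sum A)" using offset unfolding offset_def by simp
  also have "\<beta> * power_sum A = of_bool (1 \<in> A) + power_sum (shift_down A)"
    using \<open>finite A\<close> \<open>0 \<notin> A\<close> by (rule beta_mult_power_sum)
  finally show ?thesis by (simp add: algebra_simps)
qed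

lemma offset_digits_less: "of_bool (1 \<in> A) + power_sum (shift_down A) + digit v - digit v' < 1"
proof -
  have "T v' - T v < \<beta> - 1"
    using offset unfolding offset_def by (intro balanced_domain_diff_less T_in_X) auto
  then have "(\<beta> - 1) * (of_bool (1 \<in> A) + power_sum (shift_down A) + digit v - digit v') < (\<beta> - 1) * 1"
    unfolding T_diff_if_offset by simp
  then show ?thesis using beta_gt_1 mult_less_cancel_left_pos[of "\<beta> - 1"] by simp
qed

lemma offset_shift_in: "T v \<in> X" "T v' \<in> X" "shift_down A \<subseteq> {1..d}"
  using offset T_in_X unfolding offset_def shift_down_def by auto

lemma offset_step_mem:
  assumes "1 \<in> A"
  shows "v < 1/2 \<and> v' \<ge> 1/2 \<and> offset (shift_down A) (T v) (T v')"
proof -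
  have digits: "v < 1/2 \<and> v' \<ge> 1/2"
    using offset_digits_less assms power_sum_nonneg[of "shift_down A"]
    by (auto simp: digit_def of_bool_def split: if_splits)
  then have "T v' - T v = (\<beta> - 1) * power_sum (shift_down A)"
    using T_diff_if_offset assms by (simp add: digit_def)
  then show ?thesis using digits offset_shift_in unfolding offset_def by simp
qed

lemma offset_step_nonmem:
  assumes "1 \<notin> A"
  shows "((v \<ge> 1/2 \<longleftrightarrow> v' \<ge> 1/2) \<and> offset (shift_down A) (T v) (T v'))
       \<or> (v < 1/2 \<and> v' \<ge> 1/2 \<and> offset ({1..d} - shift_down A) (T v') (T v))"
proof -
  consider (same) "v \<ge> 1/2 \<longleftrightarrow> v' \<ge> 1/2" | (flip) "v < 1/2" "v' \<ge> 1/2"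
    using offset_digits_less assms power_sum_nonneg[of "shift_down A"]
    by (auto simp: digit_def of_bool_def split: if_splits)
  then show ?thesis
  proof cases
    case same
    then have "digit v = digit v'" by (simp add: digit_def)
    then have "T v' - T v = (\<beta> - 1) * power_sum (shift_down A)"
      using T_diff_if_offset assms by simp
    then show ?thesis using same offset_shift_in unfolding offset_def by simp
  next
    case flip
    have "T v - T v' = - (T v' - T v)" by simp
    also have "\<dots> = (\<beta> - 1) * (1 - power_sum (shift_down A))"
      using T_diff_if_offset flip assms by (simp add: digit_def algebra_simps)
    finally have "T v - T v' = (\<beta> - 1) * power_sum ({1..d} - shift_down A)"
      using power_sum_complement[OF offset_shift_in(3)] by simp
    then show ?thesis using flip offset_shift_in unfolding offset_def by simp
  qed
qed

end

lemma linked_T: "linked v v' \<Longrightarrow> linked (T v) (T v')"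
  unfolding linked_def using offset_step_mem offset_step_nonmem by metis

lemma linked_funpow_T: "linked v v' \<Longrightarrow> linked ((T ^^ n) v) ((T ^^ n) v')"
  by (induction n) (auto intro: linked_T)

text \<open>While \<open>v\<close> reads its \<open>j\<close>-th digit 1, either \<open>v\<close> is ahead of \<open>v'\<close> with the last \<open>j\<close>
  powers absent, or \<open>v'\<close> is ahead and those of the last \<open>j\<close> powers that are present form an
  initial segment of them.\<close>

definition ones_invariant :: "nat \<Rightarrow> real \<Rightarrow> real \<Rightarrow> bool" where
  "ones_invariant j v v' \<longleftrightarrow>
     (\<exists>B\<subseteq>{1..d - j}. offset B v' v) \<or> (\<exists>A. (\<forall>k\<in>A. {d - j<..k} \<subseteq> A) \<and> offset A v v')"

lemma ones_invariant_if_linked: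
  assumes "linked v v'"
  shows "ones_invariant 0 v v'"
proof -
  have subset: "A \<subseteq> {1..d}" if "offset A w w'" for A w w'
    using that unfolding offset_def by blast
  consider (behind) A where "offset A v v'" | (ahead) A where "offset A v' v"
    using assms unfolding linked_def by blast
  then show ?thesis
  proof cases
    case behind
    then have "\<forall>k\<in>A. {d - 0<..k} \<subseteq> A" using subset by fastforce
    then show ?thesis using behind unfolding ones_invariant_def by blast
  next
    case ahead
    then show ?thesis using subset[OF ahead] unfolding ones_invariant_def by auto
  qed
qed

lemma ones_invariant_T:
  assumes "ones_invariant j v v'" "j < d" "v \<ge> 1/2"
  shows "ones_invariant (Suc j) (T v) (T v')"
  using assms(1) unfolding ones_invariant_def[of j]
proof (elim disjE exE conjE)
  fix B assume B_subset: "B \<subseteq> {1..d - j}" and offset_B: "offset B v' v"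
  have shift_B: "shift_down B \<subseteq> {1..d - Suc j}"
    using B_subset assms(2) by (intro shift_down_subset) (simp add: Suc_diff_Suc)
  consider (ahead) "offset (shift_down B) (T v') (T v)"
    | (behind) "offset ({1..d} - shift_down B) (T v) (T v')"
    using offset_step_mem[OF offset_B] offset_step_nonmem[OF offset_B] by auto
  then show ?thesis
  proof cases
    case ahead
    then show ?thesis using shift_B unfolding ones_invariant_def by auto
  next
    case behind
    moreover have "{d - Suc j<..k} \<subseteq> {1..d} - shift_down B" if "k \<in> {1..d}" for k
      using shift_B that by auto
    ultimately show ?thesis
      unfolding ones_invariant_def by (intro disjI2 exI[of _ "{1..d} - shift_down B"]) auto
  qed
next
  fix A assume A_segment: "\<forall>k\<in>A. {d - j<..k} \<subseteq> A" and offset_A: "offset A v v'"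
  have "offset (shift_down A) (T v) (T v')"
    using offset_step_mem[OF offset_A] offset_step_nonmem[OF offset_A] assms(3)
    by (meson linorder_not_le)
  moreover have "{d - Suc j<..k} \<subseteq> shift_down A" if "k \<in> shift_down A" for k
  proof
    fix i assume "i \<in> {d - Suc j<..k}"
    then have "Suc i \<in> {d - j<..Suc k}" "1 \<le> i" using assms(2) by auto
    moreover have "Suc k \<in> A" using that unfolding shift_down_def by simp
    ultimately show "i \<in> shift_down A" using A_segment unfolding shift_down_def by blast
  qed
  ultimately show ?thesis unfolding ones_invariant_def by blast
qed

lemma ones_invariant_funpow_T:
  assumes "ones_invariant 0 v v'" "j \<le> d" "\<And>i. i < j \<Longrightarrow> (T ^^ i) v \<ge> 1/2"
  shows "ones_invariant j ((T ^^ j) v) ((T ^^ j) v')"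
  using assms(2,3) by (induction j) (use assms(1) in \<open>auto intro: ones_invariant_T\<close>)

lemma offset_initial_segment_merges:
  assumes "offset A v v'" "A \<subseteq> {1..n}" "\<forall>k\<in>A. {0<..k} \<subseteq> A"
  shows "(T ^^ n) v = (T ^^ n) v'"
  using assms
proof (induction n arbitrary: A v v')
  case 0
  then show ?case by (simp add: offset_empty_iff)
next
  case (Suc n)
  show ?case
  proof (cases "A = {}")
    case True
    then show ?thesis using Suc.prems(1) by (simp add: offset_empty_iff)
  next
    case False
    then have "1 \<in> A" using Suc.prems(2,3) by fastforce
    then have "offset (shift_down A) (T v) (T v')" using offset_step_mem[OF Suc.prems(1)] by simp
    moreover have "\<forall>k\<in>shift_down A. {0<..k} \<subseteq> shift_down A"
      using Suc.prems(3) unfolding shift_down_def by force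
    ultimately have "(T ^^ n) (T v) = (T ^^ n) (T v')"
      using Suc.IH shift_down_subset[OF Suc.prems(2)] by blast
    then show ?thesis by (simp add: funpow_swap1)
  qed
qed

lemma linked_merge_after_ones:
  assumes "linked v v'" "\<And>i. i < d \<Longrightarrow> (T ^^ i) v \<ge> 1/2"
  shows "(T ^^ (2 * d)) v = (T ^^ (2 * d)) v'"
proof -
  have "ones_invariant d ((T ^^ d) v) ((T ^^ d) v')"
    using assms ones_invariant_if_linked by (intro ones_invariant_funpow_T) auto
  then consider (equal) "offset {} ((T ^^ d) v') ((T ^^ d) v)"
    | (behind) A where "\<forall>k\<in>A. {0<..k} \<subseteq> A" "offset A ((T ^^ d) v) ((T ^^ d) v')"
    unfolding ones_invariant_def by auto
  then have "(T ^^ d) ((T ^^ d) v) = (T ^^ d) ((T ^^ d) v')"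
  proof cases
    case equal
    then show ?thesis by (simp add: offset_empty_iff)
  next
    case behind
    then show ?thesis by (intro offset_initial_segment_merges) (auto simp: offset_def)
  qed
  then show ?thesis by (simp add: mult_2 funpow_add)
qed

subsection \<open>Chains of linked points\<close>

definition power_comb :: "(nat \<Rightarrow> int) \<Rightarrow> real" where
  "power_comb c = (\<Sum>i\<in>{1..d}. of_int (c i) * (1/\<beta>) ^ i)"

definition weight :: "(nat \<Rightarrow> int) \<Rightarrow> nat" where
  "weight c = (\<Sum>i\<in>{1..d}. nat \<bar>c i\<bar>)"

lemma power_comb_upd:
  "i \<in> {1..d} \<Longrightarrow> power_comb (c(i := x)) = power_comb c + (of_int x - of_int (c i)) * (1/\<beta>) ^ i"
  unfolding power_comb_def
  by (subst (1 2) sum.remove[of "{1..d}" i]) (auto simp: algebra_simps intro!: sum.cong)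

lemma weight_upd: "i \<in> {1..d} \<Longrightarrow> weight (c(i := x)) + nat \<bar>c i\<bar> = weight c + nat \<bar>x\<bar>"
  unfolding weight_def
  by (subst (1 2) sum.remove[of "{1..d}" i]) (auto intro!: sum.cong)

lemma power_comb_uminus: "power_comb (\<lambda>i. - c i) = - power_comb c"
  unfolding power_comb_def by (simp add: sum_negf)

definition step :: "nat \<Rightarrow> real" where
  "step i = (\<beta> - 1) * (1/\<beta>) ^ i"

lemma step_pos: "0 < step i"
  unfolding step_def using beta_gt_1 by simp

lemma step_le_diff_if_coeffs_nonneg:
  assumes "v' - v = (\<beta> - 1) * power_comb c" "\<And>j. j \<in> {1..d} \<Longrightarrow> c j \<ge> 0" "i \<in> {1..d}" "c i \<noteq> 0"
  shows "step i \<le> v' - v"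
proof -
  have "c i \<ge> 1" using assms(2)[OF assms(3)] assms(4) by simp
  then have "1 * (1/\<beta>) ^ i \<le> of_int (c i) * (1/\<beta>) ^ i"
    using beta_pos by (intro mult_right_mono) auto
  also have "\<dots> \<le> power_comb c"
    unfolding power_comb_def using assms(2,3) beta_pos by (intro member_le_sum) auto
  finally show ?thesis unfolding assms(1) step_def using beta_gt_1 by simp
qed

lemma step_add_step_le:
  assumes "i \<in> {1..d}" "j \<in> {1..d}" "i \<noteq> j"
  shows "step i + step j \<le> \<beta> - 1"
proof -
  have "(1/\<beta>) ^ i + (1/\<beta>) ^ j = power_sum {i, j}" using assms unfolding power_sum_def by simp
  also have "\<dots> \<le> power_sum {1..d}"
    unfolding power_sum_def using assms beta_pos by (intro sum_mono2) auto
  finally have "(1/\<beta>) ^ i + (1/\<beta>) ^ j \<le> 1" using power_sum_all by simp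
  then have "(\<beta> - 1) * ((1/\<beta>) ^ i + (1/\<beta>) ^ j) \<le> (\<beta> - 1) * 1"
    using beta_gt_1 by (intro mult_left_mono) auto
  then show ?thesis unfolding step_def by (simp only: distrib_left mult_1_right)
qed

lemma offset_step:
  assumes "i \<in> {1..d}" "v \<in> X" "v + step i \<in> X"
  shows "offset {i} v (v + step i)"
  using assms unfolding offset_def power_sum_def step_def by auto

lemma linked_signed_step:
  assumes "i \<in> {1..d}" "v \<in> X" "v + of_int (sgn k) * step i \<in> X" "k \<noteq> 0"
  shows "linked v (v + of_int (sgn k) * step i)"
proof (cases "k > 0")
  case True
  then show ?thesis using assms offset_step unfolding linked_def by (auto simp: sgn_1_pos)
next
  case False
  then have sgn: "of_int (sgn k) = (-1 :: real)" using assms(4) by simp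
  have "offset {i} (v - step i) v"
    using offset_step[OF assms(1), of "v - step i"] assms(2,3) unfolding sgn by simp
  then show ?thesis unfolding linked_def sgn by auto
qed

text \<open>Since the length of \<open>X\<close> is at least the sum of any two distinct steps, a step up or a step
  down towards the target always stays inside \<open>X\<close>.\<close>

lemma step_up_or_down_in_X:
  assumes "v \<in> X" "i \<in> {1..d}" "j \<in> {1..d}" "i \<noteq> j"
  shows "v + step i \<in> X \<or> v - step j \<in> X"
  using assms(1) step_add_step_le[OF assms(2-4)] step_pos[of i] step_pos[of j]
  unfolding balanced_domain_def by auto

lemma ex_step_within_X:
  assumes v_in_X: "v \<in> X" and v'_in_X: "v' \<in> X" and diff: "v' - v = (\<beta> - 1) * power_comb c"
    and k_range: "k \<in> {1..d}" and k_nonzero: "c k \<noteq> 0"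
  shows "\<exists>i\<in>{1..d}. c i \<noteq> 0 \<and> v + of_int (sgn (c i)) * step i \<in> X"
proof -
  consider (both) i j where "i \<in> {1..d}" "c i > 0" "j \<in> {1..d}" "c j < 0"
    | (up) "\<And>i. i \<in> {1..d} \<Longrightarrow> c i \<ge> 0" | (down) "\<And>i. i \<in> {1..d} \<Longrightarrow> c i \<le> 0"
    by (meson linorder_not_le)
  then show ?thesis
  proof cases
    case both
    then have "i \<noteq> j" by auto
    then have "v + of_int (sgn (c i)) * step i \<in> X \<or> v + of_int (sgn (c j)) * step j \<in> X"
      using step_up_or_down_in_X[OF v_in_X both(1,3)] both(2,4) by simp
    then show ?thesis using both by (metis less_irrefl)
  next
    case up
    then have "c k > 0" using up[OF k_range] k_nonzero by simp
    have "step k \<le> v' - v"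
      using diff up k_range k_nonzero by (rule step_le_diff_if_coeffs_nonneg)
    then have "v + step k \<in> X"
      using v_in_X v'_in_X step_pos[of k] unfolding balanced_domain_def by auto
    then show ?thesis using k_range \<open>c k > 0\<close> by (intro bexI[of _ k]) simp_all
  next
    case down
    then have "c k < 0" using down[OF k_range] k_nonzero by simp
    have "v - v' = (\<beta> - 1) * power_comb (\<lambda>i. - c i)" unfolding power_comb_uminus using diff by simp
    then have "step k \<le> v - v'"
      by (rule step_le_diff_if_coeffs_nonneg) (use down k_range k_nonzero in auto)
    then have "v - step k \<in> X"
      using v_in_X v'_in_X step_pos[of k] unfolding balanced_domain_def by auto
    then show ?thesis using k_range \<open>c k < 0\<close> by (intro bexI[of _ k]) simp_all
  qed
qed

lemma ex_linked_closer:
  assumes v_in_X: "v \<in> X" and v'_in_X: "v' \<in> X" and diff: "v' - v = (\<beta> - 1) * power_comb c"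
    and weight: "weight c = Suc m"
  shows "\<exists>u\<in>X. \<exists>c'. weight c' = m \<and> v' - u = (\<beta> - 1) * power_comb c' \<and> linked v u"
proof -
  obtain k where "k \<in> {1..d}" "c k \<noteq> 0"
    using weight unfolding weight_def
    by (metis Zero_not_Suc abs_zero nat_0 sum.not_neutral_contains_not_neutral)
  from ex_step_within_X[OF v_in_X v'_in_X diff this] obtain i where i_range: "i \<in> {1..d}"
    and i_nonzero: "c i \<noteq> 0"
    and u_in_X: "v + of_int (sgn (c i)) * step i \<in> X" by blast
  let ?c' = "c(i := c i - sgn (c i))"
  show ?thesis
  proof (intro bexI[OF _ u_in_X] exI[of _ ?c'] conjI)
    have "nat \<bar>c i\<bar> = Suc (nat \<bar>c i - sgn (c i)\<bar>)" using i_nonzero by (cases "c i > 0") auto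
    then show "weight ?c' = m" using weight_upd[OF i_range, of c "c i - sgn (c i)"] weight by simp
    show "v' - (v + of_int (sgn (c i)) * step i) = (\<beta> - 1) * power_comb ?c'"
      unfolding power_comb_upd[OF i_range] using diff by (simp add: step_def algebra_simps)
  qed (rule linked_signed_step[OF i_range v_in_X u_in_X i_nonzero])
qed

subsection \<open>Blocks of ones\<close>

primrec begins_with_blocks :: "nat \<Rightarrow> real \<Rightarrow> bool" where
  "begins_with_blocks 0 v \<longleftrightarrow> True"
| "begins_with_blocks (Suc N) v \<longleftrightarrow>
     (\<forall>i<d. (T ^^ i) v \<ge> 1/2) \<and> begins_with_blocks N ((T ^^ (2 * d)) v)"

lemma begins_with_blocks_mono: "begins_with_blocks N v \<Longrightarrow> m \<le> N \<Longrightarrow> begins_with_blocks m v"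
proof (induction m arbitrary: N v)
  case (Suc m)
  then show ?case by (cases N) auto
qed simp

lemma merge_after_blocks:
  assumes "v \<in> X" "v' \<in> X" "v' - v = (\<beta> - 1) * power_comb c"
    and "begins_with_blocks (weight c) ((T ^^ k) v)"
  shows "(T ^^ (k + 2 * d * weight c)) v = (T ^^ (k + 2 * d * weight c)) v'"
  using assms
proof (induction "weight c" arbitrary: v c k)
  case 0
  then have "power_comb c = 0" unfolding weight_def power_comb_def by simp
  then show ?case using 0 by simp
next
  case (Suc m)
  obtain u c' where u_in_X: "u \<in> X" and weight_c': "weight c' = m"
    and diff_u: "v' - u = (\<beta> - 1) * power_comb c'" and linked_u: "linked v u"
    using ex_linked_closer[OF Suc.prems(1-3) Suc.hyps(2)[symmetric]] by blast
  have blocks: "\<And>i. i < d \<Longrightarrow> (T ^^ i) ((T ^^ k) v) \<ge> 1/2"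
    "begins_with_blocks m ((T ^^ (2 * d)) ((T ^^ k) v))"
    using Suc.prems(4) unfolding Suc.hyps(2)[symmetric] by auto
  have merged: "(T ^^ (k + 2 * d)) v = (T ^^ (k + 2 * d)) u"
    unfolding funpow_add_apply[of k] using linked_u blocks(1)
    by (intro linked_merge_after_ones linked_funpow_T)
  then have "begins_with_blocks m ((T ^^ (k + 2 * d)) u)"
    using blocks(2) by (simp add: funpow_add_apply[of k])
  then have "(T ^^ (k + 2 * d + 2 * d * m)) u = (T ^^ (k + 2 * d + 2 * d * m)) v'"
    using Suc.hyps(1)[OF _ u_in_X Suc.prems(2) diff_u] weight_c' by simp
  then have "(T ^^ (k + 2 * d + 2 * d * m)) v = (T ^^ (k + 2 * d + 2 * d * m)) v'"
    unfolding funpow_add_apply[of "k + 2 * d"] merged .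
  then show ?case unfolding Suc.hyps(2)[symmetric] by (simp add: add.assoc)
qed

lemma block_prependable:
  assumes "v \<in> X" "v \<ge> 1/2"
  shows "\<exists>w\<in>X. w \<ge> 1/2 \<and> (T ^^ (2 * d)) w = v \<and> (\<forall>i<d. (T ^^ i) w \<ge> 1/2)"
proof -
  obtain u where u_in_X: "u \<in> X" and u_maps: "(T ^^ d) u = v" and u_less: "u < 1/2"
    using zeros_prependable[OF assms order_refl] d_ge by auto
  obtain w where w_in_X: "w \<in> X" and w_maps: "(T ^^ d) w = u" and w_ones: "\<forall>j<d. (T ^^ j) w \<ge> 1/2"
    using ones_prependable[OF u_in_X u_less order_refl] by auto
  have "w \<ge> 1/2" using w_ones[rule_format, of 0] d_ge by simp
  moreover have "(T ^^ (2 * d)) w = v"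
    using u_maps w_maps by (simp add: mult_2 funpow_add)
  ultimately show ?thesis using w_in_X w_ones by blast
qed

lemma blocks_prependable:
  assumes "v \<in> X" "v \<ge> 1/2"
  shows "\<exists>w\<in>X. w \<ge> 1/2 \<and> (T ^^ (2 * d * N)) w = v \<and> begins_with_blocks N w"
proof (induction N)
  case 0
  then show ?case using assms by auto
next
  case (Suc N)
  then obtain w where w_in_X: "w \<in> X" and w_ge: "w \<ge> 1/2" and w_maps: "(T ^^ (2 * d * N)) w = v"
    and w_blocks: "begins_with_blocks N w" by auto
  obtain u where u_in_X: "u \<in> X" and u_ge: "u \<ge> 1/2" and u_maps: "(T ^^ (2 * d)) u = w"
    and u_ones: "\<forall>i<d. (T ^^ i) u \<ge> 1/2"
    using block_prependable[OF w_in_X w_ge] by auto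
  have "(T ^^ (2 * d * Suc N)) u = v"
    unfolding mult_Suc_right funpow_add_apply[of "2 * d"] u_maps w_maps ..
  moreover have "begins_with_blocks (Suc N) u" using u_maps u_ones w_blocks by simp
  ultimately show ?case using u_in_X u_ge by blast
qed

lemma ex_preimage_reading_one:
  assumes "v \<in> X"
  shows "\<exists>w\<in>X. w \<ge> 1/2 \<and> (T ^^ 2) w = v"
proof (cases "v \<ge> 1/2")
  case True
  let ?u = "branch0 v"
  have u_in_X: "?u \<in> X" and T_u: "T ?u = v" using True branch0_in_X T_branch0 assms by auto
  have "branch1 ?u \<in> X" using branch1_in_X[OF u_in_X] branch0_less[OF assms] by simp
  moreover have "(T ^^ 2) (branch1 ?u) = v"
    using T_branch1[OF u_in_X] T_u by (simp add: numeral_2_eq_2)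
  ultimately show ?thesis using branch1_ge[OF u_in_X] by blast
next
  case False
  obtain w where w_in_X: "w \<in> X" and w_maps: "(T ^^ 2) w = v" and w_ones: "\<forall>j<2. (T ^^ j) w \<ge> 1/2"
    using ones_prependable[OF assms, of 2] d_ge False by auto
  then show ?thesis using w_ones[rule_format, of 0] by auto
qed

theorem ex_synchronizing_preimage:
  assumes "v \<in> X"
  shows "\<exists>w\<in>X. (T ^^ (2 * d * N + 2)) w = v \<and>
    (\<forall>w'\<in>X. \<forall>c. w' - w = (\<beta> - 1) * power_comb c \<longrightarrow> weight c \<le> N \<longrightarrow> (T ^^ (2 * d * N + 2)) w' = v)"
proof -
  obtain u where u_in_X: "u \<in> X" and u_ge: "u \<ge> 1/2" and u_maps: "(T ^^ 2) u = v"
    using ex_preimage_reading_one[OF assms] by auto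
  obtain w where w_in_X: "w \<in> X" and w_to_u: "(T ^^ (2 * d * N)) w = u"
    and w_blocks: "begins_with_blocks N w"
    using blocks_prependable[OF u_in_X u_ge, of N] by blast
  have w_maps_to: "(T ^^ (2 * d * N + 2)) w = v" unfolding funpow_add_apply w_to_u u_maps ..
  have "(T ^^ (2 * d * N + 2)) w' = v"
    if w'_in_X: "w' \<in> X" and w'_diff: "w' - w = (\<beta> - 1) * power_comb c"
      and w'_weight: "weight c \<le> N" for w' c
  proof -
    have "(T ^^ (0 + 2 * d * weight c)) w = (T ^^ (0 + 2 * d * weight c)) w'"
      using begins_with_blocks_mono[OF w_blocks w'_weight]
      by (intro merge_after_blocks[OF w_in_X w'_in_X w'_diff]) simp
    moreover have "2 * d * N + 2 = 2 * d * weight c + (2 * d * (N - weight c) + 2)"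
      using w'_weight by (simp add: diff_mult_distrib2)
    ultimately show ?thesis using w_maps_to by (simp only: funpow_add_apply add_0)
  qed
  then show ?thesis using w_in_X w_maps_to by auto
qed

section \<open>Integral coordinates\<close>

lemma inverse_beta_in_Z: "1/\<beta> \<in> Z\<beta>"
proof -
  obtain d' where d_eq: "d = Suc d'" using d_ge by (cases d) auto
  have "\<beta> ^ d = (\<Sum>i<Suc d'. \<beta> ^ i)" using beta_pow_d d_eq by simp
  then have "\<beta> ^ d = (\<Sum>i<d'. \<beta> ^ Suc i) + 1"
    unfolding sum.lessThan_Suc_shift by simp
  then have "1 = \<beta> * (\<beta> ^ d' - (\<Sum>i<d'. \<beta> ^ i))"
    unfolding d_eq by (simp add: algebra_simps sum_distrib_left)
  then have "1/\<beta> = \<beta> ^ d' - (\<Sum>i<d'. \<beta> ^ i)" using beta_pos by (simp add: divide_eq_eq mult.commute)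
  then show ?thesis by (simp add: int_adjoin_intros)
qed

lemma beta_mult_in_Z_iff: "\<beta> * x \<in> Z\<beta> \<longleftrightarrow> x \<in> Z\<beta>"
proof
  assume "\<beta> * x \<in> Z\<beta>"
  then have "1/\<beta> * (\<beta> * x) \<in> Z\<beta>" by (rule int_adjoin_mult[OF inverse_beta_in_Z])
  moreover have "1/\<beta> * (\<beta> * x) = x" using beta_pos by simp
  ultimately show "x \<in> Z\<beta>" by (simp only:)
qed (rule int_adjoin_generator_mult)

lemma beta_power_mult_in_Z_iff: "\<beta> ^ n * x \<in> Z\<beta> \<longleftrightarrow> x \<in> Z\<beta>"
  by (induction n) (auto simp: beta_mult_in_Z_iff mult.assoc)

lemma power_comb_in_Z: "power_comb c \<in> Z\<beta>"
  unfolding power_comb_def by (intro int_adjoin_intros inverse_beta_in_Z int_adjoin_of_int)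

lemma power_comb_const: "power_comb (\<lambda>_. m) = of_int m"
proof -
  have "of_int m * power_sum {1..d} = power_comb (\<lambda>_. m)"
    unfolding power_sum_def power_comb_def sum_distrib_left ..
  then show ?thesis using power_sum_all by simp
qed

lemma power_comb_add: "power_comb (\<lambda>i. c i + c' i) = power_comb c + power_comb c'"
  unfolding power_comb_def sum.distrib[symmetric] by (simp add: algebra_simps)

definition mult_coords :: "(nat \<Rightarrow> int) \<Rightarrow> nat \<Rightarrow> int" where
  "mult_coords c i = c 1 + (if i = d then 0 else c (Suc i))"

lemma beta_mult_power_comb: "\<beta> * power_comb c = power_comb (mult_coords c)"
proof -
  obtain d' where d_eq: "d = Suc d'" using d_ge by (cases d) auto
  have "\<beta> * power_comb c = (\<Sum>i\<in>{1..d}. of_int (c i) * (\<beta> * (1/\<beta>) ^ i))"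
    unfolding power_comb_def sum_distrib_left by (simp add: mult.left_commute)
  also have "\<dots> = (\<Sum>i\<in>{..<d}. of_int (c (Suc i)) * (1/\<beta>) ^ i)"
    by (rule sum.reindex_bij_witness[of _ Suc "\<lambda>i. i - 1"])
       (use beta_pos in \<open>auto simp: field_simps power_Suc[symmetric] simp del: power_Suc\<close>)
  also have "{..<d} = insert 0 {1..d'}" using d_eq by auto
  also have "(\<Sum>i\<in>insert 0 {1..d'}. of_int (c (Suc i)) * (1/\<beta>) ^ i)
      = of_int (c 1) + (\<Sum>i\<in>{1..d'}. of_int (c (Suc i)) * (1/\<beta>) ^ i)" by simp
  also have "(\<Sum>i\<in>{1..d'}. of_int (c (Suc i)) * (1/\<beta>) ^ i)
      = power_comb (\<lambda>i. if i = d then 0 else c (Suc i))"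
    unfolding power_comb_def by (rule sum.mono_neutral_cong_left) (use d_eq in auto)
  finally show ?thesis unfolding mult_coords_def power_comb_add power_comb_const .
qed

lemma in_Z_iff_power_comb: "x \<in> Z\<beta> \<longleftrightarrow> (\<exists>c. x = power_comb c)"
proof
  assume "x \<in> Z\<beta>"
  then show "\<exists>c. x = power_comb c"
  proof (induction rule: int_adjoin_induct)
    case zero
    show ?case using power_comb_const[of 0] by auto
  next
    case (step k y)
    then obtain c where y_eq: "y = power_comb c" by auto
    show ?case
      unfolding y_eq beta_mult_power_comb power_comb_const[of k, symmetric] power_comb_add[symmetric]
      by blast
  qed
qed (use power_comb_in_Z in auto)

section \<open>Residue classes and preimages\<close>

lemma d_same_residue_1: "same_residue \<beta> (of_int (int d)) 1"
proof -
  have "same_residue \<beta> (\<Sum>i<d. 1) (\<Sum>i<d. \<beta> ^ i)"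
    using same_residue_generator_power same_residue_sym by (intro same_residue_sum) blast
  then have "same_residue \<beta> (real d) (\<beta> ^ d)" unfolding beta_pow_d by simp
  also have "same_residue \<beta> (\<beta> ^ d) 1" by (rule same_residue_generator_power)
  finally show ?thesis by simp
qed

lemma of_int_same_residue_if_dvd:
  assumes "(int d - 1) dvd (j - j')"
  shows "same_residue \<beta> (of_int j) (of_int j')"
proof -
  obtain k where diff_eq: "j - j' = k * (int d - 1)" using assms by (metis dvdE mult.commute)
  have "same_residue \<beta> (of_int k * (real d - 1)) (of_int k * 0)"
    using d_same_residue_1
    by (intro same_residue_mult_left) (simp_all add: same_residue_diff_iff_0[of \<beta> "real d"])
  moreover have "of_int j - of_int j' = of_int k * (real d - 1)"
    using arg_cong[OF diff_eq, of real_of_int] by simp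
  ultimately show ?thesis using same_residue_diff_iff_0[of \<beta> "of_int j"] by simp
qed

lemma Z_same_residue_representative:
  assumes "x \<in> Z\<beta>"
  shows "\<exists>h\<in>{1..d - 1}. same_residue \<beta> x (of_int (int h))"
proof -
  obtain j :: int where x_residue: "same_residue \<beta> x (of_int j)"
    using int_adjoin_same_residue_int[OF assms] ..
  let ?r = "(j - 1) mod (int d - 1)"
  have r_nonneg: "0 \<le> ?r" and r_less: "?r < int d - 1" using d_ge by auto
  have "(int d - 1) dvd (j - 1 - ?r)" by (rule dvd_minus_mod)
  then have "same_residue \<beta> (of_int j) (of_int (int (nat (1 + ?r))))"
    using r_nonneg by (intro of_int_same_residue_if_dvd) (simp add: algebra_simps)
  then have "same_residue \<beta> x (of_int (int (nat (1 + ?r))))"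
    using x_residue same_residue_trans by blast
  moreover have "nat (1 + ?r) \<in> {1..d - 1}" using r_nonneg r_less by auto
  ultimately show ?thesis by blast
qed

lemma same_residue_beta_minus_1_digit: "same_residue \<beta> ((\<beta> - 1) * digit v) 0"
  unfolding same_residue_def digit_def by auto

lemma T_in_Z_iff: "T w \<in> Z\<beta> \<longleftrightarrow> w \<in> Z\<beta>"
proof -
  have "same_residue \<beta> (\<beta> * w - T w) 0"
    unfolding balanced_map_def using same_residue_beta_minus_1_digit by simp
  then show ?thesis
    using same_residue_int_adjoin_iff same_residue_diff_iff_0 beta_mult_in_Z_iff by metis
qed

lemma T_same_residue:
  assumes "w \<in> Z\<beta>"
  shows "same_residue \<beta> (T w) w"
proof -
  have "same_residue \<beta> (\<beta> * w + -1 * ((\<beta> - 1) * digit w)) (w + -1 * 0)"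
    using same_residue_generator_mult[OF assms] same_residue_beta_minus_1_digit
      int_adjoin_of_int[of "-1"]
    by (intro same_residue_add same_residue_mult_left) auto
  then show ?thesis unfolding balanced_map_def by simp
qed

lemma funpow_T_in_Z_iff: "(T ^^ n) w \<in> Z\<beta> \<longleftrightarrow> w \<in> Z\<beta>"
  by (induction n) (auto simp: T_in_Z_iff)

lemma funpow_T_same_residue: "w \<in> Z\<beta> \<Longrightarrow> same_residue \<beta> ((T ^^ n) w) w"
proof (induction n)
  case (Suc n)
  then have "same_residue \<beta> (T ((T ^^ n) w)) ((T ^^ n) w)"
    by (intro T_same_residue) (simp add: funpow_T_in_Z_iff)
  then show ?case using Suc same_residue_trans by simp
qed simp

definition layer :: "int \<Rightarrow> real set" where
  "layer j = X \<inter> residue_class \<beta> j"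

lemma layer_iff: "v \<in> layer j \<longleftrightarrow> v \<in> X \<and> same_residue \<beta> v (of_int j)"
  unfolding layer_def by (simp add: mem_residue_class_iff)

lemma layer_subset: "layer j \<subseteq> X \<inter> Z\<beta>"
  using same_residue_int_adjoin_iff by (auto simp: layer_iff)

lemma layerD:
  assumes "v \<in> layer j"
  shows "v \<in> X" "v \<in> Z\<beta>"
  using assms layer_subset by auto

lemma layer_same_residue: "v \<in> layer j \<Longrightarrow> v' \<in> layer j \<Longrightarrow> same_residue \<beta> v v'"
  unfolding layer_iff using same_residue_trans same_residue_sym by blast

lemma X_Z_eq_Union_layers: "X \<inter> Z\<beta> = (\<Union>h\<in>{1..d - 1}. layer (int h))"
  using Z_same_residue_representative layer_subset by (fastforce simp: layer_iff)

lemma funpow_T_in_layer_iff: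
  assumes "w \<in> X"
  shows "(T ^^ n) w \<in> layer j \<longleftrightarrow> w \<in> layer j"
proof (cases "w \<in> Z\<beta>")
  case True
  then show ?thesis
    using funpow_T_same_residue[OF True, of n] same_residue_sym same_residue_trans assms funpow_T_in_X
    unfolding layer_iff by blast
next
  case False
  then show ?thesis using funpow_T_in_Z_iff[of n w] layer_subset by blast
qed

definition T_preimage :: "nat \<Rightarrow> real \<Rightarrow> real set" where
  "T_preimage n v = {w \<in> X. (T ^^ n) w = v}"

lemma T_preimage_0: "v \<in> X \<Longrightarrow> T_preimage 0 v = {v}"
  unfolding T_preimage_def by auto

lemma T_preimage_add: "T_preimage (m + n) v = (\<Union>u\<in>T_preimage n v. T_preimage m u)"
  unfolding T_preimage_def using funpow_T_in_X by (auto simp: funpow_add_apply)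

lemma funpow_T_in_T_preimage: "w \<in> T_preimage (m + n) v \<Longrightarrow> (T ^^ m) w \<in> T_preimage n v"
  unfolding T_preimage_def by (simp add: funpow_add_apply funpow_T_in_X)

lemma finite_T_preimage: "finite (T_preimage n v)"
proof (induction n arbitrary: v)
  case 0
  show ?case by (rule finite_subset[of _ "{v}"]) (auto simp: T_preimage_def)
next
  case (Suc n)
  have "T_preimage 1 v \<subseteq> {branch0 v, branch1 v}" unfolding T_preimage_def using branch_of_T by auto
  then have "finite (T_preimage 1 v)" by (rule finite_subset) simp
  then show ?case using Suc T_preimage_add[of n 1 v] by simp
qed

lemma T_preimage_nonempty:
  assumes "v \<in> X"
  shows "T_preimage n v \<noteq> {}"
proof (induction n)
  case 0
  show ?case using assms by (simp add: T_preimage_0)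
next
  case (Suc n)
  then obtain u where "u \<in> X" "(T ^^ n) u = v" unfolding T_preimage_def by auto
  moreover obtain w where "w \<in> X" "T w = u" using T_surj_on_X[OF \<open>u \<in> X\<close>] by blast
  ultimately show ?case unfolding T_preimage_def by (auto simp: funpow_swap1)
qed

lemma T_preimage_in_Z: "v \<in> Z\<beta> \<Longrightarrow> w \<in> T_preimage n v \<Longrightarrow> w \<in> X \<and> w \<in> Z\<beta>"
  unfolding T_preimage_def using funpow_T_in_Z_iff by auto

lemma T_preimage_in_layer: "v \<in> layer j \<Longrightarrow> w \<in> T_preimage n v \<Longrightarrow> w \<in> layer j"
  unfolding T_preimage_def using funpow_T_in_layer_iff by auto

subsection \<open>Digit types\<close>

text \<open>The type of \<open>v\<close> records how many digits 0 and how many digits 1 can be prepended to the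
  expansion of \<open>v\<close>. It determines the tile of \<open>v\<close> up to translation.\<close>

definition digit_type :: "real \<Rightarrow> nat set \<times> nat set" where
  "digit_type v = ({i \<in> {..d}. \<beta> ^ i * (1 - \<beta>/2) \<le> v}, {i \<in> {..d}. \<beta> ^ i * (1 - \<beta>/2) < 1 - v})"

lemma finite_digit_types: "finite (range digit_type)"
  by (rule finite_subset[of _ "Pow {..d} \<times> Pow {..d}"]) (auto simp: digit_type_def)

lemma beta_pow_Suc_d_mult_left_end: "\<beta> ^ Suc d * (1 - \<beta>/2) = \<beta>/2"
  unfolding power_Suc mult.assoc beta_pow_d_mult_left_end by simp

context
  fixes v assumes v_in_X: "v \<in> X"
begin

lemma branch0_in_X_iff_digit_type: "branch0 v \<in> X \<longleftrightarrow> 1 \<in> fst (digit_type v)"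
  unfolding branch0_in_X_iff[OF v_in_X] digit_type_def using d_ge by simp

lemma branch1_in_X_iff_digit_type: "branch1 v \<in> X \<longleftrightarrow> 1 \<in> snd (digit_type v)"
  unfolding branch1_in_X_iff[OF v_in_X] digit_type_def using d_ge by simp

lemma digit_type_branch0: "digit_type (branch0 v) = ({i \<in> {..d}. Suc i \<in> fst (digit_type v)}, {..d})"
proof -
  have "\<beta> ^ i * (1 - \<beta>/2) \<le> branch0 v \<longleftrightarrow> \<beta> ^ Suc i * (1 - \<beta>/2) \<le> v" for i
    unfolding branch0_def using beta_pos by (simp add: le_divide_eq mult_ac)
  moreover have "\<not> \<beta> ^ Suc d * (1 - \<beta>/2) \<le> v"
    unfolding beta_pow_Suc_d_mult_left_end using v_in_X unfolding balanced_domain_def by simp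
  ultimately have "\<beta> ^ i * (1 - \<beta>/2) \<le> branch0 v \<longleftrightarrow> Suc i \<in> fst (digit_type v)" if "i \<le> d" for i
    unfolding digit_type_def using that by (cases "i = d") auto
  moreover have "\<beta> ^ i * (1 - \<beta>/2) < 1 - branch0 v" if "i \<le> d" for i
    using beta_pow_mult_left_end_le[OF that] branch0_less[OF v_in_X] by linarith
  ultimately show ?thesis unfolding digit_type_def[of "branch0 v"] by auto
qed

lemma digit_type_branch1: "digit_type (branch1 v) = ({..d}, {i \<in> {..d}. Suc i \<in> snd (digit_type v)})"
proof -
  have "\<beta> ^ i * (1 - \<beta>/2) < 1 - branch1 v \<longleftrightarrow> \<beta> ^ Suc i * (1 - \<beta>/2) < 1 - v" for i
    unfolding one_minus_branch1 using beta_pos by (simp add: less_divide_eq mult_ac)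
  moreover have "\<not> \<beta> ^ Suc d * (1 - \<beta>/2) < 1 - v"
    unfolding beta_pow_Suc_d_mult_left_end using v_in_X unfolding balanced_domain_def by simp
  ultimately have "\<beta> ^ i * (1 - \<beta>/2) < 1 - branch1 v \<longleftrightarrow> Suc i \<in> snd (digit_type v)" if "i \<le> d" for i
    unfolding digit_type_def using that by (cases "i = d") auto
  moreover have "\<beta> ^ i * (1 - \<beta>/2) \<le> branch1 v" if "i \<le> d" for i
    using beta_pow_mult_left_end_le[OF that] branch1_ge[OF v_in_X] by linarith
  ultimately show ?thesis unfolding digit_type_def[of "branch1 v"] by auto
qed

end

lemma same_digit_type_step:
  assumes "v \<in> X" "v' \<in> X" "digit_type v = digit_type v'" and u_preimage: "u \<in> T_preimage 1 v"
  shows "u + (v' - v) / \<beta> \<in> T_preimage 1 v' \<and> digit_type (u + (v' - v) / \<beta>) = digit_type u"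
proof -
  consider (zero) "u = branch0 v" | (one) "u = branch1 v"
    using u_preimage branch_of_T[of u] unfolding T_preimage_def by auto
  then show ?thesis
  proof cases
    case zero
    then have "u + (v' - v) / \<beta> = branch0 v'"
      unfolding branch0_def by (simp add: diff_divide_distrib)
    then show ?thesis
      using zero assms branch0_in_X_iff_digit_type digit_type_branch0 T_branch0
      unfolding T_preimage_def by auto
  next
    case one
    then have "u + (v' - v) / \<beta> = branch1 v'"
      unfolding branch1_def by (simp add: diff_divide_distrib add_divide_distrib)
    then show ?thesis
      using one assms branch1_in_X_iff_digit_type digit_type_branch1 T_branch1
      unfolding T_preimage_def by auto
  qed
qed

lemma T_preimage_translate:
  assumes "v \<in> X" "v' \<in> X" "digit_type v = digit_type v'" "w \<in> T_preimage n v"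
  shows "w + (v' - v) / \<beta> ^ n \<in> T_preimage n v'"
  using assms
proof (induction n arbitrary: v v')
  case 0
  then show ?case by (auto simp: T_preimage_def)
next
  case (Suc n)
  then obtain u where u_preimage: "u \<in> T_preimage 1 v" and w_preimage: "w \<in> T_preimage n u"
    using T_preimage_add[of n 1 v] by auto
  let ?u' = "u + (v' - v) / \<beta>"
  have u'_preimage: "?u' \<in> T_preimage 1 v'" and u'_type: "digit_type u = digit_type ?u'"
    using same_digit_type_step[OF Suc.prems(1-3) u_preimage] by auto
  then have "w + (?u' - u) / \<beta> ^ n \<in> T_preimage n ?u'"
    using Suc.IH[OF _ _ u'_type w_preimage] u_preimage unfolding T_preimage_def by auto
  then have "w + (v' - v) / \<beta> ^ Suc n \<in> T_preimage n ?u'" by (simp add: mult.commute)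
  then show ?case using T_preimage_add[of n 1 v'] u'_preimage by auto
qed

subsection \<open>The symmetric transformation\<close>

lemma mem_XS_iff: "x \<in> XS \<beta> \<longleftrightarrow> -1/2 \<le> x \<and> x < 1/2 \<and> frac x \<in> X"
proof (cases "-1/2 \<le> x \<and> x < 1/2")
  case True
  have "frac x = (if x < 0 then x + 1 else x)"
    using floor_between_minus_1_and_1[of x] True unfolding frac_def by simp
  then show ?thesis
    using True beta_gt_1 beta_less_2
    by (auto simp: XS_def XS_neg_def XS_pos_def balanced_domain_def)
next
  case False
  then show ?thesis using beta_gt_1 beta_less_2 by (auto simp: XS_def XS_neg_def XS_pos_def)
qed

lemma bij_betw_frac_XS: "bij_betw frac (XS \<beta>) X"
  unfolding bij_betw_def
proof
  show "inj_on frac (XS \<beta>)"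
  proof (rule inj_onI)
    fix x y assume "x \<in> XS \<beta>" "y \<in> XS \<beta>" and frac_eq: "frac x = frac y"
    then have "\<bar>x - y\<bar> < 1" by (auto simp: mem_XS_iff)
    moreover obtain n where "x = y + of_int n" using frac_eqE[OF frac_eq] .
    ultimately show "x = y" by simp
  qed
  have "v \<in> frac ` XS \<beta>" if v_in_X: "v \<in> X" for v
  proof -
    define x where "x = (if v < 1/2 then v else v - 1)"
    have "frac v = v" using v_in_X beta_gt_1 beta_less_2 by (auto simp: balanced_domain_def frac_eq)
    moreover have "frac (v - 1) = frac v" using frac_1_eq[of "v - 1"] by simp
    ultimately have "frac x = v" unfolding x_def by simp
    moreover have "-1/2 \<le> x" "x < 1/2"
      using v_in_X beta_gt_1 beta_less_2 unfolding x_def balanced_domain_def by auto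
    ultimately show ?thesis using v_in_X mem_XS_iff by (metis image_eqI)
  qed
  then show "frac ` XS \<beta> = X" by (auto simp: mem_XS_iff)
qed

lemma bij_betw_frac_XS_Int: "bij_betw frac {x \<in> XS \<beta>. frac x \<in> S} (X \<inter> S)"
  using bij_betw_frac_XS unfolding bij_betw_def inj_on_def by auto

lemma frac_in_Z_iff: "frac x \<in> Z\<beta> \<longleftrightarrow> x \<in> Z\<beta>"
proof -
  have "frac x = x - of_int \<lfloor>x\<rfloor>" "x = frac x + of_int \<lfloor>x\<rfloor>" by (simp_all add: frac_def)
  then show ?thesis using int_adjoin_of_int int_adjoin_add int_adjoin_diff by metis
qed

lemma frac_TS:
  assumes "x \<in> XS \<beta>"
  shows "frac (TS \<beta> x) = T (frac x)"
proof -
  have x_ge: "-1/2 \<le> x" and x_less: "x < 1/2" using assms by (simp_all add: mem_XS_iff)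
  have bounds: "-1 \<le> \<beta> * x" "\<beta> * x < 1"
  proof -
    have "\<beta> * (-1/2) \<le> \<beta> * x" "\<beta> * x < \<beta> * (1/2)"
      using x_ge x_less beta_pos by (intro mult_left_mono mult_strict_left_mono; simp)+
    then show "-1 \<le> \<beta> * x" "\<beta> * x < 1" using beta_less_2 by auto
  qed
  have "frac (TS \<beta> x) = frac (\<beta> * x)"
    unfolding TS_def using frac_add_of_int_right[of "\<beta> * x" "- \<lfloor>\<beta> * x + 1/2\<rfloor>"] by simp
  also have "\<dots> = (if x < 0 then \<beta> * x + 1 else \<beta> * x)"
  proof -
    have "\<beta> * x < 0 \<longleftrightarrow> x < 0" using beta_pos by (simp add: mult_less_0_iff)
    then show ?thesis using floor_between_minus_1_and_1[OF bounds] unfolding frac_def by simp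
  qed
  also have "\<dots> = T (frac x)"
    using x_ge x_less floor_between_minus_1_and_1[of x]
    unfolding balanced_map_def digit_def frac_def by (auto simp: algebra_simps)
  finally show ?thesis .
qed

lemma TS_in_XS:
  assumes "x \<in> XS \<beta>"
  shows "TS \<beta> x \<in> XS \<beta>"
proof -
  have "frac (TS \<beta> x) \<in> X" using assms T_in_X unfolding frac_TS[OF assms] by (simp add: mem_XS_iff)
  moreover have "-1/2 \<le> TS \<beta> x" "TS \<beta> x < 1/2" unfolding TS_def by linarith+
  ultimately show ?thesis by (simp add: mem_XS_iff)
qed

lemma funpow_TS_in_XS: "x \<in> XS \<beta> \<Longrightarrow> (TS \<beta> ^^ n) x \<in> XS \<beta>"
  by (induction n) (auto intro: TS_in_XS)

lemma frac_funpow_TS: "x \<in> XS \<beta> \<Longrightarrow> frac ((TS \<beta> ^^ n) x) = (T ^^ n) (frac x)"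
  by (induction n) (auto simp: frac_TS funpow_TS_in_XS)

lemma frac_image_TS_preimage:
  assumes "x \<in> XS \<beta>"
  shows "frac ` TS_preimage \<beta> n x = T_preimage n (frac x)"
proof -
  have "(TS \<beta> ^^ n) y = x \<longleftrightarrow> (T ^^ n) (frac y) = frac x" if "y \<in> XS \<beta>" for y
    unfolding frac_funpow_TS[OF that, symmetric]
    using inj_on_eq_iff[OF bij_betw_imp_inj_on[OF bij_betw_frac_XS] funpow_TS_in_XS[OF that] assms]
    by simp
  moreover have "frac y \<in> X" if "y \<in> XS \<beta>" for y using that mem_XS_iff by blast
  ultimately have "TS_preimage \<beta> n x = {y \<in> XS \<beta>. frac y \<in> T_preimage n (frac x)}"
    unfolding TS_preimage_def T_preimage_def by blast
  then show ?thesis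
    using bij_betw_imp_surj_on[OF bij_betw_frac_XS_Int[of "T_preimage n (frac x)"]]
    by (auto simp: T_preimage_def)
qed

lemma layer_index_eq: "layer_index d \<beta> h = {x \<in> XS \<beta>. frac x \<in> layer (int h)}"
proof -
  have pos: "frac x = x" if "x \<in> XS_pos \<beta>" for x
    using that beta_less_2 unfolding XS_pos_def by (intro frac_eq_id) auto
  have neg: "frac x = x + 1" if "x \<in> XS_neg \<beta>" for x
  proof -
    have "frac (x + 1) = x + 1"
      using that beta_less_2 unfolding XS_neg_def by (intro frac_eq_id) auto
    then show ?thesis by (simp only: frac_1_eq)
  qed
  have shift: "same_residue \<beta> x (of_int (int h - int d))
      \<longleftrightarrow> same_residue \<beta> (x + 1) (of_int (int h))" for x
  proof -
    have "int h - int d + 1 - int h = - (int d - 1)" by simp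
    then have "(int d - 1) dvd (int h - int d + 1 - int h)" by (simp only: dvd_minus_iff dvd_refl)
    then have "same_residue \<beta> (of_int (int h - int d) + 1) (of_int (int h))"
      using of_int_same_residue_if_dvd by fastforce
    moreover have "same_residue \<beta> x y \<longleftrightarrow> same_residue \<beta> (x + 1) (y + 1)" for y
      unfolding same_residue_def by simp
    ultimately show ?thesis using same_residue_trans same_residue_sym by blast
  qed
  have "frac x \<in> X" if "x \<in> XS \<beta>" for x using that mem_XS_iff by blast
  then have "x \<in> layer_index d \<beta> h \<longleftrightarrow> x \<in> XS \<beta> \<and> frac x \<in> layer (int h)" for x
    using pos[of x] neg[of x] shift[of x]
    by (auto simp: layer_index_def mem_residue_class_iff layer_iff XS_def)
  then show ?thesis by blast
qed

end

section \<open>Tiles of the balanced transformation\<close>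

locale bonacci_embedding = bonacci d \<beta> + linear_contraction M \<theta>
  for d :: nat and \<beta> :: real and M :: "'a::euclidean_space \<Rightarrow> 'a" and \<theta> :: real +
  fixes \<Phi> :: "real \<Rightarrow> 'a"
  assumes Phi_add: "x \<in> Z\<beta> \<Longrightarrow> y \<in> Z\<beta> \<Longrightarrow> \<Phi> (x + y) = \<Phi> x + \<Phi> y"
    and Phi_beta_mult: "x \<in> Z\<beta> \<Longrightarrow> \<Phi> (\<beta> * x) = M (\<Phi> x)"
    and discrete: "finite {x \<in> Z\<beta>. \<bar>x\<bar> \<le> a \<and> norm (\<Phi> x) \<le> b}"
    and relatively_dense: "\<exists>K. \<forall>t z. \<exists>x\<in>Z\<beta>. \<bar>x - t\<bar> \<le> K \<and> dist (\<Phi> x) z \<le> K"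
begin

lemma Phi_0: "\<Phi> 0 = 0"
  using Phi_add[of 0 0] by simp

lemma Phi_diff: "x \<in> Z\<beta> \<Longrightarrow> y \<in> Z\<beta> \<Longrightarrow> \<Phi> (x - y) = \<Phi> x - \<Phi> y"
  using Phi_add[of "x - y" y] int_adjoin_diff by (simp add: algebra_simps)

lemma Phi_beta_power_mult: "x \<in> Z\<beta> \<Longrightarrow> \<Phi> (\<beta> ^ n * x) = (M ^^ n) (\<Phi> x)"
  by (induction n) (auto simp: Phi_beta_mult beta_power_mult_in_Z_iff mult.assoc)

lemma dist_funpow_Phi_le:
  assumes "x \<in> Z\<beta>" "dist (\<Phi> x) z \<le> r"
  shows "dist (\<Phi> (\<beta> ^ n * x)) ((M ^^ n) z) \<le> r * \<theta> ^ n"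
proof -
  have "dist (\<Phi> (\<beta> ^ n * x)) ((M ^^ n) z) \<le> \<theta> ^ n * dist (\<Phi> x) z"
    unfolding Phi_beta_power_mult[OF assms(1)] by (rule dist_funpow_le)
  also have "\<dots> \<le> \<theta> ^ n * r" using assms(2) theta by (intro mult_left_mono) auto
  finally show ?thesis by (simp add: mult.commute)
qed

definition tile_radius :: real where
  "tile_radius = norm (\<Phi> (\<beta> - 1)) / (1 - \<theta>)"

lemma tile_radius_nonneg: "0 \<le> tile_radius"
  unfolding tile_radius_def using theta by simp

lemma dist_Phi_T_le:
  assumes "w \<in> Z\<beta>"
  shows "dist (\<Phi> (\<beta> ^ Suc n * w)) (\<Phi> (\<beta> ^ n * T w)) \<le> tile_radius * (\<theta> ^ n - \<theta> ^ Suc n)"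
proof -
  have digit_in_Z: "(\<beta> - 1) * digit w \<in> Z\<beta>"
    unfolding digit_def by (intro int_adjoin_mult int_adjoin_diff) auto
  have "\<Phi> (\<beta> * w) - \<Phi> (T w) = \<Phi> ((\<beta> - 1) * digit w)"
    using Phi_diff[of "\<beta> * w" "T w"] assms T_in_Z_iff
    by (simp add: beta_mult_in_Z_iff balanced_map_def)
  then have "dist (\<Phi> (\<beta> * w)) (\<Phi> (T w)) \<le> norm (\<Phi> (\<beta> - 1))"
    unfolding digit_def by (auto simp: Phi_0 dist_norm)
  then have "dist (\<Phi> (\<beta> ^ n * (\<beta> * w))) ((M ^^ n) (\<Phi> (T w))) \<le> norm (\<Phi> (\<beta> - 1)) * \<theta> ^ n"
    using assms by (intro dist_funpow_Phi_le) (simp_all add: beta_mult_in_Z_iff)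
  also have "\<dots> = tile_radius * (\<theta> ^ n - \<theta> ^ Suc n)"
    unfolding tile_radius_def using theta by (simp add: field_simps)
  finally show ?thesis
    unfolding Phi_beta_power_mult[OF T_in_Z_iff[THEN iffD2, OF assms]]
    by (simp add: power_Suc2 mult.assoc del: power_Suc)
qed

lemma dist_Phi_funpow_T_le:
  assumes "w \<in> Z\<beta>"
  shows "dist (\<Phi> (\<beta> ^ (m + n) * w)) (\<Phi> (\<beta> ^ n * (T ^^ m) w)) \<le> tile_radius * (\<theta> ^ n - \<theta> ^ (m + n))"
  using assms
proof (induction m arbitrary: w)
  case (Suc m)
  have "dist (\<Phi> (\<beta> ^ (Suc m + n) * w)) (\<Phi> (\<beta> ^ n * (T ^^ Suc m) w))
      \<le> dist (\<Phi> (\<beta> ^ Suc (m + n) * w)) (\<Phi> (\<beta> ^ (m + n) * T w))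
      + dist (\<Phi> (\<beta> ^ (m + n) * T w)) (\<Phi> (\<beta> ^ n * (T ^^ m) (T w)))"
    unfolding funpow_Suc_right comp_apply add_Suc by (rule dist_triangle)
  also have "\<dots> \<le> tile_radius * (\<theta> ^ (m + n) - \<theta> ^ Suc (m + n)) + tile_radius * (\<theta> ^ n - \<theta> ^ (m + n))"
    using Suc.prems by (intro add_mono dist_Phi_T_le Suc.IH) (simp_all add: T_in_Z_iff)
  also have "\<dots> = tile_radius * (\<theta> ^ n - \<theta> ^ (Suc m + n))" by (simp add: algebra_simps)
  finally show ?case .
qed simp

subsection \<open>Tiles as decreasing intersections\<close>

definition approximation :: "nat \<Rightarrow> real \<Rightarrow> 'a set" where
  "approximation n v = (\<Union>w\<in>T_preimage n v. cball (\<Phi> (\<beta> ^ n * w)) (tile_radius * \<theta> ^ n))"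

definition balanced_tile :: "real \<Rightarrow> 'a set" where
  "balanced_tile v = (\<Inter>n. approximation n v)"

lemma mem_approximation_iff:
  "z \<in> approximation n v \<longleftrightarrow> (\<exists>w\<in>T_preimage n v. dist (\<Phi> (\<beta> ^ n * w)) z \<le> tile_radius * \<theta> ^ n)"
  unfolding approximation_def by auto

lemma balanced_tile_near_preimage:
  "z \<in> balanced_tile v \<Longrightarrow> \<exists>w\<in>T_preimage n v. dist (\<Phi> (\<beta> ^ n * w)) z \<le> tile_radius * \<theta> ^ n"
  unfolding balanced_tile_def mem_approximation_iff[symmetric] by blast

lemma Phi_mem_approximation: "w \<in> T_preimage n v \<Longrightarrow> \<Phi> (\<beta> ^ n * w) \<in> approximation n v"
  unfolding mem_approximation_iff using tile_radius_nonneg theta by (intro bexI[of _ w]) auto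

lemma compact_approximation: "compact (approximation n v)"
  unfolding approximation_def using finite_T_preimage by (intro compact_UN) auto

lemma approximation_nonempty: "v \<in> X \<Longrightarrow> approximation n v \<noteq> {}"
  using Phi_mem_approximation T_preimage_nonempty by (metis equals0I empty_iff)

text \<open>The radius is chosen such that the balls shrink by at least the distance of their centres.\<close>

lemma approximation_decreasing:
  assumes "v \<in> Z\<beta>" "m \<le> n"
  shows "approximation n v \<subseteq> approximation m v"
proof
  obtain k where n_eq: "n = k + m" using assms(2) by (metis le_add_diff_inverse2)
  fix z assume "z \<in> approximation n v"
  then obtain w where w_preimage: "w \<in> T_preimage n v"
    and w_close: "dist (\<Phi> (\<beta> ^ n * w)) z \<le> tile_radius * \<theta> ^ n"
    unfolding mem_approximation_iff by blast
  have "dist (\<Phi> (\<beta> ^ m * (T ^^ k) w)) z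
      \<le> dist (\<Phi> (\<beta> ^ n * w)) (\<Phi> (\<beta> ^ m * (T ^^ k) w)) + dist (\<Phi> (\<beta> ^ n * w)) z"
    by (rule dist_triangle3)
  also have "\<dots> \<le> tile_radius * (\<theta> ^ m - \<theta> ^ n) + tile_radius * \<theta> ^ n"
    using w_close T_preimage_in_Z[OF assms(1) w_preimage]
    unfolding n_eq by (intro add_mono dist_Phi_funpow_T_le) auto
  also have "\<dots> = tile_radius * \<theta> ^ m" by (simp add: algebra_simps)
  finally show "z \<in> approximation m v"
    using funpow_T_in_T_preimage w_preimage unfolding n_eq mem_approximation_iff by blast
qed

lemma dist_Phi_balanced_tile_le:
  assumes "v \<in> X" "z \<in> balanced_tile v"
  shows "dist (\<Phi> v) z \<le> tile_radius"
  using balanced_tile_near_preimage[OF assms(2), of 0] assms(1) by (simp add: T_preimage_0)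

lemma dist_in_balanced_tile_le:
  assumes "v \<in> X" "y \<in> balanced_tile v" "z \<in> balanced_tile v"
  shows "dist y z \<le> 2 * tile_radius"
  using dist_Phi_balanced_tile_le[OF assms(1,2)] dist_Phi_balanced_tile_le[OF assms(1,3)]
    dist_triangle3[of y z "\<Phi> v"] by simp

lemma compact_balanced_tile: "compact (balanced_tile v)"
  unfolding balanced_tile_def by (intro compact_Inter) (use compact_approximation in auto)

lemma balanced_tile_nonempty:
  assumes "v \<in> X" "v \<in> Z\<beta>"
  shows "balanced_tile v \<noteq> {}"
  unfolding balanced_tile_def
  using assms
  by (intro compact_nest compact_approximation approximation_nonempty approximation_decreasing)

text \<open>By the pigeonhole principle, one point of \<open>F\<close> is reached for infinitely many \<open>n\<close>, so that
  the limit lies in each approximation of its tile.\<close>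

lemma limit_mem_balanced_tile:
  assumes "finite F" and w_in: "\<And>n. w n \<in> X \<inter> Z\<beta>" and orbit_in_F: "\<And>n. (T ^^ n) (w n) \<in> F"
    and lim: "(\<lambda>n. \<Phi> (\<beta> ^ n * w n)) \<longlonglongrightarrow> z"
  shows "\<exists>v\<in>F. z \<in> balanced_tile v"
proof -
  obtain v where v_in_F: "v \<in> F" and v_recurrent: "infinite {n. (T ^^ n) (w n) = v}"
    using pigeonhole_infinite_rel[of UNIV F "\<lambda>n v. (T ^^ n) (w n) = v"] assms(1) orbit_in_F by auto
  have "z \<in> approximation m v" for m
  proof (rule ccontr)
    assume "z \<notin> approximation m v"
    then have "\<forall>\<^sub>F n in sequentially. \<Phi> (\<beta> ^ n * w n) \<in> - approximation m v"
      using compact_imp_closed[OF compact_approximation]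
      by (intro topological_tendstoD[OF lim]) auto
    then obtain N where avoids: "\<And>n. n \<ge> N \<Longrightarrow> \<Phi> (\<beta> ^ n * w n) \<notin> approximation m v"
      by (auto simp: eventually_sequentially)
    obtain n where n_ge: "n \<ge> max N m" and orbit_n: "(T ^^ n) (w n) = v"
      using v_recurrent unfolding infinite_nat_iff_unbounded_le by blast
    have "v \<in> Z\<beta>" using w_in orbit_n funpow_T_in_Z_iff by blast
    moreover have "w n \<in> T_preimage n v" using w_in orbit_n unfolding T_preimage_def by auto
    then have "\<Phi> (\<beta> ^ n * w n) \<in> approximation n v" by (rule Phi_mem_approximation)
    ultimately show False using approximation_decreasing[of v m n] avoids[of n] n_ge by auto
  qed
  then show ?thesis using v_in_F unfolding balanced_tile_def by blast
qed

lemma funpow_mem_balanced_tile: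
  assumes v_in_Z: "v \<in> Z\<beta>" and w_preimage: "w \<in> T_preimage k v" and z_in_tile: "z \<in> balanced_tile w"
  shows "(M ^^ k) z \<in> balanced_tile v"
proof -
  have "(M ^^ k) z \<in> approximation (n + k) v" for n
  proof -
    obtain u where u_preimage: "u \<in> T_preimage n w"
      and u_close: "dist (\<Phi> (\<beta> ^ n * u)) z \<le> tile_radius * \<theta> ^ n"
      using balanced_tile_near_preimage[OF z_in_tile] by blast
    have "\<beta> ^ n * u \<in> Z\<beta>"
      using u_preimage T_preimage_in_Z v_in_Z w_preimage beta_power_mult_in_Z_iff by blast
    then have "dist (\<Phi> (\<beta> ^ k * (\<beta> ^ n * u))) ((M ^^ k) z) \<le> tile_radius * \<theta> ^ n * \<theta> ^ k"
      using u_close by (intro dist_funpow_Phi_le)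
    moreover have "u \<in> T_preimage (n + k) v" using u_preimage w_preimage T_preimage_add by blast
    ultimately show ?thesis
      unfolding mem_approximation_iff by (intro bexI[of _ u]) (simp_all add: power_add mult_ac)
  qed
  then show ?thesis
    using approximation_decreasing[OF v_in_Z, of n "n + k" for n]
    unfolding balanced_tile_def by auto
qed

theorem balanced_tile_subdivision:
  assumes "v \<in> Z\<beta>"
  shows "balanced_tile v = (\<Union>w\<in>T_preimage k v. (M ^^ k) ` balanced_tile w)"
proof (intro equalityI subsetI)
  fix z assume "z \<in> balanced_tile v"
  then have "\<forall>n. \<exists>u\<in>T_preimage (n + k) v. dist (\<Phi> (\<beta> ^ (n + k) * u)) z \<le> tile_radius * \<theta> ^ (n + k)"
    using balanced_tile_near_preimage by blast
  then obtain u where u_preimage: "\<And>n. u n \<in> T_preimage (n + k) v"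
    and close: "\<And>n. dist (\<Phi> (\<beta> ^ (n + k) * u n)) z \<le> tile_radius * \<theta> ^ (n + k)" by metis
  obtain y where z_eq: "z = (M ^^ k) y" using surj_funpow[of k] by (metis surjD)
  have u_in: "u n \<in> X \<inter> Z\<beta>" for n using T_preimage_in_Z[OF assms u_preimage] by blast
  have "(\<lambda>n. \<Phi> (\<beta> ^ (n + k) * u n)) \<longlonglongrightarrow> z"
  proof (rule LIM_zero_cancel, rule Lim_null_comparison)
    show "\<forall>\<^sub>F n in sequentially. norm (\<Phi> (\<beta> ^ (n + k) * u n) - z) \<le> tile_radius * \<theta> ^ (n + k)"
      using close by (simp add: dist_norm)
    show "(\<lambda>n. tile_radius * \<theta> ^ (n + k)) \<longlonglongrightarrow> 0"
      using tendsto_theta_power[of tile_radius] by (rule LIMSEQ_ignore_initial_segment)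
  qed
  moreover have "\<Phi> (\<beta> ^ (n + k) * u n) = (M ^^ k) (\<Phi> (\<beta> ^ n * u n))" for n
    using u_in[of n] by (simp add: Phi_beta_power_mult funpow_add_apply)
  ultimately have "(\<lambda>n. \<Phi> (\<beta> ^ n * u n)) \<longlonglongrightarrow> y" unfolding z_eq by (simp add: tendsto_funpow_cancel)
  then obtain w where "w \<in> T_preimage k v" "y \<in> balanced_tile w"
    using limit_mem_balanced_tile[OF finite_T_preimage u_in funpow_T_in_T_preimage[OF u_preimage]]
    by blast
  then show "z \<in> (\<Union>w\<in>T_preimage k v. (M ^^ k) ` balanced_tile w)" unfolding z_eq by blast
qed (use funpow_mem_balanced_tile[OF assms] in blast)

lemma dist_Phi_frac_le:
  assumes "y \<in> XS \<beta>" "y \<in> Z\<beta>"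
  shows "dist (\<Phi> (\<beta> ^ n * y)) (\<Phi> (\<beta> ^ n * frac y)) \<le> norm (\<Phi> 1) * \<theta> ^ n"
proof -
  have "y - frac y = 0 \<or> frac y - y = 1"
    using assms(1) floor_between_minus_1_and_1[of y] by (auto simp: mem_XS_iff frac_def)
  then have "dist (\<Phi> y) (\<Phi> (frac y)) \<le> norm (\<Phi> 1)"
    using Phi_diff[of "frac y" y] frac_in_Z_iff[of y] assms(2)
    by (auto simp: dist_norm norm_minus_commute)
  then show ?thesis
    using dist_funpow_Phi_le[OF assms(2)] frac_in_Z_iff assms(2) by (simp add: Phi_beta_power_mult)
qed

lemma dist_Phi_TS_preimage_le:
  assumes "x \<in> XS \<beta>" "x \<in> Z\<beta>" "y \<in> TS_preimage \<beta> n x"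
    and close: "dist (\<Phi> (\<beta> ^ n * frac y)) z \<le> tile_radius * \<theta> ^ n"
  shows "dist (\<Phi> (\<beta> ^ n * y)) z \<le> (norm (\<Phi> 1) + tile_radius) * \<theta> ^ n"
proof -
  have "frac y \<in> T_preimage n (frac x)" using assms(3) frac_image_TS_preimage[OF assms(1)] by blast
  then have "y \<in> XS \<beta>" "y \<in> Z\<beta>"
    using assms(2,3) T_preimage_in_Z frac_in_Z_iff unfolding TS_preimage_def by blast+
  then have "dist (\<Phi> (\<beta> ^ n * y)) (\<Phi> (\<beta> ^ n * frac y)) \<le> norm (\<Phi> 1) * \<theta> ^ n"
    by (rule dist_Phi_frac_le)
  then show ?thesis
    using close dist_triangle[of "\<Phi> (\<beta> ^ n * y)" z "\<Phi> (\<beta> ^ n * frac y)"]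
    by (simp add: distrib_right)
qed

theorem hausdorff_lim_eq_balanced_tile:
  assumes x_in_XS: "x \<in> XS \<beta>" and x_in_Z: "x \<in> Z\<beta>"
  shows "hausdorff_lim (\<lambda>n. (\<lambda>y. \<Phi> (\<beta> ^ n * y)) ` TS_preimage \<beta> n x) = balanced_tile (frac x)"
proof (rule hausdorff_lim_eqI[OF compact_balanced_tile])
  have frac_in_X: "frac x \<in> X" and frac_in_Z: "frac x \<in> Z\<beta>"
    using x_in_XS x_in_Z mem_XS_iff frac_in_Z_iff by auto
  let ?\<delta> = "\<lambda>n. (norm (\<Phi> 1) + tile_radius) * \<theta> ^ n"
  note close = dist_Phi_TS_preimage_le[OF x_in_XS x_in_Z]
  show "hausdorff_tendsto (\<lambda>n. (\<lambda>y. \<Phi> (\<beta> ^ n * y)) ` TS_preimage \<beta> n x) (balanced_tile (frac x))"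
  proof (rule hausdorff_tendstoI[OF tendsto_theta_power])
    fix n a assume "a \<in> (\<lambda>y. \<Phi> (\<beta> ^ n * y)) ` TS_preimage \<beta> n x"
    then obtain y where y_preimage: "y \<in> TS_preimage \<beta> n x" and a_eq: "a = \<Phi> (\<beta> ^ n * y)" by blast
    then have w_preimage: "frac y \<in> T_preimage n (frac x)"
      using frac_image_TS_preimage[OF x_in_XS] by blast
    have w_in: "frac y \<in> X" "frac y \<in> Z\<beta>" using T_preimage_in_Z[OF frac_in_Z w_preimage] by auto
    obtain z where z_in_tile: "z \<in> balanced_tile (frac y)"
      using balanced_tile_nonempty[OF w_in] by blast
    then have "dist (\<Phi> (frac y)) z \<le> tile_radius" by (rule dist_Phi_balanced_tile_le[OF w_in(1)])
    then have "dist a ((M ^^ n) z) \<le> ?\<delta> n"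
      unfolding a_eq using dist_funpow_Phi_le[OF w_in(2)] by (intro close[OF y_preimage]) auto
    then show "\<exists>k\<in>balanced_tile (frac x). dist a k \<le> ?\<delta> n"
      using funpow_mem_balanced_tile[OF frac_in_Z w_preimage z_in_tile] by blast
  next
    fix n k assume "k \<in> balanced_tile (frac x)"
    then obtain w where w_preimage: "w \<in> T_preimage n (frac x)"
      and w_close: "dist (\<Phi> (\<beta> ^ n * w)) k \<le> tile_radius * \<theta> ^ n"
      using balanced_tile_near_preimage by blast
    then obtain y where "y \<in> TS_preimage \<beta> n x" "w = frac y"
      using frac_image_TS_preimage[OF x_in_XS] by blast
    then show "\<exists>a\<in>(\<lambda>y. \<Phi> (\<beta> ^ n * y)) ` TS_preimage \<beta> n x. dist a k \<le> ?\<delta> n"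
      using close w_close by blast
  qed
qed

subsection \<open>Shapes and local finiteness\<close>

lemma balanced_tile_translate_subset:
  assumes v_in: "v \<in> X \<inter> Z\<beta>" and v'_in: "v' \<in> X \<inter> Z\<beta>" and same_type: "digit_type v = digit_type v'"
  shows "(+) (\<Phi> v' - \<Phi> v) ` balanced_tile v \<subseteq> balanced_tile v'"
proof -
  have "\<Phi> v' - \<Phi> v + z \<in> approximation n v'" if "z \<in> balanced_tile v" for n z
  proof -
    obtain w where w_preimage: "w \<in> T_preimage n v"
      and w_close: "dist (\<Phi> (\<beta> ^ n * w)) z \<le> tile_radius * \<theta> ^ n"
      using balanced_tile_near_preimage[OF \<open>z \<in> balanced_tile v\<close>] by blast
    let ?w' = "w + (v' - v) / \<beta> ^ n"
    have "\<beta> ^ n * w \<in> Z\<beta>" using T_preimage_in_Z v_in w_preimage beta_power_mult_in_Z_iff by blast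
    moreover have "\<beta> ^ n * ?w' = \<beta> ^ n * w + (v' - v)" using beta_pos by (simp add: distrib_left)
    ultimately have "\<Phi> (\<beta> ^ n * ?w') = \<Phi> (\<beta> ^ n * w) + (\<Phi> v' - \<Phi> v)"
      using v_in v'_in by (simp add: Phi_add Phi_diff int_adjoin_diff)
    then have "dist (\<Phi> (\<beta> ^ n * ?w')) (\<Phi> v' - \<Phi> v + z) = dist (\<Phi> (\<beta> ^ n * w)) z"
      by (simp add: dist_norm)
    moreover have "?w' \<in> T_preimage n v'"
      using v_in v'_in same_type w_preimage by (intro T_preimage_translate) auto
    ultimately show ?thesis using w_close unfolding mem_approximation_iff by metis
  qed
  then show ?thesis unfolding balanced_tile_def by blast
qed

lemma balanced_tile_translate:
  assumes "v \<in> X \<inter> Z\<beta>" "v' \<in> X \<inter> Z\<beta>" "digit_type v = digit_type v'"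
  shows "balanced_tile v' = (+) (\<Phi> v' - \<Phi> v) ` balanced_tile v"
proof
  have "(+) (\<Phi> v' - \<Phi> v) ` (+) (\<Phi> v - \<Phi> v') ` balanced_tile v' = balanced_tile v'"
    by (simp add: image_image)
  then show "balanced_tile v' \<subseteq> (+) (\<Phi> v' - \<Phi> v) ` balanced_tile v"
    using image_mono[OF balanced_tile_translate_subset[OF assms(2,1) assms(3)[symmetric]]] by metis
qed (rule balanced_tile_translate_subset[OF assms])

lemma balanced_tiles_finitely_many_shapes:
  "\<exists>\<S>. finite \<S> \<and> (\<forall>v\<in>X \<inter> Z\<beta>. \<exists>S\<in>\<S>. \<exists>t. balanced_tile v = (+) t ` S)"
proof -
  have "finite (digit_type ` (X \<inter> Z\<beta>))"
    using finite_digit_types by (rule finite_subset[rotated]) auto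
  then have "\<exists>R\<subseteq>X \<inter> Z\<beta>. finite R \<and> digit_type ` (X \<inter> Z\<beta>) = digit_type ` R"
    by (rule finite_subset_image[OF _ order_refl])
  then obtain R where R_subset: "R \<subseteq> X \<inter> Z\<beta>" and R_finite: "finite R"
    and R_types: "digit_type ` (X \<inter> Z\<beta>) = digit_type ` R"
    by (elim exE conjE)
  have "\<exists>S\<in>balanced_tile ` R. \<exists>t. balanced_tile v = (+) t ` S" if v_in: "v \<in> X \<inter> Z\<beta>" for v
  proof -
    obtain r where "r \<in> R" "digit_type r = digit_type v" using R_types v_in by (metis imageE imageI)
    then show ?thesis using balanced_tile_translate[of r v] R_subset v_in by blast
  qed
  then show ?thesis using R_finite by (intro exI[of _ "balanced_tile ` R"]) simp
qed

lemma finite_near: "finite {v \<in> X \<inter> Z\<beta>. dist (\<Phi> v) z \<le> r}"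
proof (rule finite_subset[OF _ discrete[of 1 "r + norm z"]])
  have "\<bar>v\<bar> \<le> 1" if "v \<in> X" for v
    using that beta_less_2 unfolding balanced_domain_def by auto
  moreover have "norm (\<Phi> v) \<le> r + norm z" if "dist (\<Phi> v) z \<le> r" for v
    using that norm_triangle_sub[of "\<Phi> v" z] by (simp add: dist_norm)
  ultimately show "{v \<in> X \<inter> Z\<beta>. dist (\<Phi> v) z \<le> r} \<subseteq> {x \<in> Z\<beta>. \<bar>x\<bar> \<le> 1 \<and> norm (\<Phi> x) \<le> r + norm z}"
    by auto
qed

lemma balanced_tiles_locally_finite: "finite {v \<in> X \<inter> Z\<beta>. balanced_tile v \<inter> ball z r \<noteq> {}}"
proof (rule finite_subset[OF _ finite_near[of z "tile_radius + r"]])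
  have "dist (\<Phi> v) z \<le> tile_radius + r" if v_in_X: "v \<in> X" and y_in_tile: "y \<in> balanced_tile v"
    and y_close: "dist z y < r" for v y
    using dist_Phi_balanced_tile_le[OF v_in_X y_in_tile] y_close dist_triangle2[of "\<Phi> v" z y]
    by simp
  then show "{v \<in> X \<inter> Z\<beta>. balanced_tile v \<inter> ball z r \<noteq> {}}
      \<subseteq> {v \<in> X \<inter> Z\<beta>. dist (\<Phi> v) z \<le> tile_radius + r}"
    by auto
qed

section \<open>Each layer covers\<close>

lemma residue_class_relatively_dense:
  "\<exists>K. \<forall>t z. \<exists>x\<in>Z\<beta>. same_residue \<beta> x (of_int j) \<and> \<bar>x - t\<bar> \<le> K \<and> dist (\<Phi> x) z \<le> K"
proof -
  obtain K where K_dense: "\<And>t z. \<exists>x\<in>Z\<beta>. \<bar>x - t\<bar> \<le> K \<and> dist (\<Phi> x) z \<le> K"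
    using relatively_dense by auto
  let ?shift = "\<lambda>h. of_int (j - int h) :: real"
  define L where "L = (\<Sum>h\<in>{1..d - 1}. \<bar>?shift h\<bar> + norm (\<Phi> (?shift h)))"
  have "\<exists>x'\<in>Z\<beta>. same_residue \<beta> x' (of_int j) \<and> \<bar>x' - t\<bar> \<le> K + L \<and> dist (\<Phi> x') z \<le> K + L" for t z
  proof -
    obtain x where x_in_Z: "x \<in> Z\<beta>" and x_close: "\<bar>x - t\<bar> \<le> K" and Phi_x_close: "dist (\<Phi> x) z \<le> K"
      using K_dense by blast
    obtain h where h_range: "h \<in> {1..d - 1}" and x_residue: "same_residue \<beta> x (of_int (int h))"
      using Z_same_residue_representative[OF x_in_Z] by blast
    have "\<bar>?shift h\<bar> + norm (\<Phi> (?shift h)) \<le> L"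
      unfolding L_def using h_range by (intro member_le_sum) auto
    then have shift_le: "\<bar>?shift h\<bar> \<le> L" "norm (\<Phi> (?shift h)) \<le> L"
      using norm_ge_zero[of "\<Phi> (?shift h)"] abs_ge_zero[of "?shift h"] by linarith+
    let ?x' = "x + ?shift h"
    have "same_residue \<beta> ?x' (of_int (int h) + ?shift h)"
      using x_residue by (intro same_residue_add same_residue_refl)
    then have "same_residue \<beta> ?x' (of_int j)" by simp
    moreover have "\<bar>?x' - t\<bar> \<le> K + L" using x_close shift_le(1) by linarith
    moreover have "dist (\<Phi> ?x') (\<Phi> x) = norm (\<Phi> (?shift h))"
      unfolding dist_norm Phi_add[OF x_in_Z int_adjoin_of_int] by simp
    then have "dist (\<Phi> ?x') z \<le> K + L"
      using Phi_x_close shift_le(2) dist_triangle[of "\<Phi> ?x'" z "\<Phi> x"] by simp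
    moreover have "?x' \<in> Z\<beta>" using x_in_Z int_adjoin_of_int by (rule int_adjoin_add)
    ultimately show ?thesis by blast
  qed
  then show ?thesis by blast
qed

text \<open>Division by \<open>\<beta>\<^sup>m\<close> preserves the residue class and brings the point into \<open>X\<close>, while it enlarges
  distances between images under \<open>\<Phi>\<close> by a bounded factor only.\<close>

lemma layer_relatively_dense: "\<exists>K. \<forall>z. \<exists>v\<in>layer j. dist (\<Phi> v) z \<le> K"
proof -
  obtain K where K_dense: "\<And>t z. \<exists>x\<in>Z\<beta>. same_residue \<beta> x (of_int j) \<and> \<bar>x - t\<bar> \<le> K \<and> dist (\<Phi> x) z \<le> K"
    using residue_class_relatively_dense by blast
  obtain m where scale_large: "K * 2 / (\<beta> - 1) < \<beta> ^ m" using real_arch_pow[OF beta_gt_1] by blast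
  obtain B where B_pos: "B > 0" and B_le: "\<And>x. B * norm x \<le> norm ((M ^^ m) x)"
    using linear_inj_bounded_below_pos[OF linear_funpow inj_fn[OF inj_M], of m] by blast
  have "\<exists>v\<in>layer j. dist (\<Phi> v) z \<le> K / B" for z
  proof -
    obtain x where x_in_Z: "x \<in> Z\<beta>" and x_residue: "same_residue \<beta> x (of_int j)"
      and x_close: "\<bar>x - \<beta> ^ m / 2\<bar> \<le> K"
      and Phi_x_close: "dist (\<Phi> x) ((M ^^ m) z) \<le> K" using K_dense by blast
    define v where "v = x / \<beta> ^ m"
    have x_eq: "x = \<beta> ^ m * v" unfolding v_def using beta_pos by simp
    have v_in_Z: "v \<in> Z\<beta>" using x_in_Z unfolding x_eq beta_power_mult_in_Z_iff .
    have "\<beta> ^ m * \<bar>v - 1/2\<bar> = \<bar>x - \<beta> ^ m / 2\<bar>"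
      using beta_pos abs_mult[of "\<beta> ^ m" "v - 1/2"] unfolding x_eq by (simp add: right_diff_distrib)
    also have "\<dots> < \<beta> ^ m * ((\<beta> - 1) / 2)"
      using x_close scale_large beta_gt_1 by (simp add: field_simps)
    finally have "\<bar>v - 1/2\<bar> < (\<beta> - 1) / 2" using beta_pos by simp
    then have "v \<in> X" unfolding balanced_domain_def abs_less_iff by auto
    moreover have "same_residue \<beta> (v * \<beta> ^ m) (v * 1)"
      using v_in_Z same_residue_generator_power by (intro same_residue_mult_left)
    then have "same_residue \<beta> v (of_int j)"
      using x_residue same_residue_sym same_residue_trans
      unfolding x_eq by (metis mult.commute mult_1_right)
    ultimately have "v \<in> layer j" by (simp add: layer_iff)
    moreover have "B * dist (\<Phi> v) z \<le> K"
      using B_le[of "\<Phi> v - z"] Phi_x_close Phi_beta_power_mult[OF v_in_Z]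
      unfolding funpow_diff x_eq dist_norm by simp
    then have "dist (\<Phi> v) z \<le> K / B" using B_pos by (simp add: le_divide_eq mult.commute)
    ultimately show ?thesis by blast
  qed
  then show ?thesis by blast
qed

theorem balanced_tiles_of_layer_cover: "\<exists>v\<in>layer j. z \<in> balanced_tile v"
proof -
  obtain K where K_dense: "\<And>z. \<exists>v\<in>layer j. dist (\<Phi> v) z \<le> K" using layer_relatively_dense by blast
  have "\<exists>w\<in>layer j. dist (\<Phi> (\<beta> ^ n * w)) z \<le> K * \<theta> ^ n" for n
  proof -
    obtain y where z_eq: "z = (M ^^ n) y" using surj_funpow[of n] by (metis surjD)
    obtain w where "w \<in> layer j" "dist (\<Phi> w) y \<le> K" using K_dense by blast
    then show ?thesis unfolding z_eq using dist_funpow_Phi_le layerD(2) by blast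
  qed
  then obtain w where w_layer: "\<And>n. w n \<in> layer j"
    and close: "\<And>n. dist (\<Phi> (\<beta> ^ n * w n)) z \<le> K * \<theta> ^ n"
    by metis
  define F where "F = {v \<in> layer j. dist (\<Phi> v) z \<le> tile_radius + \<bar>K\<bar>}"
  have w_in: "w n \<in> X \<inter> Z\<beta>" for n using w_layer layer_subset by blast
  have "finite F"
    unfolding F_def by (rule finite_subset[OF _ finite_near]) (use layer_subset in auto)
  moreover have "(T ^^ n) (w n) \<in> F" for n
  proof -
    have "dist (\<Phi> (\<beta> ^ n * w n)) (\<Phi> ((T ^^ n) (w n))) \<le> tile_radius * (1 - \<theta> ^ n)"
      using dist_Phi_funpow_T_le[of "w n" n 0] w_in by simp
    also have "\<dots> \<le> tile_radius * 1" using tile_radius_nonneg theta by (intro mult_left_mono) auto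
    finally have "dist (\<Phi> ((T ^^ n) (w n))) z \<le> tile_radius + K * \<theta> ^ n"
      using close[of n] dist_triangle3[of "\<Phi> ((T ^^ n) (w n))" z "\<Phi> (\<beta> ^ n * w n)"] by simp
    moreover have "K * \<theta> ^ n \<le> \<bar>K\<bar> * 1" using theta by (intro mult_mono power_le_one) auto
    ultimately show ?thesis
      using w_layer[of n] w_in[of n] funpow_T_in_layer_iff unfolding F_def by auto
  qed
  moreover have "(\<lambda>n. \<Phi> (\<beta> ^ n * w n)) \<longlonglongrightarrow> z"
  proof (rule LIM_zero_cancel, rule Lim_null_comparison)
    show "\<forall>\<^sub>F n in sequentially. norm (\<Phi> (\<beta> ^ n * w n) - z) \<le> K * \<theta> ^ n"
      using close by (simp add: dist_norm)
  qed (rule tendsto_theta_power)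
  ultimately have "\<exists>v\<in>F. z \<in> balanced_tile v" by (rule limit_mem_balanced_tile[OF _ w_in])
  then show ?thesis unfolding F_def by blast
qed

section \<open>Each layer covers almost every point once\<close>

definition overlap :: "int \<Rightarrow> 'a set" where
  "overlap j = {z. \<exists>v\<in>layer j. \<exists>v'\<in>layer j. v \<noteq> v' \<and> z \<in> balanced_tile v \<and> z \<in> balanced_tile v'}"

lemma neighbours_bounded_weight:
  "\<exists>N. \<forall>u. u \<in> Z\<beta> \<longrightarrow> same_residue \<beta> u 0 \<longrightarrow> \<bar>u\<bar> \<le> 1 \<longrightarrow> norm (\<Phi> u) \<le> r \<longrightarrow>
     (\<exists>c. u = (\<beta> - 1) * power_comb c \<and> weight c \<le> N)"
proof -
  define F where "F = {u \<in> Z\<beta>. \<bar>u\<bar> \<le> 1 \<and> norm (\<Phi> u) \<le> r}"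
  have "finite F" unfolding F_def by (rule discrete)
  have "\<forall>u. same_residue \<beta> u 0 \<longrightarrow> (\<exists>c. u = (\<beta> - 1) * power_comb c)"
    unfolding same_residue_def using in_Z_iff_power_comb by force
  then obtain c where u_eq: "\<And>u. same_residue \<beta> u 0 \<Longrightarrow> u = (\<beta> - 1) * power_comb (c u)" by metis
  have "weight (c u) \<le> (\<Sum>u\<in>F. weight (c u))" if "u \<in> F" for u
    using \<open>finite F\<close> that by (intro member_le_sum) auto
  then show ?thesis using u_eq unfolding F_def by blast
qed

lemma ex_preimage_synchronizing_neighbours:
  "\<exists>n. \<forall>v\<in>X \<inter> Z\<beta>. \<exists>w\<in>T_preimage n v. \<forall>w'\<in>X \<inter> Z\<beta>.
     same_residue \<beta> w' w \<longrightarrow> dist (\<Phi> w') (\<Phi> w) \<le> r \<longrightarrow> (T ^^ n) w' = v"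
proof -
  obtain N where weight_bound: "\<And>u. u \<in> Z\<beta> \<Longrightarrow> same_residue \<beta> u 0 \<Longrightarrow> \<bar>u\<bar> \<le> 1 \<Longrightarrow> norm (\<Phi> u) \<le> r \<Longrightarrow>
      \<exists>c. u = (\<beta> - 1) * power_comb c \<and> weight c \<le> N"
    using neighbours_bounded_weight by blast
  let ?n = "2 * d * N + 2"
  have "\<exists>w\<in>T_preimage ?n v. \<forall>w'\<in>X \<inter> Z\<beta>.
      same_residue \<beta> w' w \<longrightarrow> dist (\<Phi> w') (\<Phi> w) \<le> r \<longrightarrow> (T ^^ ?n) w' = v" if v_in: "v \<in> X \<inter> Z\<beta>" for v
  proof -
    obtain w where w_in_X: "w \<in> X" and w_maps: "(T ^^ ?n) w = v" and
      synchronizing: "\<And>w' c. w' \<in> X \<Longrightarrow> w' - w = (\<beta> - 1) * power_comb c \<Longrightarrow> weight c \<le> N \<Longrightarrow>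
        (T ^^ ?n) w' = v"
      using ex_synchronizing_preimage[of v N] v_in by blast
    have w_preimage: "w \<in> T_preimage ?n v" unfolding T_preimage_def using w_in_X w_maps by simp
    then have w_in_Z: "w \<in> Z\<beta>" using T_preimage_in_Z v_in by blast
    have "(T ^^ ?n) w' = v"
      if w'_in: "w' \<in> X \<inter> Z\<beta>" and w'_residue: "same_residue \<beta> w' w"
        and w'_close: "dist (\<Phi> w') (\<Phi> w) \<le> r" for w'
    proof -
      have "\<bar>w' - w\<bar> \<le> 1" using w_in_X w'_in beta_less_2 unfolding balanced_domain_def by auto
      moreover have "norm (\<Phi> (w' - w)) \<le> r"
        using w'_in w'_close w_in_Z by (simp add: Phi_diff dist_norm)
      ultimately obtain c where "w' - w = (\<beta> - 1) * power_comb c" "weight c \<le> N"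
        using weight_bound[of "w' - w"] w'_in w'_residue w_in_Z same_residue_diff_iff_0[of \<beta> w' w]
          int_adjoin_diff by blast
      then show ?thesis using synchronizing w'_in by blast
    qed
    then show ?thesis using w_preimage by blast
  qed
  then show ?thesis by blast
qed

lemma ex_exclusive_ball:
  "\<exists>n. \<forall>j. \<forall>v\<in>layer j. \<exists>p. (M ^^ n) ` ball p 1 \<subseteq> balanced_tile v - overlap j"
proof -
  obtain n where synchronizing_preimage: "\<And>v. v \<in> X \<inter> Z\<beta> \<Longrightarrow> \<exists>w\<in>T_preimage n v. \<forall>w'\<in>X \<inter> Z\<beta>.
      same_residue \<beta> w' w \<longrightarrow> dist (\<Phi> w') (\<Phi> w) \<le> tile_radius + 1 \<longrightarrow> (T ^^ n) w' = v"
    using ex_preimage_synchronizing_neighbours by blast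
  have "\<exists>p. (M ^^ n) ` ball p 1 \<subseteq> balanced_tile v - overlap j" if v_layer: "v \<in> layer j" for j v
  proof -
    obtain w where w_preimage: "w \<in> T_preimage n v" and synchronizing: "\<And>w'. w' \<in> X \<inter> Z\<beta> \<Longrightarrow>
        same_residue \<beta> w' w \<Longrightarrow> dist (\<Phi> w') (\<Phi> w) \<le> tile_radius + 1 \<Longrightarrow> (T ^^ n) w' = v"
      using synchronizing_preimage v_layer layer_subset by blast
    have unique: "v' = v" if v'_layer: "v' \<in> layer j" and q_in_ball: "q \<in> ball (\<Phi> w) 1"
      and q_in_tile: "(M ^^ n) q \<in> balanced_tile v'" for v' q
    proof -
      obtain w' where w'_preimage: "w' \<in> T_preimage n v'"
        and q_in_image: "(M ^^ n) q \<in> (M ^^ n) ` balanced_tile w'"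
        using q_in_tile balanced_tile_subdivision[OF layerD(2)[OF v'_layer], of n] by blast
      have w'_layer: "w' \<in> layer j" using T_preimage_in_layer[OF v'_layer w'_preimage] .
      have "q \<in> balanced_tile w'" using q_in_image inj_image_mem_iff[OF inj_fn[OF inj_M]] by blast
      then have "dist (\<Phi> w') q \<le> tile_radius"
        by (rule dist_Phi_balanced_tile_le[OF layerD(1)[OF w'_layer]])
      then have "dist (\<Phi> w') (\<Phi> w) \<le> tile_radius + 1"
        using q_in_ball dist_triangle2[of "\<Phi> w'" "\<Phi> w" q] by simp
      then have "(T ^^ n) w' = v"
        using w'_layer layer_subset
          layer_same_residue[OF w'_layer T_preimage_in_layer[OF v_layer w_preimage]]
        by (intro synchronizing) auto
      then show ?thesis using w'_preimage unfolding T_preimage_def by simp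
    qed
    have "(M ^^ n) q \<in> balanced_tile v - overlap j" if "q \<in> ball (\<Phi> w) 1" for q
      using balanced_tiles_of_layer_cover[of j "(M ^^ n) q"] unique[OF _ that]
      unfolding overlap_def by blast
    then show ?thesis by blast
  qed
  then show ?thesis by blast
qed

lemma balanced_tile_eq_closure_interior:
  assumes v_in: "v \<in> X \<inter> Z\<beta>"
  shows "balanced_tile v = closure (interior (balanced_tile v))"
proof
  show "closure (interior (balanced_tile v)) \<subseteq> balanced_tile v"
    using compact_imp_closed[OF compact_balanced_tile] interior_subset by (intro closure_minimal)
  obtain n where exclusive_ball:
    "\<And>j v. v \<in> layer j \<Longrightarrow> \<exists>p. (M ^^ n) ` ball p 1 \<subseteq> balanced_tile v - overlap j"
    using ex_exclusive_ball by blast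
  obtain j where v_layer: "v \<in> layer j" using v_in X_Z_eq_Union_layers by blast
  have "\<exists>y\<in>interior (balanced_tile v). dist y z < \<epsilon>"
    if z_in_tile: "z \<in> balanced_tile v" and "\<epsilon> > 0" for z \<epsilon>
  proof -
    obtain k where k_small: "2 * tile_radius * \<theta> ^ k < \<epsilon>" using ex_theta_power_less[OF \<open>\<epsilon> > 0\<close>] ..
    obtain w y where w_preimage: "w \<in> T_preimage k v" and y_in_tile: "y \<in> balanced_tile w"
      and z_eq: "z = (M ^^ k) y"
      using z_in_tile balanced_tile_subdivision[of v k] v_in by blast
    have w_layer: "w \<in> layer j" using T_preimage_in_layer[OF v_layer w_preimage] .
    obtain p where ball_subset: "(M ^^ n) ` ball p 1 \<subseteq> balanced_tile w"
      using exclusive_ball[OF w_layer] by blast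
    let ?q = "(M ^^ n) p"
    have "(M ^^ k) ` (M ^^ n) ` ball p 1 \<subseteq> balanced_tile v"
      using ball_subset funpow_mem_balanced_tile[OF _ w_preimage] v_in by blast
    moreover have "open ((M ^^ k) ` (M ^^ n) ` ball p 1)" by (intro open_funpow_image open_ball)
    moreover have "(M ^^ k) ?q \<in> (M ^^ k) ` (M ^^ n) ` ball p 1" by simp
    ultimately have interior: "(M ^^ k) ?q \<in> interior (balanced_tile v)"
      using interior_maximal by blast
    have "?q \<in> balanced_tile w" using ball_subset by auto
    have "dist ((M ^^ k) ?q) z \<le> \<theta> ^ k * dist ?q y" unfolding z_eq by (rule dist_funpow_le)
    also have "\<dots> \<le> \<theta> ^ k * (2 * tile_radius)"
      using dist_in_balanced_tile_le[OF layerD(1)[OF w_layer] \<open>?q \<in> balanced_tile w\<close> y_in_tile] theta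
      by (intro mult_left_mono) auto
    also have "\<dots> < \<epsilon>" using k_small by (simp add: mult.commute)
    finally show ?thesis using interior by blast
  qed
  then show "balanced_tile v \<subseteq> closure (interior (balanced_tile v))"
    by (auto simp: closure_approachable)
qed

lemma closed_overlap: "closed (overlap j)"
proof -
  define \<A> where "\<A> =
    (\<lambda>(v, v'). balanced_tile v \<inter> balanced_tile v') ` {(v, v') \<in> layer j \<times> layer j. v \<noteq> v'}"
  have "locally_finite_in euclidean \<A>"
    unfolding locally_finite_in_def
  proof (intro conjI ballI)
    fix z :: 'a
    define V where "V = {v \<in> X \<inter> Z\<beta>. balanced_tile v \<inter> ball z 1 \<noteq> {}}"
    have "{S \<in> \<A>. S \<inter> ball z 1 \<noteq> {}} \<subseteq> (\<lambda>(v, v'). balanced_tile v \<inter> balanced_tile v') ` (V \<times> V)"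
      unfolding \<A>_def V_def using layer_subset by fast
    moreover have "finite (V \<times> V)" unfolding V_def using balanced_tiles_locally_finite by simp
    ultimately have "finite {S \<in> \<A>. S \<inter> ball z 1 \<noteq> {}}" using finite_subset finite_imageI by blast
    then show "\<exists>V. openin euclidean V \<and> z \<in> V \<and> finite {S \<in> \<A>. S \<inter> V \<noteq> {}}"
      by (intro exI[of _ "ball z 1"]) simp
  qed simp
  moreover have "closedin euclidean S" if "S \<in> \<A>" for S
    using that compact_imp_closed[OF compact_balanced_tile] unfolding \<A>_def by auto
  ultimately have "closedin euclidean (\<Union>\<A>)" by (intro closedin_locally_finite_Union)
  moreover have "\<Union>\<A> = overlap j" unfolding \<A>_def overlap_def by auto
  ultimately show ?thesis by simp
qed

lemma overlap_invariant:
  assumes "M y \<in> overlap j"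
  shows "y \<in> overlap j"
proof -
  obtain v v' where v_layer: "v \<in> layer j" and v'_layer: "v' \<in> layer j" and v_ne: "v \<noteq> v'"
    and My_in_v: "M y \<in> balanced_tile v" and My_in_v': "M y \<in> balanced_tile v'"
    using assms unfolding overlap_def by auto
  have parent: "\<exists>w\<in>T_preimage 1 u. y \<in> balanced_tile w"
    if "u \<in> layer j" "M y \<in> balanced_tile u" for u
    using that(2) balanced_tile_subdivision[OF layerD(2)[OF that(1)], of 1]
      inj_image_mem_iff[OF inj_M] by auto
  obtain w w' where w_preimage: "w \<in> T_preimage 1 v" and y_in_w: "y \<in> balanced_tile w"
    and w'_preimage: "w' \<in> T_preimage 1 v'" and y_in_w': "y \<in> balanced_tile w'"
    using parent[OF v_layer My_in_v] parent[OF v'_layer My_in_v'] by blast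
  moreover have "w \<noteq> w'"
    using w_preimage w'_preimage v_ne unfolding T_preimage_def by auto
  ultimately show ?thesis
    using T_preimage_in_layer v_layer v'_layer unfolding overlap_def by blast
qed

theorem overlap_null: "overlap j \<in> null_sets lborel"
proof -
  obtain n where exclusive_ball:
    "\<And>j v. v \<in> layer j \<Longrightarrow> \<exists>p. (M ^^ n) ` ball p 1 \<subseteq> balanced_tile v - overlap j"
    using ex_exclusive_ball by blast
  let ?G = "(M ^^ n) ` ball 0 1"
  show ?thesis
  proof (rule null_sets_if_relatively_dense_holes[OF closed_overlap overlap_invariant])
    show "open ?G" "bounded ?G" "?G \<noteq> {}"
      by (auto intro: open_funpow_image bounded_funpow_image)
    fix y
    obtain v where v_layer: "v \<in> layer j" and y_in_tile: "y \<in> balanced_tile v"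
      using balanced_tiles_of_layer_cover by blast
    obtain p where ball_subset: "(M ^^ n) ` ball p 1 \<subseteq> balanced_tile v - overlap j"
      using exclusive_ball[OF v_layer] by blast
    have "(+) ((M ^^ n) p) ` ?G = (M ^^ n) ` ball p 1"
      unfolding funpow_image_translate[symmetric] by (simp add: ball_translation[symmetric])
    moreover have "balanced_tile v \<subseteq> ball y (2 * tile_radius + 1)"
      using dist_in_balanced_tile_le[OF layerD(1)[OF v_layer] y_in_tile] by fastforce
    ultimately show "\<exists>p. (+) p ` ?G \<subseteq> ball y (2 * tile_radius + 1) - overlap j"
      using ball_subset by (intro exI[of _ "(M ^^ n) p"]) auto
  qed
qed

lemma AE_in_exactly_one_tile_of_layer: "AE z in lborel. card {v \<in> layer j. z \<in> balanced_tile v} = 1"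
proof (rule AE_I'[OF overlap_null[of j]])
  have "card {v \<in> layer j. z \<in> balanced_tile v} = 1" if "z \<notin> overlap j" for z
  proof -
    obtain v where "v \<in> layer j" "z \<in> balanced_tile v" using balanced_tiles_of_layer_cover by blast
    then have "{v \<in> layer j. z \<in> balanced_tile v} = {v}" using that unfolding overlap_def by auto
    then show ?thesis by simp
  qed
  then show "{z \<in> space lborel. card {v \<in> layer j. z \<in> balanced_tile v} \<noteq> 1} \<subseteq> overlap j" by blast
qed

lemma multiple_tiling_balanced_tile:
  assumes "I \<subseteq> X \<inter> Z\<beta>" "\<And>z. \<exists>v\<in>I. z \<in> balanced_tile v"
    and "AE z in lborel. card {v \<in> I. z \<in> balanced_tile v} = m"
  shows "multiple_tiling m I balanced_tile"
  unfolding multiple_tiling_def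
proof (intro conjI)
  show "\<exists>\<S>. finite \<S> \<and> (\<forall>v\<in>I. \<exists>S\<in>\<S>. \<exists>t. balanced_tile v = (\<lambda>s. t + s) ` S)"
    using balanced_tiles_finitely_many_shapes assms(1) by (meson subsetD)
  have "finite {v \<in> I. balanced_tile v \<inter> ball z 1 \<noteq> {}}" for z
    by (rule finite_subset[OF _ balanced_tiles_locally_finite[of z 1]]) (use assms(1) in blast)
  then show "\<forall>z. \<exists>U. open U \<and> z \<in> U \<and> finite {v \<in> I. balanced_tile v \<inter> U \<noteq> {}}"
    by (meson centre_in_ball open_ball zero_less_one)
  show "(\<Union>v\<in>I. balanced_tile v) = UNIV" using assms(2) by blast
  show "\<forall>v\<in>I. balanced_tile v = closure (interior (balanced_tile v))"
    using balanced_tile_eq_closure_interior assms(1) by blast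
qed (rule assms(3))

theorem tiling_layer: "tiling (layer j) balanced_tile"
  unfolding tiling_def
  using layer_subset balanced_tiles_of_layer_cover AE_in_exactly_one_tile_of_layer
  by (rule multiple_tiling_balanced_tile)

end

section \<open>The embedding by Galois conjugates\<close>

context bonacci begin

lemma conjugate_norm_less_1:
  fixes z :: complex
  assumes root: "z ^ d = (\<Sum>i<d. z ^ i)" and "z \<noteq> of_real \<beta>"
  shows "norm z < 1"
proof (rule ccontr)
  define t where "t = norm z"
  assume "\<not> norm z < 1"
  then have t_ge_1: "t \<ge> 1" unfolding t_def by simp
  have "z ^ d - 1 = (z - 1) * z ^ d" unfolding power_diff_1_eq root[symmetric] ..
  then have "z ^ d * (2 - z) = 1" by (simp add: algebra_simps)
  then have "norm (z ^ d * (2 - z)) = 1" by simp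
  then have norm_prod: "t ^ d * norm (2 - z) = 1"
    unfolding t_def by (simp add: norm_mult norm_power)
  have "t ^ d = norm (\<Sum>i<d. z ^ i)" unfolding t_def root[symmetric] by (simp add: norm_power)
  also have "\<dots> \<le> (\<Sum>i<d. t ^ i)" unfolding t_def norm_power[symmetric] by (rule norm_sum)
  finally have "(t - 1) * t ^ d \<le> (t - 1) * (\<Sum>i<d. t ^ i)"
    using t_ge_1 by (intro mult_left_mono) auto
  then have "(t - 1) * t ^ d \<le> t ^ d - 1" unfolding power_diff_1_eq .
  then have "t ^ d * norm (2 - z) \<le> t ^ d * (2 - t)" using norm_prod by (simp add: algebra_simps)
  then have "norm (2 - z) \<le> 2 - t" using t_ge_1 by simp
  then have "2 - Re z \<le> 2 - t" using complex_Re_le_cmod[of "2 - z"] by simp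
  then have "Re z = t" using complex_Re_le_cmod[of z] unfolding t_def by simp
  then have "z = of_real t"
    unfolding t_def by (metis complex_is_Real_iff of_real_Re Im_eq_0 abs_norm_cancel)
  then have "complex_of_real (t ^ d) = of_real (\<Sum>i<d. t ^ i)" using root by simp
  then have "t ^ d = (\<Sum>i<d. t ^ i)" by (simp only: of_real_eq_iff)
  then have "t = \<beta>" using positive_root_unique[of d t \<beta>] t_ge_1 beta_pos beta_pow_d d_ge by simp
  then show False using assms(2) \<open>z = of_real t\<close> by simp
qed

definition comb_at :: "(nat \<Rightarrow> real) \<Rightarrow> complex \<Rightarrow> complex" where
  "comb_at b z = (\<Sum>i\<in>{1..d}. of_real (b i) * (1 / z) ^ i)"

lemma comb_at_beta: "comb_at b (of_real \<beta>) = of_real (\<Sum>i\<in>{1..d}. b i * (1/\<beta>) ^ i)"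
  unfolding comb_at_def by simp

lemma comb_at_of_int_beta: "comb_at (\<lambda>i. of_int (c i)) (of_real \<beta>) = of_real (power_comb c)"
  unfolding comb_at_beta power_comb_def ..

lemma cnj_comb_at: "cnj (comb_at b z) = comb_at b (cnj z)"
  unfolding comb_at_def by simp

lemma comb_at_Reals: "z \<in> \<real> \<Longrightarrow> comb_at b z \<in> \<real>"
  by (simp add: Reals_cnj_iff cnj_comb_at)

lemma comb_at_add: "comb_at (\<lambda>i. b i + b' i) z = comb_at b z + comb_at b' z"
  unfolding comb_at_def by (simp add: distrib_right sum.distrib)

lemma comb_at_scaleR: "comb_at (\<lambda>i. r * b i) z = r *\<^sub>R comb_at b z"
  unfolding comb_at_def scaleR_sum_right by (simp add: scaleR_conv_of_real mult.assoc)

end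

locale bonacci_conjugates = bonacci +
  fixes e :: nat and \<gamma> :: "nat \<Rightarrow> complex" and \<sigma> :: "nat \<Rightarrow> real \<Rightarrow> complex" and \<iota> :: "'n::finite \<Rightarrow> nat"
  assumes conj_enum: "conjugate_enumeration d \<beta> e \<gamma>"
    and iso: "\<And>j. j \<in> {1..d - e - 1} \<Longrightarrow>
           field_iso_on (rat_field_adjoin \<beta>) (rat_field_adjoin (\<gamma> j)) (\<sigma> j) \<and> \<sigma> j \<beta> = \<gamma> j"
    and iota: "bij_betw \<iota> (UNIV :: 'n set) {1..d - 1}"
begin

abbreviation "J \<equiv> {1..d - e - 1}"
abbreviation "\<Phi> \<equiv> embed e \<sigma> \<iota>"

lemma e_less: "2 * e < d"
  and gamma_inj: "inj_on \<gamma> J"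
  and gamma_cnj_disjoint: "\<gamma> ` {1..e} \<inter> cnj ` \<gamma> ` {1..e} = {}"
  and gamma_nonreal_eq: "\<gamma> ` {1..e} \<union> cnj ` \<gamma> ` {1..e} = {z. galois_conjugate \<beta> z \<and> z \<notin> \<real>}"
  and gamma_real_eq: "\<gamma> ` {e + 1..d - e - 1} = {z. galois_conjugate \<beta> z \<and> z \<in> \<real> \<and> z \<noteq> of_real \<beta>}"
  using conj_enum unfolding conjugate_enumeration_def by simp_all

lemma J_eq: "J = {1..e} \<union> {e + 1..d - e - 1}"
  using e_less by auto

lemma gamma_nonreal: "j \<in> {1..e} \<Longrightarrow> \<gamma> j \<notin> \<real>"
  using gamma_nonreal_eq by blast

lemma gamma_real: "j \<in> {e + 1..d - e - 1} \<Longrightarrow> \<gamma> j \<in> \<real> \<and> \<gamma> j \<noteq> of_real \<beta>"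
  using gamma_real_eq by blast

lemma gamma_ne_beta: "j \<in> J \<Longrightarrow> \<gamma> j \<noteq> of_real \<beta>"
  unfolding J_eq using gamma_nonreal gamma_real by (metis Reals_of_real UnE)

definition conjugates :: "complex set" where
  "conjugates = insert (of_real \<beta>) (\<gamma> ` J \<union> cnj ` \<gamma> ` {1..e})"

lemma card_conjugates: "card conjugates = d"
proof -
  have "cnj (\<gamma> i) \<noteq> \<gamma> j" if "i \<in> {1..e}" "j \<in> J" for i j
  proof -
    have "cnj (\<gamma> i) \<notin> \<real>" using gamma_nonreal[OF that(1)] by (simp add: complex_is_Real_iff)
    then show ?thesis
      using that gamma_cnj_disjoint gamma_real unfolding J_eq by (metis UnE IntI emptyE imageI)
  qed
  then have "\<gamma> ` J \<inter> cnj ` \<gamma> ` {1..e} = {}" by force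
  then have "card (\<gamma> ` J \<union> cnj ` \<gamma> ` {1..e}) = card (\<gamma> ` J) + card (cnj ` \<gamma> ` {1..e})"
    by (intro card_Un_disjoint) auto
  also have "card (\<gamma> ` J) = d - e - 1" using gamma_inj by (simp add: card_image)
  also have "card (cnj ` \<gamma> ` {1..e}) = card (\<gamma> ` {1..e})"
    by (intro card_image) (auto simp: inj_on_def)
  also have "\<dots> = e"
  proof -
    have "{1..e} \<subseteq> J" using e_less by auto
    then show ?thesis using card_image[OF inj_on_subset[OF gamma_inj]] by simp
  qed
  finally have "card (\<gamma> ` J \<union> cnj ` \<gamma> ` {1..e}) = d - 1" using e_less by simp
  moreover have "of_real \<beta> \<notin> \<gamma> ` J" using gamma_ne_beta by force
  moreover have "of_real \<beta> \<notin> cnj ` \<gamma> ` {1..e}"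
    using gamma_nonreal by (force simp: complex_is_Real_iff complex_eq_iff)
  ultimately show ?thesis unfolding conjugates_def using d_ge by simp
qed

subsection \<open>The conjugation maps on the ring\<close>

context
  fixes j assumes j_in_J: "j \<in> J"
begin

lemma sigma_add: "x \<in> Z\<beta> \<Longrightarrow> y \<in> Z\<beta> \<Longrightarrow> \<sigma> j (x + y) = \<sigma> j x + \<sigma> j y"
  using iso[OF j_in_J] int_adjoin_subset_rat_field_adjoin unfolding field_iso_on_def by blast

lemma sigma_mult: "x \<in> Z\<beta> \<Longrightarrow> y \<in> Z\<beta> \<Longrightarrow> \<sigma> j (x * y) = \<sigma> j x * \<sigma> j y"
  using iso[OF j_in_J] int_adjoin_subset_rat_field_adjoin unfolding field_iso_on_def by blast

lemma sigma_1: "\<sigma> j 1 = 1" and sigma_beta: "\<sigma> j \<beta> = \<gamma> j"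
  using iso[OF j_in_J] unfolding field_iso_on_def by auto

lemma sigma_0: "\<sigma> j 0 = 0"
  using sigma_add[of 0 0] by simp

lemma sigma_uminus: "x \<in> Z\<beta> \<Longrightarrow> \<sigma> j (- x) = - \<sigma> j x"
  using sigma_add[of x "- x"] int_adjoin_uminus sigma_0
  by (simp add: eq_neg_iff_add_eq_0 add.commute)

lemma sigma_of_int: "\<sigma> j (of_int k) = of_int k"
proof -
  have of_nat: "\<sigma> j (of_nat n) = of_nat n" for n
    by (induction n) (use sigma_0 sigma_1 sigma_add in auto)
  show ?thesis
    by (cases k) (use of_nat sigma_uminus[OF int_adjoin_of_nat] in \<open>auto simp del: of_nat_Suc\<close>)
qed

lemma sigma_power: "x \<in> Z\<beta> \<Longrightarrow> \<sigma> j (x ^ n) = \<sigma> j x ^ n"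
  by (induction n) (auto simp: sigma_1 sigma_mult int_adjoin_power)

lemma sigma_sum: "finite A \<Longrightarrow> (\<And>i. i \<in> A \<Longrightarrow> f i \<in> Z\<beta>) \<Longrightarrow> \<sigma> j (sum f A) = (\<Sum>i\<in>A. \<sigma> j (f i))"
  by (induction A rule: finite_induct) (auto simp: sigma_0 sigma_add int_adjoin_sum)

lemma gamma_root: "\<gamma> j ^ d = (\<Sum>i<d. \<gamma> j ^ i)"
proof -
  have "\<gamma> j ^ d = \<sigma> j (\<Sum>i<d. \<beta> ^ i)"
    unfolding beta_pow_d[symmetric] sigma_power[OF int_adjoin_generator] sigma_beta ..
  also have "\<dots> = (\<Sum>i<d. \<gamma> j ^ i)" by (simp add: sigma_sum sigma_power sigma_beta int_adjoin_power)
  finally show ?thesis .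
qed

lemma gamma_norm: "norm (\<gamma> j) < 1"
  using conjugate_norm_less_1[OF gamma_root gamma_ne_beta[OF j_in_J]] .

lemma sigma_inverse_beta: "\<sigma> j (1/\<beta>) = 1 / \<gamma> j" and gamma_nonzero: "\<gamma> j \<noteq> 0"
proof -
  have "\<sigma> j (1/\<beta>) * \<gamma> j = 1"
    using sigma_mult[OF inverse_beta_in_Z int_adjoin_generator] beta_pos
    by (simp add: sigma_1 sigma_beta)
  then show "\<sigma> j (1/\<beta>) = 1 / \<gamma> j" "\<gamma> j \<noteq> 0" by (auto simp: eq_divide_eq)
qed

lemma sigma_power_comb: "\<sigma> j (power_comb c) = comb_at (\<lambda>i. of_int (c i)) (\<gamma> j)"
proof -
  note in_Z = int_adjoin_of_int int_adjoin_power[OF inverse_beta_in_Z]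
  have "\<sigma> j (power_comb c) = (\<Sum>i\<in>{1..d}. \<sigma> j (of_int (c i) * (1/\<beta>) ^ i))"
    unfolding power_comb_def by (intro sigma_sum int_adjoin_mult in_Z) simp
  also have "\<dots> = comb_at (\<lambda>i. of_int (c i)) (\<gamma> j)"
    unfolding comb_at_def sigma_mult[OF in_Z] sigma_of_int sigma_power[OF inverse_beta_in_Z]
      sigma_inverse_beta
    by simp
  finally show ?thesis .
qed

end

lemma zero_notin_conjugates: "0 \<notin> conjugates"
  unfolding conjugates_def using gamma_nonzero e_less beta_pos by fastforce

subsection \<open>Real coordinates\<close>

definition real_coord :: "(nat \<Rightarrow> complex) \<Rightarrow> nat \<Rightarrow> real" where
  "real_coord u k = (if k \<le> e then Re (u k) else if k \<le> 2 * e then Im (u (k - e)) else Re (u (k - e)))"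

definition assemble :: "(nat \<Rightarrow> complex) \<Rightarrow> real ^ 'n" where
  "assemble u = (\<chi> i. real_coord u (\<iota> i))"

definition index :: "nat \<Rightarrow> 'n" where
  "index = inv_into UNIV \<iota>"

definition component :: "real ^ 'n \<Rightarrow> nat \<Rightarrow> complex" where
  "component z j =
     (if j \<le> e then Complex (z $ index j) (z $ index (j + e)) else of_real (z $ index (j + e)))"

definition compatible :: "(nat \<Rightarrow> complex) \<Rightarrow> bool" where
  "compatible u \<longleftrightarrow> (\<forall>j\<in>J. e < j \<longrightarrow> u j \<in> \<real>)"

lemma iota_range: "\<iota> i \<in> {1..d - 1}"
  using iota unfolding bij_betw_def by blast

lemma iota_index: "k \<in> {1..d - 1} \<Longrightarrow> \<iota> (index k) = k"
  unfolding index_def using iota by (metis bij_betw_def f_inv_into_f)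

lemma index_iota: "index (\<iota> i) = i"
  unfolding index_def using iota by (metis bij_betw_def inv_into_f_f UNIV_I)

lemma embed_eq_assemble: "\<Phi> x = assemble (\<lambda>j. \<sigma> j x)"
  unfolding embed_def assemble_def real_coord_def ..

lemma assemble_component: "assemble (component z) = z"
  unfolding assemble_def real_coord_def component_def by (auto simp: vec_eq_iff index_iota)

lemma component_assemble:
  assumes "compatible u" "j \<in> J"
  shows "component (assemble u) j = u j"
proof (cases "j \<le> e")
  case True
  then have "\<iota> (index j) = j" "\<iota> (index (j + e)) = j + e"
    using assms(2) e_less by (auto intro!: iota_index)
  then show ?thesis
    using True assms(2)
    unfolding component_def assemble_def real_coord_def by (simp add: complex_eq_iff)
next
  case False
  then have "\<iota> (index (j + e)) = j + e" using assms(2) by (intro iota_index) auto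
  moreover have "Im (u j) = 0"
    using False assms unfolding compatible_def by (simp add: complex_is_Real_iff)
  ultimately show ?thesis
    using False unfolding component_def assemble_def real_coord_def by (simp add: complex_eq_iff)
qed

lemma compatible_component: "compatible (component z)"
  unfolding compatible_def component_def by auto

lemma compatible_gamma: "compatible \<gamma>"
  unfolding compatible_def using gamma_real by auto

lemma compatible_mult: "compatible u \<Longrightarrow> compatible u' \<Longrightarrow> compatible (\<lambda>j. u j * u' j)"
  unfolding compatible_def by auto

lemma compatible_comb_at: "compatible (\<lambda>j. comb_at b (\<gamma> j))"
  unfolding compatible_def using compatible_gamma comb_at_Reals unfolding compatible_def by blast

lemma compatible_sigma:
  assumes "x \<in> Z\<beta>"
  shows "compatible (\<lambda>j. \<sigma> j x)"
proof -
  obtain c where "x = power_comb c" using assms in_Z_iff_power_comb by auto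
  then show ?thesis
    using compatible_comb_at[of "\<lambda>i. of_int (c i)"] by (simp add: compatible_def sigma_power_comb)
qed

lemma assemble_cong:
  assumes "\<And>j. j \<in> J \<Longrightarrow> u j = u' j"
  shows "assemble u = assemble u'"
proof -
  have "real_coord u k = real_coord u' k" if "k \<in> {1..d - 1}" for k
  proof -
    have "k \<in> J" if "k \<le> e" using that \<open>k \<in> {1..d - 1}\<close> e_less by auto
    moreover have "k - e \<in> J" if "\<not> k \<le> e" using that \<open>k \<in> {1..d - 1}\<close> by auto
    ultimately show ?thesis using assms unfolding real_coord_def by auto
  qed
  then show ?thesis unfolding assemble_def using iota_range by (simp add: vec_eq_iff)
qed

lemma assemble_add: "assemble (\<lambda>j. u j + u' j) = assemble u + assemble u'"
  unfolding assemble_def real_coord_def by (simp add: vec_eq_iff)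

lemma assemble_scaleR: "assemble (\<lambda>j. r *\<^sub>R u j) = r *\<^sub>R assemble u"
  unfolding assemble_def real_coord_def by (simp add: vec_eq_iff)

lemma component_add: "component (z + z') j = component z j + component z' j"
  unfolding component_def by (simp add: complex_eq_iff)

lemma component_scaleR: "component (r *\<^sub>R z) j = r *\<^sub>R component z j"
  unfolding component_def by (simp add: complex_eq_iff)

lemma norm_assemble:
  assumes "compatible u"
  shows "(norm (assemble u))\<^sup>2 = (\<Sum>j\<in>J. (norm (u j))\<^sup>2)"
proof -
  have "(norm (assemble u))\<^sup>2 = (\<Sum>i\<in>UNIV. (real_coord u (\<iota> i))\<^sup>2)"
    unfolding norm_vec_def L2_set_def assemble_def by (simp add: sum_nonneg)
  also have "\<dots> = (\<Sum>k\<in>{1..d - 1}. (real_coord u k)\<^sup>2)" by (rule sum.reindex_bij_betw[OF iota])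
  also have "{1..d - 1} = {1..e} \<union> {e + 1..2 * e} \<union> {2 * e + 1..d - 1}" using e_less by auto
  also have "(\<Sum>k\<in>\<dots>. (real_coord u k)\<^sup>2) = (\<Sum>k\<in>{1..e}. (real_coord u k)\<^sup>2)
      + (\<Sum>k\<in>{e + 1..2 * e}. (real_coord u k)\<^sup>2) + (\<Sum>k\<in>{2 * e + 1..d - 1}. (real_coord u k)\<^sup>2)"
    by (subst sum.union_disjoint; (subst sum.union_disjoint)?) auto
  also have "(\<Sum>k\<in>{1..e}. (real_coord u k)\<^sup>2) = (\<Sum>j\<in>{1..e}. (Re (u j))\<^sup>2)"
    by (simp add: real_coord_def)
  also have "(\<Sum>k\<in>{e + 1..2 * e}. (real_coord u k)\<^sup>2) = (\<Sum>j\<in>{1..e}. (Im (u j))\<^sup>2)"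
    by (rule sum.reindex_bij_witness[of _ "\<lambda>j. j + e" "\<lambda>k. k - e"]) (auto simp: real_coord_def)
  also have "(\<Sum>k\<in>{2 * e + 1..d - 1}. (real_coord u k)\<^sup>2) = (\<Sum>j\<in>{e + 1..d - e - 1}. (Re (u j))\<^sup>2)"
    by (rule sum.reindex_bij_witness[of _ "\<lambda>j. j + e" "\<lambda>k. k - e"])
       (use e_less in \<open>auto simp: real_coord_def\<close>)
  also have "\<dots> = (\<Sum>j\<in>{e + 1..d - e - 1}. (norm (u j))\<^sup>2)"
    using assms
    unfolding compatible_def complex_is_Real_iff by (intro sum.cong) (auto simp: cmod_power2)
  also have "(\<Sum>j\<in>{1..e}. (Re (u j))\<^sup>2) + (\<Sum>j\<in>{1..e}. (Im (u j))\<^sup>2) + \<dots>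
      = (\<Sum>j\<in>{1..e}. (norm (u j))\<^sup>2) + (\<Sum>j\<in>{e + 1..d - e - 1}. (norm (u j))\<^sup>2)"
    by (simp add: cmod_power2 sum.distrib)
  also have "\<dots> = (\<Sum>j\<in>J. (norm (u j))\<^sup>2)"
    unfolding J_eq by (subst sum.union_disjoint) auto
  finally show ?thesis .
qed

subsection \<open>The contraction induced by multiplication\<close>

definition conjugate_mult :: "real ^ 'n \<Rightarrow> real ^ 'n" where
  "conjugate_mult z = assemble (\<lambda>j. \<gamma> j * component z j)"

definition max_conjugate_norm :: real where
  "max_conjugate_norm = Max (insert (1/2) ((\<lambda>j. norm (\<gamma> j)) ` J))"

lemma max_conjugate_norm_pos: "0 < max_conjugate_norm"
proof -
  have "1/2 \<le> max_conjugate_norm" unfolding max_conjugate_norm_def by (intro Max_ge) auto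
  then show ?thesis by simp
qed

lemma max_conjugate_norm_less_1: "max_conjugate_norm < 1"
  unfolding max_conjugate_norm_def using gamma_norm by (subst Max_less_iff) auto

lemma norm_gamma_le: "j \<in> J \<Longrightarrow> norm (\<gamma> j) \<le> max_conjugate_norm"
  unfolding max_conjugate_norm_def by (intro Max_ge) auto

lemma component_conjugate_mult: "j \<in> J \<Longrightarrow> component (conjugate_mult z) j = \<gamma> j * component z j"
  unfolding conjugate_mult_def
  by (intro component_assemble compatible_mult compatible_gamma compatible_component)

lemma linear_conjugate_mult: "linear conjugate_mult"
  by (rule linearI)
     (auto simp: conjugate_mult_def component_add component_scaleR assemble_add[symmetric]
       assemble_scaleR[symmetric] distrib_left)

lemma inj_conjugate_mult: "inj conjugate_mult"
proof (rule injI)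
  fix z z' assume "conjugate_mult z = conjugate_mult z'"
  then have "component z j = component z' j" if "j \<in> J" for j
    using component_conjugate_mult[OF that, of z] component_conjugate_mult[OF that, of z']
      gamma_nonzero[OF that] by simp
  then have "assemble (component z) = assemble (component z')" by (rule assemble_cong)
  then show "z = z'" by (simp only: assemble_component)
qed

lemma norm_conjugate_mult_le: "norm (conjugate_mult z) \<le> max_conjugate_norm * norm z"
proof -
  have "(norm (conjugate_mult z))\<^sup>2 = (\<Sum>j\<in>J. (norm (\<gamma> j * component z j))\<^sup>2)"
    unfolding conjugate_mult_def
    by (intro norm_assemble compatible_mult compatible_gamma compatible_component)
  also have "\<dots> \<le> (\<Sum>j\<in>J. max_conjugate_norm\<^sup>2 * (norm (component z j))\<^sup>2)"
    unfolding norm_mult power_mult_distrib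
    by (intro sum_mono mult_right_mono power_mono norm_gamma_le) auto
  also have "\<dots> = max_conjugate_norm\<^sup>2 * (norm (assemble (component z)))\<^sup>2"
    unfolding norm_assemble[OF compatible_component] sum_distrib_left ..
  also have "\<dots> = (max_conjugate_norm * norm z)\<^sup>2"
    by (simp add: assemble_component power_mult_distrib)
  finally show ?thesis by (rule power2_le_imp_le) (use max_conjugate_norm_pos in simp)
qed

lemma Phi_add: "x \<in> Z\<beta> \<Longrightarrow> y \<in> Z\<beta> \<Longrightarrow> \<Phi> (x + y) = \<Phi> x + \<Phi> y"
  unfolding embed_eq_assemble assemble_add[symmetric] by (rule assemble_cong) (rule sigma_add)

lemma component_Phi: "j \<in> J \<Longrightarrow> x \<in> Z\<beta> \<Longrightarrow> component (\<Phi> x) j = \<sigma> j x"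
  unfolding embed_eq_assemble by (intro component_assemble compatible_sigma)

lemma Phi_beta_mult: "x \<in> Z\<beta> \<Longrightarrow> \<Phi> (\<beta> * x) = conjugate_mult (\<Phi> x)"
  unfolding conjugate_mult_def embed_eq_assemble[of "\<beta> * x"]
  by (rule assemble_cong) (simp add: component_Phi sigma_mult sigma_beta)

subsection \<open>The lattice of the ring\<close>

text \<open>The coordinates of a point of \<open>\<real> \<times> \<real>\<^bsup>d-1\<^esup>\<close> are numbered from 1 to \<open>d\<close>, with the first
  factor as the last coordinate.\<close>

definition coord :: "real \<times> (real ^ 'n) \<Rightarrow> nat \<Rightarrow> real" where
  "coord p i = (if i = d then fst p else snd p $ index i)"

definition of_coords :: "(nat \<Rightarrow> real) \<Rightarrow> real \<times> (real ^ 'n)" where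
  "of_coords b = (b d, \<chi> i. b (\<iota> i))"

definition lattice_map :: "real \<times> (real ^ 'n) \<Rightarrow> real \<times> (real ^ 'n)" where
  "lattice_map p = (Re (comb_at (coord p) (of_real \<beta>)), assemble (\<lambda>j. comb_at (coord p) (\<gamma> j)))"

lemma coord_of_coords: "i \<in> {1..d} \<Longrightarrow> coord (of_coords b) i = b i"
  unfolding coord_def of_coords_def using iota_index[of i] by auto

lemma coord_add: "coord (p + q) = (\<lambda>i. coord p i + coord q i)"
  and coord_diff: "coord (p - q) = (\<lambda>i. coord p i - coord q i)"
  and coord_scaleR: "coord (r *\<^sub>R p) = (\<lambda>i. r * coord p i)"
  unfolding coord_def by auto

lemma coord_eq_0_imp:
  assumes "\<And>i. i \<in> {1..d} \<Longrightarrow> coord p i = 0"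
  shows "p = 0"
proof -
  have "fst p = 0" using assms[of d] d_ge unfolding coord_def by simp
  moreover have "snd p $ i = 0" for i
  proof -
    have "\<iota> i \<in> {1..d}" "\<iota> i \<noteq> d" using iota_range[of i] d_ge by auto
    then show ?thesis using assms[of "\<iota> i"] unfolding coord_def by (simp add: index_iota)
  qed
  ultimately show ?thesis by (simp add: prod_eq_iff vec_eq_iff)
qed

lemma abs_coord_le: "\<bar>coord p i\<bar> \<le> norm p"
  unfolding coord_def using norm_fst_le[of "fst p" "snd p"] norm_snd_le[of "snd p" "fst p"]
    component_le_norm_cart[of "snd p" "index i"] by auto

lemma norm_le_if_abs_coord_le_1:
  assumes "\<And>i. i \<in> {1..d} \<Longrightarrow> \<bar>coord p i\<bar> \<le> 1"
  shows "norm p \<le> 1 + real CARD('n)"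
proof -
  have "\<bar>snd p $ i\<bar> \<le> 1" for i
  proof -
    have "\<iota> i \<in> {1..d}" "\<iota> i \<noteq> d" using iota_range[of i] d_ge by auto
    then show ?thesis using assms[of "\<iota> i"] unfolding coord_def by (simp add: index_iota)
  qed
  then have "(\<Sum>i\<in>UNIV. \<bar>snd p $ i\<bar>) \<le> real CARD('n)"
    using sum_bounded_above[of UNIV "\<lambda>i. \<bar>snd p $ i\<bar>" 1] by simp
  then have "norm (snd p) \<le> real CARD('n)" using norm_le_l1_cart order_trans by blast
  moreover have "norm (fst p) \<le> 1" using assms[of d] d_ge unfolding coord_def by simp
  ultimately show ?thesis using norm_Pair_le[of "fst p" "snd p"] by simp
qed

lemma linear_lattice_map: "linear lattice_map"
  by (rule linearI)
     (simp_all add: lattice_map_def coord_add coord_scaleR comb_at_add comb_at_scaleR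
       assemble_add assemble_scaleR)

lemma lattice_map_of_coords:
  "lattice_map (of_coords (\<lambda>i. of_int (c i))) = (power_comb c, \<Phi> (power_comb c))"
proof -
  have "comb_at (coord (of_coords (\<lambda>i. of_int (c i)))) z = comb_at (\<lambda>i. of_int (c i)) z" for z
    unfolding comb_at_def by (intro sum.cong refl) (simp only: coord_of_coords)
  moreover have "assemble (\<lambda>j. comb_at (\<lambda>i. of_int (c i)) (\<gamma> j)) = \<Phi> (power_comb c)"
    unfolding embed_eq_assemble by (intro assemble_cong) (simp add: sigma_power_comb)
  ultimately show ?thesis
    unfolding lattice_map_def by (simp only: comb_at_of_int_beta Re_complex_of_real)
qed

lemma comb_at_conjugates_eq_0:
  assumes "lattice_map p = 0" "z \<in> conjugates"
  shows "comb_at (coord p) z = 0"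
proof -
  have at_beta: "comb_at (coord p) (of_real \<beta>) = 0"
    using assms(1) unfolding lattice_map_def comb_at_beta by (simp add: zero_prod_def)
  have at_gamma: "comb_at (coord p) (\<gamma> j) = 0" if "j \<in> J" for j
  proof -
    have "comb_at (coord p) (\<gamma> j) = component (assemble (\<lambda>j. comb_at (coord p) (\<gamma> j))) j"
      using component_assemble[OF compatible_comb_at that] ..
    also have "assemble (\<lambda>j. comb_at (coord p) (\<gamma> j)) = 0"
      using assms(1) unfolding lattice_map_def by (simp add: zero_prod_def)
    finally show ?thesis by (simp add: component_def complex_eq_iff)
  qed
  have "comb_at (coord p) (cnj (\<gamma> j)) = 0" if "j \<in> {1..e}" for j
  proof -
    have "j \<in> J" using that e_less by auto
    then show ?thesis unfolding cnj_comb_at[symmetric] using at_gamma by simp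
  qed
  then show ?thesis using assms(2) at_beta at_gamma unfolding conjugates_def by blast
qed

lemma inj_lattice_map: "inj lattice_map"
proof -
  have "p = 0" if kernel: "lattice_map p = 0" for p
  proof (rule coord_eq_0_imp)
    fix i assume "i \<in> {1..d}"
    have "complex_of_real (coord p i) = 0"
    proof (rule sum_inverse_powers_coeffs_0[OF _ zero_notin_conjugates _ \<open>i \<in> {1..d}\<close>])
      show "d \<le> card conjugates" unfolding card_conjugates ..
      show "(\<Sum>k\<in>{1..d}. of_real (coord p k) * (1 / z) ^ k) = 0" if "z \<in> conjugates" for z
        using comb_at_conjugates_eq_0[OF kernel that] unfolding comb_at_def .
    qed
    then show "coord p i = 0" by simp
  qed
  then show ?thesis using linear_injective_0[OF linear_lattice_map] by blast
qed

lemma power_comb_eq_0_imp: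
  assumes "power_comb c = 0" "i \<in> {1..d}"
  shows "c i = 0"
proof -
  have "\<Phi> (0 :: real) = 0" using Phi_add[of 0 0] by simp
  then have "lattice_map (of_coords (\<lambda>i. of_int (c i))) = lattice_map 0"
    unfolding lattice_map_of_coords assms(1) linear_0[OF linear_lattice_map]
    by (simp add: zero_prod_def)
  then have "of_coords (\<lambda>i. of_int (c i)) = 0" using inj_lattice_map by (rule injD[rotated])
  then have "coord (of_coords (\<lambda>i. of_int (c i))) i = coord 0 i" by (simp only:)
  then show ?thesis unfolding coord_of_coords[OF assms(2)] by (simp add: coord_def split: if_splits)
qed

lemma finite_Z_bounded: "finite {x \<in> Z\<beta>. \<bar>x\<bar> \<le> a \<and> norm (\<Phi> x) \<le> b}"
proof -
  obtain B where B_pos: "B > 0" and B_le: "\<And>p. B * norm p \<le> norm (lattice_map p)"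
    using linear_inj_bounded_below_pos[OF linear_lattice_map inj_lattice_map] by blast
  define N where "N = \<lceil>(a + b) / B\<rceil>"
  have "{x \<in> Z\<beta>. \<bar>x\<bar> \<le> a \<and> norm (\<Phi> x) \<le> b} \<subseteq> power_comb ` (\<Pi>\<^sub>E i\<in>{1..d}. {-N..N})"
  proof
    fix x assume "x \<in> {x \<in> Z\<beta>. \<bar>x\<bar> \<le> a \<and> norm (\<Phi> x) \<le> b}"
    then obtain c where x_le: "\<bar>x\<bar> \<le> a" and Phi_x_le: "norm (\<Phi> x) \<le> b" and x_eq: "x = power_comb c"
      using in_Z_iff_power_comb by auto
    let ?p = "of_coords (\<lambda>i. of_int (c i))"
    have "B * norm ?p \<le> norm (x, \<Phi> x)" using B_le[of ?p] unfolding lattice_map_of_coords x_eq .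
    also have "\<dots> \<le> norm x + norm (\<Phi> x)" by (rule norm_Pair_le)
    also have "\<dots> \<le> a + b" using x_le Phi_x_le by simp
    finally have norm_le: "norm ?p \<le> (a + b) / B"
      using B_pos by (simp add: le_divide_eq mult.commute)
    have "c i \<in> {-N..N}" if "i \<in> {1..d}" for i
    proof -
      have "\<bar>real_of_int (c i)\<bar> \<le> (a + b) / B"
        using abs_coord_le[of ?p i] norm_le unfolding coord_of_coords[OF that] by simp
      also have "\<dots> \<le> of_int N" unfolding N_def by (rule le_of_int_ceiling)
      finally have "\<bar>c i\<bar> \<le> N" by (simp flip: of_int_abs)
      then show ?thesis by auto
    qed
    then have "restrict c {1..d} \<in> (\<Pi>\<^sub>E i\<in>{1..d}. {-N..N})" by auto
    moreover have "x = power_comb (restrict c {1..d})"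
      unfolding x_eq power_comb_def by (intro sum.cong) auto
    ultimately show "x \<in> power_comb ` (\<Pi>\<^sub>E i\<in>{1..d}. {-N..N})" by blast
  qed
  then show ?thesis by (rule finite_subset) (intro finite_imageI finite_PiE; simp)
qed

lemma Z_relatively_dense: "\<exists>K. \<forall>t z. \<exists>x\<in>Z\<beta>. \<bar>x - t\<bar> \<le> K \<and> dist (\<Phi> x) z \<le> K"
proof -
  have "surj lattice_map" using linear_inj_imp_surj[OF linear_lattice_map inj_lattice_map] .
  obtain B where B_pos: "B > 0" and B_le: "\<And>p. norm (lattice_map p) \<le> B * norm p"
    using linear_bounded_pos[OF linear_lattice_map] by blast
  define K where "K = B * (1 + real CARD('n))"
  have "\<exists>x\<in>Z\<beta>. \<bar>x - t\<bar> \<le> K \<and> dist (\<Phi> x) z \<le> K" for t z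
  proof -
    obtain p where p_eq: "lattice_map p = (t, z)" using \<open>surj lattice_map\<close> by (metis surjD)
    define c where "c i = round (coord p i)" for i
    let ?q = "of_coords (\<lambda>i. of_int (c i))"
    have "\<bar>coord (?q - p) i\<bar> \<le> 1" if "i \<in> {1..d}" for i
    proof -
      have "coord (?q - p) i = of_int (c i) - coord p i"
        unfolding coord_diff coord_of_coords[OF that] ..
      then show ?thesis unfolding c_def using of_int_round_abs_le[of "coord p i"] by linarith
    qed
    then have "norm (?q - p) \<le> 1 + real CARD('n)" by (rule norm_le_if_abs_coord_le_1)
    then have "norm (lattice_map (?q - p)) \<le> K"
      unfolding K_def using B_pos B_le by (meson mult_left_mono order_trans less_imp_le)
    moreover have "lattice_map (?q - p) = (power_comb c - t, \<Phi> (power_comb c) - z)"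
      unfolding linear_diff[OF linear_lattice_map] lattice_map_of_coords p_eq by simp
    ultimately have "norm (power_comb c - t, \<Phi> (power_comb c) - z) \<le> K" by simp
    then have "\<bar>power_comb c - t\<bar> \<le> K" "dist (\<Phi> (power_comb c)) z \<le> K"
      using norm_fst_le[of "power_comb c - t" "\<Phi> (power_comb c) - z"]
        norm_snd_le[of "\<Phi> (power_comb c) - z" "power_comb c - t"] by (auto simp: dist_norm)
    then show ?thesis using power_comb_in_Z[of c] by blast
  qed
  then show ?thesis by blast
qed

sublocale bonacci_embedding d \<beta> conjugate_mult max_conjugate_norm \<Phi>
  by (intro bonacci_embedding.intro bonacci_axioms linear_contraction.intro
      bonacci_embedding_axioms.intro linear_conjugate_mult inj_conjugate_mult norm_conjugate_mult_le max_conjugate_norm_pos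
      max_conjugate_norm_less_1 Phi_add Phi_beta_mult finite_Z_bounded Z_relatively_dense)

section \<open>The layers\<close>

lemma sum_mult_coords: "(\<Sum>i\<in>{1..d}. mult_coords c i) = (int d - 1) * c 1 + (\<Sum>i\<in>{1..d}. c i)"
proof -
  have "(\<Sum>i\<in>{1..d}. mult_coords c i) = int d * c 1 + (\<Sum>i\<in>{1..d}. if i = d then 0 else c (Suc i))"
    unfolding mult_coords_def sum.distrib by simp
  also have "(\<Sum>i\<in>{1..d}. if i = d then 0 else c (Suc i)) = (\<Sum>i\<in>{1..d - 1}. c (Suc i))"
    by (rule sum.mono_neutral_cong_right) auto
  also have "\<dots> = (\<Sum>i\<in>{2..d}. c i)"
    by (rule sum.reindex_bij_witness[of _ "\<lambda>i. i - 1" Suc]) auto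
  also have "\<dots> = (\<Sum>i\<in>{1..d}. c i) - c 1"
  proof -
    have "{1..d} = insert 1 {2..d}" using d_ge by auto
    then show ?thesis by simp
  qed
  finally show ?thesis by (simp add: algebra_simps)
qed

lemma dvd_if_of_int_same_residue_0:
  assumes "same_residue \<beta> (of_int j) 0"
  shows "(int d - 1) dvd j"
proof -
  obtain z where "z \<in> Z\<beta>" "of_int j = (\<beta> - 1) * z" using assms unfolding same_residue_def by auto
  then obtain c where j_eq: "of_int j = (\<beta> - 1) * power_comb c"
    unfolding in_Z_iff_power_comb by blast
  have "power_comb (\<lambda>i. c i + (j - mult_coords c i))
      = power_comb c + (power_comb (\<lambda>_. j) - power_comb (mult_coords c))"
    unfolding power_comb_def sum_subtractf[symmetric] sum.distrib[symmetric]
    by (simp add: algebra_simps)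
  also have "\<dots> = 0"
    unfolding power_comb_const beta_mult_power_comb[symmetric] j_eq by (simp add: algebra_simps)
  finally have "c i + (j - mult_coords c i) = 0" if "i \<in> {1..d}" for i
    using power_comb_eq_0_imp[OF _ that] by blast
  then have "(\<Sum>i\<in>{1..d}. j) = (\<Sum>i\<in>{1..d}. mult_coords c i - c i)"
    by (intro sum.cong refl) fastforce
  then have "int d * j = (int d - 1) * c 1" unfolding sum_subtractf sum_mult_coords by simp
  then have "j = (int d - 1) * (c 1 - j)" by (simp add: algebra_simps)
  then show ?thesis by (rule dvdI)
qed

lemma layers_disjoint:
  assumes "h \<in> {1..d - 1}" "h' \<in> {1..d - 1}" "h \<noteq> h'"
  shows "layer (int h) \<inter> layer (int h') = {}"
proof (rule ccontr)
  assume "layer (int h) \<inter> layer (int h') \<noteq> {}"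
  then obtain v where "v \<in> layer (int h)" "v \<in> layer (int h')" by blast
  then have "same_residue \<beta> (of_int (int h')) (of_int (int h))"
    using same_residue_sym same_residue_trans unfolding layer_iff by blast
  then have "same_residue \<beta> (of_int (int h' - int h)) 0"
    using same_residue_diff_iff_0[of \<beta> "of_int (int h')"] by simp
  then have "(int d - 1) dvd (int h' - int h)" by (rule dvd_if_of_int_same_residue_0)
  then have "int d - 1 \<le> \<bar>int h' - int h\<bar>"
    using dvd_imp_le_int[of "int h' - int h" "int d - 1"] assms(3) d_ge by simp
  then show False using assms d_ge by auto
qed

lemma multiple_tiling_X_Z: "multiple_tiling (d - 1) (X \<inter> Z\<beta>) balanced_tile"
proof (rule multiple_tiling_balanced_tile[OF order_refl])
  show "\<exists>v\<in>X \<inter> Z\<beta>. z \<in> balanced_tile v" for z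
    using balanced_tiles_of_layer_cover[of 1 z] layer_subset by blast
  let ?tiles_at = "\<lambda>z h. {v \<in> layer (int h). z \<in> balanced_tile v}"
  have card_eq: "card {v \<in> X \<inter> Z\<beta>. z \<in> balanced_tile v} = d - 1"
    if one: "\<forall>h\<in>{1..d - 1}. card (?tiles_at z h) = 1" for z
  proof -
    have "{v \<in> X \<inter> Z\<beta>. z \<in> balanced_tile v} = (\<Union>h\<in>{1..d - 1}. ?tiles_at z h)"
      unfolding X_Z_eq_Union_layers by blast
    also have "card \<dots> = (\<Sum>h\<in>{1..d - 1}. card (?tiles_at z h))"
    proof (rule card_UN_disjoint)
      show "\<forall>h\<in>{1..d - 1}. finite (?tiles_at z h)"
        using one by (metis card.infinite zero_neq_one)
      show "\<forall>h\<in>{1..d - 1}. \<forall>h'\<in>{1..d - 1}. h \<noteq> h' \<longrightarrow> ?tiles_at z h \<inter> ?tiles_at z h' = {}"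
        using layers_disjoint by blast
    qed simp
    also have "\<dots> = d - 1" using one by simp
    finally show ?thesis .
  qed
  have "AE z in lborel. \<forall>h\<in>{1..d - 1}. card (?tiles_at z h) = 1"
    using AE_in_exactly_one_tile_of_layer by (intro AE_finite_allI) auto
  then show "AE z in lborel. card {v \<in> X \<inter> Z\<beta>. z \<in> balanced_tile v} = d - 1"
    by eventually_elim (rule card_eq)
qed

lemma tile_eq_balanced_tile:
  assumes "x \<in> XS \<beta>" "frac x \<in> Z\<beta>"
  shows "tile \<beta> e \<sigma> \<iota> x = balanced_tile (frac x)"
  unfolding tile_def using assms frac_in_Z_iff by (intro hausdorff_lim_eq_balanced_tile) auto

lemma multiple_tiling_tile:
  assumes "S \<subseteq> Z\<beta>" "multiple_tiling m (X \<inter> S) balanced_tile"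
  shows "multiple_tiling m {x \<in> XS \<beta>. frac x \<in> S} (tile \<beta> e \<sigma> \<iota>)"
  using assms tile_eq_balanced_tile
  by (intro multiple_tiling_reindex[OF assms(2) bij_betw_frac_XS_Int]) auto

end

theorem theorem2:
  fixes d e h :: nat and \<beta> :: real
    and \<gamma> :: "nat \<Rightarrow> complex" and \<sigma> :: "nat \<Rightarrow> real \<Rightarrow> complex"
    and \<iota> :: "'n::finite \<Rightarrow> nat"
  assumes "d \<ge> 3"
    and "dBonacci d \<beta>"
    and "h \<in> {1..d - 1}"
    and "conjugate_enumeration d \<beta> e \<gamma>"
    and "\<And>j. j \<in> {1..d - e - 1} \<Longrightarrow>
           field_iso_on (rat_field_adjoin \<beta>) (rat_field_adjoin (\<gamma> j)) (\<sigma> j) \<and> \<sigma> j \<beta> = \<gamma> j"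
    and "bij_betw \<iota> (UNIV :: 'n set) {1..d - 1}"
  shows "tiling (layer_index d \<beta> h) (tile \<beta> e \<sigma> \<iota>)
    \<and> layer_index d \<beta> h \<subseteq> int_adjoin \<beta> \<inter> XS \<beta>
    \<and> multiple_tiling (d - 1) (int_adjoin \<beta> \<inter> XS \<beta>) (tile \<beta> e \<sigma> \<iota>)"
proof -
  interpret bonacci_conjugates d \<beta> e \<gamma> \<sigma> \<iota>
    using assms(1,2,4,6) assms(5)
    by (intro bonacci_conjugates.intro bonacci.intro bonacci_conjugates_axioms.intro)
  have layer_in_Z: "layer (int h) \<subseteq> Z\<beta>" and "X \<inter> layer (int h) = layer (int h)"
    using layer_subset by auto
  then have "tiling (layer_index d \<beta> h) (tile \<beta> e \<sigma> \<iota>)"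
    unfolding layer_index_eq using tiling_layer multiple_tiling_tile[OF layer_in_Z]
    by (simp add: tiling_def)
  moreover have Z_XS_eq: "Z\<beta> \<inter> XS \<beta> = {x \<in> XS \<beta>. frac x \<in> Z\<beta>}" using frac_in_Z_iff by auto
  then have "layer_index d \<beta> h \<subseteq> Z\<beta> \<inter> XS \<beta>" unfolding layer_index_eq using layer_in_Z by auto
  moreover have "multiple_tiling (d - 1) (Z\<beta> \<inter> XS \<beta>) (tile \<beta> e \<sigma> \<iota>)"
    unfolding Z_XS_eq using multiple_tiling_X_Z by (rule multiple_tiling_tile[OF order_refl])
  ultimately show ?thesis by blast
qed

end
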